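(* Let $\mathfrak g$ be a non-compact semisimple Lie algebra with Cartan decomposition $\mathfrak g=\mathfrak k\oplus\mathfrak s$ and Cartan involution $\theta$, let $\mathfrak a\subset\mathfrak s$ be maximal abelian with a choice of positive Weyl chamber $\mathfrak a^+$, let $G=\mathrm{Aut}_0\,\mathfrak g$, and let $K\subset G$ be the connected subgroup with Lie algebra $\mathfrak k$. Let $H\in\mathrm{cl}(\mathfrak a^+)$ and $r>0$. Then the manifolds $\mathrm{Ad}(G)\cdot H$ and $\mathrm{Ad}_r(G)\cdot H$ are diffeomorphic by the map $$\widetilde\psi_r:\mathrm{Ad}(G)\cdot H\to\mathrm{Ad}_r(G)\cdot H,\qquad \widetilde\psi_r\big(\mathrm{Ad}(k)(H+X)\big)=\mathrm{Ad}(k)\big(H+\psi_r(X)\big),\quad k\in K,\ X\in\mathfrak n_H^+ .$$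
   Context: For $r>0$ let $T_r:\mathfrak g\to\mathfrak g$ be the linear map with $T_r(X)=rX$ for $X\in\mathfrak k$ and $T_r(Y)=Y$ for $Y\in\mathfrak s$, and let $\mathfrak g_r$ be the vector space $\mathfrak g$ with the Lie bracket $[X,Y]_r=T_r[T_r^{-1}X,T_r^{-1}Y]$. Let $G_r=\mathrm{Aut}_0\,\mathfrak g_r$ be the identity component of the automorphism group of $\mathfrak g_r$. $\mathrm{Ad}_r(G)\cdot H$ denotes the adjoint orbit of $H$ in $\mathfrak g_r$, i.e. the orbit of $H$ under $G_r$, viewed as a submanifold of the vector space $\mathfrak g$. The map $\psi_r:\mathfrak g\to\mathfrak g$ is $\psi_r(Z)=Z+\frac{r-1}{r+1}\theta Z$. With $\Pi$ the set of roots of $\mathfrak a$ and $\mathfrak g_\alpha$ the root spaces in $\mathfrak g$, $\mathfrak n_H^+=\sum_{\alpha(H)>0}\mathfrak g_\alpha$. One has $\mathrm{Ad}(G)\cdot H=\bigcup_{k\in K}\mathrm{Ad}(k)(H+\mathfrak n_H^+)$ and $\mathrm{Ad}_r(G)\cdot H=\bigcup_{k\in K}\mathrm{Ad}(k)(H+\psi_r(\mathfrak n_H^+))$. A complex $\mathfrak g$ is treated as a real Lie algebra. *)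

theory Defs
  imports "HOL-Analysis.Analysis"
begin

section \<open>Real Lie algebras\<close>

text \<open>A finite-dimensional real Lie algebra is a bracket \<open>br\<close> on a Euclidean space. The inner product
  of that space plays no role beyond inducing the canonical topology and smooth structure of a
  finite-dimensional real vector space.\<close>

definition lie_algebra :: "('g::euclidean_space \<Rightarrow> 'g \<Rightarrow> 'g) \<Rightarrow> bool" where
  "lie_algebra br \<longleftrightarrow> bilinear br \<and> (\<forall>X. br X X = 0) \<and>
     (\<forall>X Y Z. br X (br Y Z) + br Y (br Z X) + br Z (br X Y) = 0)"

definition lie_ideal :: "('g::euclidean_space \<Rightarrow> 'g \<Rightarrow> 'g) \<Rightarrow> 'g set \<Rightarrow> bool" where
  "lie_ideal br I \<longleftrightarrow> subspace I \<and> (\<forall>X. \<forall>Y\<in>I. br X Y \<in> I)"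

definition derived_algebra :: "('g::euclidean_space \<Rightarrow> 'g \<Rightarrow> 'g) \<Rightarrow> 'g set \<Rightarrow> 'g set" where
  "derived_algebra br I = span {br X Y | X Y. X \<in> I \<and> Y \<in> I}"

definition solvable :: "('g::euclidean_space \<Rightarrow> 'g \<Rightarrow> 'g) \<Rightarrow> 'g set \<Rightarrow> bool" where
  "solvable br I \<longleftrightarrow> (\<exists>n. (derived_algebra br ^^ n) I = {0})"

definition semisimple :: "('g::euclidean_space \<Rightarrow> 'g \<Rightarrow> 'g) \<Rightarrow> bool" where
  "semisimple br \<longleftrightarrow> lie_algebra br \<and> (\<forall>I. lie_ideal br I \<and> solvable br I \<longrightarrow> I = {0})"

definition trace_map :: "('g::euclidean_space \<Rightarrow> 'g) \<Rightarrow> real" where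
  "trace_map f = (\<Sum>b\<in>Basis. f b \<bullet> b)"

definition killing_form :: "('g::euclidean_space \<Rightarrow> 'g \<Rightarrow> 'g) \<Rightarrow> 'g \<Rightarrow> 'g \<Rightarrow> real" where
  "killing_form br X Y = trace_map (\<lambda>Z. br X (br Y Z))"

text \<open>For semisimple algebras: compactness means a negative definite Killing form.\<close>

definition compact_type :: "('g::euclidean_space \<Rightarrow> 'g \<Rightarrow> 'g) \<Rightarrow> bool" where
  "compact_type br \<longleftrightarrow> (\<forall>X. X \<noteq> 0 \<longrightarrow> killing_form br X X < 0)"

section \<open>Cartan decomposition, roots and chambers\<close>

definition cartan_involution :: "('g::euclidean_space \<Rightarrow> 'g \<Rightarrow> 'g) \<Rightarrow> ('g \<Rightarrow> 'g) \<Rightarrow> bool" where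
  "cartan_involution br \<theta> \<longleftrightarrow> linear \<theta> \<and> (\<forall>X. \<theta> (\<theta> X) = X) \<and>
     (\<forall>X Y. \<theta> (br X Y) = br (\<theta> X) (\<theta> Y)) \<and>
     (\<forall>X. X \<noteq> 0 \<longrightarrow> - killing_form br X (\<theta> X) > 0)"

definition cartan_k :: "('g::euclidean_space \<Rightarrow> 'g) \<Rightarrow> 'g set" where
  "cartan_k \<theta> = {X. \<theta> X = X}"

definition cartan_s :: "('g::euclidean_space \<Rightarrow> 'g) \<Rightarrow> 'g set" where
  "cartan_s \<theta> = {X. \<theta> X = - X}"

definition abelian_subspace :: "('g::euclidean_space \<Rightarrow> 'g \<Rightarrow> 'g) \<Rightarrow> 'g set \<Rightarrow> bool" where
  "abelian_subspace br V \<longleftrightarrow> subspace V \<and> (\<forall>X\<in>V. \<forall>Y\<in>V. br X Y = 0)"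

definition maximal_abelian_in :: "('g::euclidean_space \<Rightarrow> 'g \<Rightarrow> 'g) \<Rightarrow> 'g set \<Rightarrow> 'g set \<Rightarrow> bool" where
  "maximal_abelian_in br S \<aa> \<longleftrightarrow> abelian_subspace br \<aa> \<and> \<aa> \<subseteq> S \<and>
     (\<forall>V. abelian_subspace br V \<and> \<aa> \<subseteq> V \<and> V \<subseteq> S \<longrightarrow> V = \<aa>)"

definition root_space :: "('g::euclidean_space \<Rightarrow> 'g \<Rightarrow> 'g) \<Rightarrow> 'g set \<Rightarrow> ('g \<Rightarrow> real) \<Rightarrow> 'g set" where
  "root_space br \<aa> \<alpha> = {X. \<forall>A\<in>\<aa>. br A X = \<alpha> A *\<^sub>R X}"

text \<open>A linear functional on \<open>\<aa>\<close> is represented by a function that is \<open>extensional\<close> on \<open>\<aa>\<close>, so that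
  distinct elements of \<open>roots\<close> are distinct functionals on \<open>\<aa>\<close>.\<close>

definition roots :: "('g::euclidean_space \<Rightarrow> 'g \<Rightarrow> 'g) \<Rightarrow> 'g set \<Rightarrow> ('g \<Rightarrow> real) set" where
  "roots br \<aa> = {\<alpha> \<in> extensional \<aa>.
     (\<forall>A\<in>\<aa>. \<forall>B\<in>\<aa>. \<alpha> (A + B) = \<alpha> A + \<alpha> B) \<and> (\<forall>c. \<forall>A\<in>\<aa>. \<alpha> (c *\<^sub>R A) = c * \<alpha> A) \<and>
     (\<exists>A\<in>\<aa>. \<alpha> A \<noteq> 0) \<and> root_space br \<aa> \<alpha> \<noteq> {0}}"

definition weyl_chamber :: "('g::euclidean_space \<Rightarrow> 'g \<Rightarrow> 'g) \<Rightarrow> 'g set \<Rightarrow> 'g set \<Rightarrow> bool" where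
  "weyl_chamber br \<aa> C \<longleftrightarrow> C \<in> components {A \<in> \<aa>. \<forall>\<alpha>\<in>roots br \<aa>. \<alpha> A \<noteq> 0}"

definition n_plus :: "('g::euclidean_space \<Rightarrow> 'g \<Rightarrow> 'g) \<Rightarrow> 'g set \<Rightarrow> 'g \<Rightarrow> 'g set" where
  "n_plus br \<aa> H = span (\<Union>\<alpha>\<in>{\<alpha> \<in> roots br \<aa>. \<alpha> H > 0}. root_space br \<aa> \<alpha>)"

section \<open>Linear Lie groups\<close>

definition lie_automorphisms :: "('g::euclidean_space \<Rightarrow> 'g \<Rightarrow> 'g) \<Rightarrow> ('g \<Rightarrow>\<^sub>L 'g) set" where
  "lie_automorphisms br = {g. bij (blinfun_apply g) \<and> (\<forall>X Y. g (br X Y) = br (g X) (g Y))}"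

definition Aut0 :: "('g::euclidean_space \<Rightarrow> 'g \<Rightarrow> 'g) \<Rightarrow> ('g \<Rightarrow>\<^sub>L 'g) set" where
  "Aut0 br = connected_component_set (lie_automorphisms br) id_blinfun"

definition blinfun_exp :: "('g::euclidean_space \<Rightarrow>\<^sub>L 'g) \<Rightarrow> ('g \<Rightarrow>\<^sub>L 'g)" where
  "blinfun_exp A = (\<Sum>n. (1 / fact n) *\<^sub>R (((o\<^sub>L) A) ^^ n) id_blinfun)"

definition linear_group :: "('g::euclidean_space \<Rightarrow>\<^sub>L 'g) set \<Rightarrow> bool" where
  "linear_group K \<longleftrightarrow> id_blinfun \<in> K \<and> (\<forall>g\<in>K. \<forall>h\<in>K. g o\<^sub>L h \<in> K) \<and>
     (\<forall>g\<in>K. \<exists>h\<in>K. g o\<^sub>L h = id_blinfun \<and> h o\<^sub>L g = id_blinfun)"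

definition lie_algebra_of :: "('g::euclidean_space \<Rightarrow>\<^sub>L 'g) set \<Rightarrow> ('g \<Rightarrow>\<^sub>L 'g) set" where
  "lie_algebra_of K = {A. \<forall>t. blinfun_exp (t *\<^sub>R A) \<in> K}"

text \<open>Connected Lie subgroups of the general linear group in the sense of matrix Lie theory: the Lie
  algebra is a subspace and every element is a finite product of its exponentials. No closedness is
  imposed.\<close>

definition connected_lie_subgroup :: "('g::euclidean_space \<Rightarrow>\<^sub>L 'g) set \<Rightarrow> bool" where
  "connected_lie_subgroup K \<longleftrightarrow> linear_group K \<and> subspace (lie_algebra_of K) \<and>
     (\<forall>g\<in>K. \<exists>As. set As \<subseteq> lie_algebra_of K \<and>
        g = foldr (\<lambda>A h. blinfun_exp A o\<^sub>L h) As id_blinfun)"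

definition ad :: "('g::euclidean_space \<Rightarrow> 'g \<Rightarrow> 'g) \<Rightarrow> 'g \<Rightarrow> ('g \<Rightarrow>\<^sub>L 'g)" where
  "ad br X = Blinfun (br X)"

text \<open>For semisimple \<open>\<gg>\<close>, the Lie algebra of \<open>G = Aut\<^sub>0 \<gg>\<close> is \<open>ad \<gg>\<close>, and
  \<open>g \<circ> ad X \<circ> g\<^sup>-\<^sup>1 = ad (g X)\<close>. Under the identification \<open>\<gg> = ad \<gg>\<close>, \<open>Ad(g)\<close> therefore acts on \<open>\<gg>\<close>
  as the linear map \<open>g\<close> itself.\<close>

definition adjoint_orbit :: "('g::euclidean_space \<Rightarrow> 'g \<Rightarrow> 'g) \<Rightarrow> 'g \<Rightarrow> 'g set" where
  "adjoint_orbit br H = (\<lambda>g. blinfun_apply g H) ` Aut0 br"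

section \<open>The deformed algebras\<close>

definition deform :: "('g::euclidean_space \<Rightarrow> 'g) \<Rightarrow> real \<Rightarrow> 'g \<Rightarrow> 'g" where
  "deform \<theta> r Z = r *\<^sub>R ((1/2) *\<^sub>R (Z + \<theta> Z)) + (1/2) *\<^sub>R (Z - \<theta> Z)"

lemma deform_k: "X \<in> cartan_k \<theta> \<Longrightarrow> deform \<theta> r X = r *\<^sub>R X"
  by (simp add: deform_def cartan_k_def flip: scaleR_2)

lemma deform_s: "Y \<in> cartan_s \<theta> \<Longrightarrow> deform \<theta> r Y = Y"
  by (simp add: deform_def cartan_s_def flip: scaleR_2)

lemma linear_deform:
  assumes "linear \<theta>"
  shows "linear (deform \<theta> r)"
proof -
  interpret linear \<theta> by fact
  show ?thesis
    by (rule linearI) (simp_all add: deform_def add scale algebra_simps)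
qed

definition deformed_bracket ::
  "('g::euclidean_space \<Rightarrow> 'g \<Rightarrow> 'g) \<Rightarrow> ('g \<Rightarrow> 'g) \<Rightarrow> real \<Rightarrow> 'g \<Rightarrow> 'g \<Rightarrow> 'g" where
  "deformed_bracket br \<theta> r X Y = deform \<theta> r (br (inv (deform \<theta> r) X) (inv (deform \<theta> r) Y))"

definition psi :: "('g::euclidean_space \<Rightarrow> 'g) \<Rightarrow> real \<Rightarrow> 'g \<Rightarrow> 'g" where
  "psi \<theta> r Z = Z + ((r - 1) / (r + 1)) *\<^sub>R \<theta> Z"

section \<open>Submanifolds of a vector space and diffeomorphisms\<close>

text \<open>\<open>Ck_on n f U\<close>, for open \<open>U\<close>: \<open>f\<close> is of class \<open>C\<^sup>n\<close> on \<open>U\<close>.\<close>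

fun Ck_on :: "nat \<Rightarrow> ('a::euclidean_space \<Rightarrow> 'b::euclidean_space) \<Rightarrow> 'a set \<Rightarrow> bool" where
  "Ck_on 0 f U \<longleftrightarrow> continuous_on U f"
| "Ck_on (Suc n) f U \<longleftrightarrow> (\<forall>x\<in>U. f differentiable (at x)) \<and>
     (\<forall>v. Ck_on n (\<lambda>x. frechet_derivative f (at x) v) U)"

text \<open>Smoothness on an arbitrary subset means local extendability to smooth maps on open sets; on an
  embedded submanifold this is smoothness in the sense of manifolds.\<close>

definition smooth_map_on :: "('a::euclidean_space \<Rightarrow> 'b::euclidean_space) \<Rightarrow> 'a set \<Rightarrow> bool" where
  "smooth_map_on f M \<longleftrightarrow> (\<forall>x\<in>M. \<exists>U F. open U \<and> x \<in> U \<and> (\<forall>n. Ck_on n F U) \<and>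
     (\<forall>y\<in>M \<inter> U. F y = f y))"

definition diffeomorphism ::
  "('a::euclidean_space \<Rightarrow> 'b::euclidean_space) \<Rightarrow> 'a set \<Rightarrow> 'b set \<Rightarrow> bool" where
  "diffeomorphism f M N \<longleftrightarrow> bij_betw f M N \<and> smooth_map_on f M \<and> smooth_map_on (inv_into M f) N"

definition embedded_submanifold :: "'a::euclidean_space set \<Rightarrow> bool" where
  "embedded_submanifold M \<longleftrightarrow> (\<exists>d. \<forall>x\<in>M. \<exists>U V L \<phi>. open U \<and> x \<in> U \<and> open (V :: 'a set) \<and>
     subspace L \<and> dim L = d \<and> diffeomorphism \<phi> U V \<and> \<phi> ` (M \<inter> U) = L \<inter> V)"

end

theory Submission
  imports Defs
begin

text \<open>
  Write \<open>O\<close> for the orbit of \<open>H\<close>, \<open>n\<close> for the sum of the eigenspaces of \<open>ad H\<close> with positive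
  eigenvalue, and \<open>T\<close> for \<open>deform \<theta> r\<close>. Since \<open>T\<close> is an isomorphism onto the deformed algebra and fixes
  \<open>H\<close>, the deformed orbit is \<open>T O\<close>; as \<open>psi \<theta> r X = T (c X)\<close> with \<open>c = 2 / (r + 1)\<close> and \<open>K\<close> commutes
  with \<open>T\<close>, the map of the theorem is \<open>T\<close> after \<open>k (H + X) \<mapsto> k (H + c X)\<close>. Everything therefore reduces
  to showing that \<open>k (H + X) \<mapsto> k X\<close> is well defined and smooth. It is, because \<open>k X\<close> is the orthogonal
  projection of \<open>z = k (H + X)\<close> onto the sum of the positive eigenspaces of \<open>ad z\<close>. If the product of
  polynomials \<open>p q\<close> annihilates \<open>ad H\<close>, with the positive roots in \<open>q\<close> and the others in \<open>p\<close>, this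
  projection is \<open>B B\<^sup>* (B B\<^sup>* + C\<^sup>* C)\<^sup>-\<^sup>1\<close> for \<open>B = p (ad z)\<close> and \<open>C = q (ad z)\<close>, and the
  adjoints are the same polynomials in \<open>- ad (\<theta> z)\<close>.

  That \<open>O\<close> is a submanifold follows from the inverse function theorem and a rigidity property of the
  equation \<open>(p q) (ad z) = 0\<close>, which holds on \<open>O\<close> and cuts out the orbit near \<open>H\<close>. The same two
  ingredients show that \<open>K (H + n)\<close> is open in \<open>O\<close>. It is also closed in \<open>O\<close>: if \<open>k\<^sub>i (H + X\<^sub>i)\<close> tends to
  \<open>z\<close>, then \<open>X\<^sub>i\<close> has a limit \<open>X\<close> along a subsequence, along which \<open>k\<^sub>i\<^sup>-\<^sup>1 z\<close> tends to \<open>H + X\<close> and is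
  eventually in the open set \<open>K (H + n)\<close>. As \<open>O\<close> is connected, \<open>O = K (H + n)\<close>.
\<close>

section \<open>Calculus of smooth maps\<close>

text \<open>The decomposition z = k (H + X) need not determine k or X, and it offers no canonical
  smooth choice of k; this is why k X has to be recovered from z alone. Orthogonality achieves it: k
  is an isometry of the Cartan inner product, and H, an eigenvector of ad H with eigenvalue 0, is
  orthogonal to \<open>n\<close>, so k H is orthogonal to the image of \<open>n\<close> under k.
  That image is the positive part of ad z because H + X = g H for an automorphism g that preserves
  \<open>n\<close>. A formula rational in z is wanted because smoothness on the orbit means
  extension to open sets of the surrounding space, where ad z may fail to be diagonalizable.

  No global Iwasawa decomposition is invoked. Its infinitesimal form, that the Lie algebra is
  spanned by the fixed points of \<theta>, by \<open>n\<close> and by the centralizer of H, gives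
  local statements at every point H + X, and the clopen argument makes them global. The uniform
  bound on \<open>K\<close> that comes from the invariant inner product stands in for compactness.
  Rigidity comes from the gaps between the eigenvalues of ad H: a small change of H inside its
  centralizer cannot preserve an annihilating polynomial with simple roots.\<close>

lemma Ck_on_cong:
  assumes "open U" "\<And>x. x \<in> U \<Longrightarrow> f x = g x" "Ck_on n f U"
  shows "Ck_on n g U"
  using assms
proof (induction n arbitrary: f g)
  case 0
  then show ?case by (simp cong: continuous_on_cong)
next
  case (Suc n)
  have "(g has_derivative frechet_derivative f (at x)) (at x)" if "x \<in> U" for x
    using Suc.prems that has_derivative_transform_within_open
    by (metis Ck_on.simps(2) frechet_derivative_works)
  then have "frechet_derivative g (at x) = frechet_derivative f (at x)" "g differentiable at x"
    if "x \<in> U" for x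
    using that by (metis frechet_derivative_at, metis differentiable_def)
  with Suc show ?case by (metis (no_types, lifting) Ck_on.simps(2))
qed

text \<open>\<open>Ck_on\<close> refers to \<open>frechet_derivative\<close>; here any closed form
  of the derivative may take its place, so that regularity is proved by differentiating once and
  inducting on n.\<close>

lemma Ck_on_Suc_intro:
  assumes "\<And>x. x \<in> U \<Longrightarrow> (f has_derivative f' x) (at x)" "open U" "\<And>v. Ck_on n (\<lambda>x. f' x v) U"
  shows "Ck_on (Suc n) f U"
proof -
  have "f' x = frechet_derivative f (at x)" if "x \<in> U" for x
    using assms(1)[OF that] by (metis frechet_derivative_at)
  then have "Ck_on n (\<lambda>x. frechet_derivative f (at x) v) U" for v
    by (intro Ck_on_cong[OF assms(2) _ assms(3)[of v]]) auto
  then show ?thesis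
    using assms(1) by (auto simp: differentiable_def)
qed

lemma Ck_on_SucD:
  assumes "Ck_on (Suc n) f U" "x \<in> U"
  shows "(f has_derivative frechet_derivative f (at x)) (at x)"
  using assms by (simp add: frechet_derivative_works)

lemma Ck_on_imp_continuous_on: "Ck_on n f U \<Longrightarrow> continuous_on U f"
  by (cases n) (auto intro!: continuous_at_imp_continuous_on differentiable_imp_continuous_within)

lemma Ck_on_Suc_imp: "Ck_on (Suc n) f U \<Longrightarrow> Ck_on n f U"
proof (induction n arbitrary: f)
  case 0
  then show ?case using Ck_on_imp_continuous_on Ck_on.simps(1) by blast
next
  case (Suc n)
  then show ?case by (metis Ck_on.simps(2))
qed

lemma Ck_on_subset: "Ck_on n f U \<Longrightarrow> V \<subseteq> U \<Longrightarrow> Ck_on n f V"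
  by (induction n arbitrary: f) (auto intro: continuous_on_subset)

lemma Ck_on_const: "open U \<Longrightarrow> Ck_on n (\<lambda>x. c) U"
proof (induction n arbitrary: c)
  case (Suc n)
  then show ?case by (intro Ck_on_Suc_intro[where f' = "\<lambda>x v. 0"]) auto
qed simp

lemma Ck_on_linear:
  fixes L :: "'a::euclidean_space \<Rightarrow> 'b::euclidean_space"
  assumes "linear L" "open U"
  shows "Ck_on n L U"
proof -
  have L: "bounded_linear L" using assms(1) by (simp add: linear_linear)
  show ?thesis
  proof (cases n)
    case 0
    then show ?thesis using L by (simp add: linear_continuous_on)
  next
    case (Suc m)
    show ?thesis unfolding Suc
      by (rule Ck_on_Suc_intro[where f' = "\<lambda>x. L"])
        (use L assms(2) in \<open>auto intro: Ck_on_const bounded_linear_imp_has_derivative\<close>)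
  qed
qed

lemma Ck_on_linear_compose:
  assumes "bounded_linear L" "Ck_on n f U" "open U"
  shows "Ck_on n (\<lambda>x. L (f x)) U"
  using assms(2)
proof (induction n arbitrary: f)
  case 0
  then show ?case using assms(1) by (simp add: bounded_linear.continuous_on)
next
  case (Suc n)
  show ?case
  proof (rule Ck_on_Suc_intro[where f' = "\<lambda>x v. L (frechet_derivative f (at x) v)"])
    show "((\<lambda>x. L (f x)) has_derivative (\<lambda>v. L (frechet_derivative f (at x) v))) (at x)" if "x \<in> U" for x
      using Ck_on_SucD[OF Suc.prems that] assms(1) by (rule bounded_linear.has_derivative[rotated])
  qed (use Suc assms in auto)
qed

lemma Ck_on_add:
  assumes "Ck_on n f U" "Ck_on n g U" "open U"
  shows "Ck_on n (\<lambda>x. f x + g x) U"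
  using assms(1,2)
proof (induction n arbitrary: f g)
  case 0
  then show ?case by (simp add: continuous_on_add)
next
  case (Suc n)
  show ?case
  proof (rule Ck_on_Suc_intro[where
        f' = "\<lambda>x v. frechet_derivative f (at x) v + frechet_derivative g (at x) v"])
    show "((\<lambda>x. f x + g x) has_derivative
        (\<lambda>v. frechet_derivative f (at x) v + frechet_derivative g (at x) v)) (at x)" if "x \<in> U" for x
      using Ck_on_SucD[OF Suc.prems(1) that] Ck_on_SucD[OF Suc.prems(2) that]
      by (rule has_derivative_add)
  qed (use Suc assms in auto)
qed

lemma Ck_on_minus: "Ck_on n f U \<Longrightarrow> open U \<Longrightarrow> Ck_on n (\<lambda>x. - f x) U"
  by (rule Ck_on_linear_compose[OF bounded_linear_minus[OF bounded_linear_ident]])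

lemma Ck_on_diff:
  assumes "Ck_on n f U" "Ck_on n g U" "open U"
  shows "Ck_on n (\<lambda>x. f x - g x) U"
  using Ck_on_add[OF assms(1) Ck_on_minus[OF assms(2,3)] assms(3)] by simp

lemma Ck_on_sum:
  "\<lbrakk>\<And>i. i \<in> I \<Longrightarrow> Ck_on n (f i) U; open U\<rbrakk> \<Longrightarrow> Ck_on n (\<lambda>x. \<Sum>i\<in>I. f i x) U"
  by (induction I rule: infinite_finite_induct) (auto intro: Ck_on_const Ck_on_add)

lemma Ck_on_bilinear:
  fixes prod :: "'a::euclidean_space \<Rightarrow> 'b::euclidean_space \<Rightarrow> 'c::euclidean_space"
    (infixl \<open>\<star>\<close> 70)
  assumes prod: "bounded_bilinear prod" and "Ck_on n f U" "Ck_on n g U" "open U"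
  shows "Ck_on n (\<lambda>x. f x \<star> g x) U"
  using assms(2,3)
proof (induction n arbitrary: f g)
  case 0
  then show ?case by (simp add: bounded_bilinear.continuous_on[OF prod])
next
  case (Suc n)
  show ?case
  proof (rule Ck_on_Suc_intro[where
        f' = "\<lambda>x v. f x \<star> frechet_derivative g (at x) v + frechet_derivative f (at x) v \<star> g x"])
    show "((\<lambda>x. f x \<star> g x) has_derivative
        (\<lambda>v. f x \<star> frechet_derivative g (at x) v + frechet_derivative f (at x) v \<star> g x)) (at x)"
      if "x \<in> U" for x
      using Ck_on_SucD[OF Suc.prems(1) that] Ck_on_SucD[OF Suc.prems(2) that]
      by (rule bounded_bilinear.FDERIV[OF prod])
    show "Ck_on n (\<lambda>x. f x \<star> frechet_derivative g (at x) v + frechet_derivative f (at x) v \<star> g x) U" for v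
      using Suc.prems Suc.prems[THEN Ck_on_Suc_imp] by (intro Ck_on_add Suc.IH assms(4)) auto
  qed (use assms in auto)
qed

lemma Ck_on_compose:
  fixes f :: "'a::euclidean_space \<Rightarrow> 'b::euclidean_space" and g :: "'b \<Rightarrow> 'c::euclidean_space"
  assumes "Ck_on n f U" "Ck_on n g V" "f ` U \<subseteq> V" "open U" "open V"
  shows "Ck_on n (\<lambda>x. g (f x)) U"
  using assms(1,2)
proof (induction n arbitrary: g)
  case 0
  then show ?case using assms(3) by (auto intro: continuous_on_compose2)
next
  case (Suc n)
  let ?f' = "\<lambda>x. frechet_derivative f (at x)" and ?g' = "\<lambda>y. frechet_derivative g (at y)"
  have lin: "linear (?g' (f x))" if "x \<in> U" for x
    using Ck_on_SucD[OF Suc.prems(2), of "f x"] assms(3) that has_derivative_linear by blast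
  show ?case
  proof (rule Ck_on_Suc_intro[where f' = "\<lambda>x v. ?g' (f x) (?f' x v)"])
    show "((\<lambda>x. g (f x)) has_derivative (\<lambda>v. ?g' (f x) (?f' x v))) (at x)" if "x \<in> U" for x
      using diff_chain_at[OF Ck_on_SucD[OF Suc.prems(1) that] Ck_on_SucD[OF Suc.prems(2), of "f x"]]
        assms(3) that by (auto simp: o_def)
    fix v
    \<comment> \<open>The direction \<open>?f' x v\<close> moves with x, while \<open>Ck_on\<close>
      controls \<open>?g'\<close> in fixed directions only; expanding in the basis separates the
      two.\<close>
    have "Ck_on n (\<lambda>x. \<Sum>b\<in>Basis. (?f' x v \<bullet> b) *\<^sub>R ?g' (f x) b) U"
      using Suc.prems Suc.prems(1)[THEN Ck_on_Suc_imp] assms(4)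
      by (intro Ck_on_sum Ck_on_bilinear[OF bounded_bilinear_scaleR] Suc.IH
          Ck_on_linear_compose[OF bounded_linear_inner_left]) auto
    then show "Ck_on n (\<lambda>x. ?g' (f x) (?f' x v)) U"
    proof (rule Ck_on_cong[OF assms(4), rotated])
      fix x assume "x \<in> U"
      have "?g' (f x) (?f' x v) = ?g' (f x) (\<Sum>b\<in>Basis. (?f' x v \<bullet> b) *\<^sub>R b)"
        by (simp add: euclidean_representation)
      also have "\<dots> = (\<Sum>b\<in>Basis. (?f' x v \<bullet> b) *\<^sub>R ?g' (f x) b)"
        using lin[OF \<open>x \<in> U\<close>] by (simp add: linear_sum linear_cmul)
      finally show "(\<Sum>b\<in>Basis. (?f' x v \<bullet> b) *\<^sub>R ?g' (f x) b) = ?g' (f x) (?f' x v)" ..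
    qed
  qed (use assms in auto)
qed

lemma Ck_on_family_apply:
  fixes M :: "'a::euclidean_space \<Rightarrow> 'b::euclidean_space \<Rightarrow> 'c::euclidean_space"
  assumes "open U" "\<And>x. x \<in> U \<Longrightarrow> linear (M x)" "\<And>v. Ck_on n (\<lambda>x. M x v) U" "Ck_on n f U"
  shows "Ck_on n (\<lambda>x. M x (f x)) U"
proof -
  have "Ck_on n (\<lambda>x. \<Sum>b\<in>Basis. (f x \<bullet> b) *\<^sub>R M x b) U"
    using assms by (intro Ck_on_sum Ck_on_bilinear[OF bounded_bilinear_scaleR]
          Ck_on_linear_compose[OF bounded_linear_inner_left]) auto
  then show ?thesis
  proof (rule Ck_on_cong[OF assms(1), rotated])
    fix x assume "x \<in> U"
    have "M x (f x) = M x (\<Sum>b\<in>Basis. (f x \<bullet> b) *\<^sub>R b)"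
      by (simp add: euclidean_representation)
    also have "\<dots> = (\<Sum>b\<in>Basis. (f x \<bullet> b) *\<^sub>R M x b)"
      using assms(2)[OF \<open>x \<in> U\<close>] by (simp add: linear_sum linear_cmul)
    finally show "(\<Sum>b\<in>Basis. (f x \<bullet> b) *\<^sub>R M x b) = M x (f x)" ..
  qed
qed

subsection \<open>Inverses of families of linear maps\<close>

text \<open>Half of the lower bound at x0 survives a small perturbation. The quantitative form gives
  both the continuity of inverse families and a neighbourhood on which \<open>gram\<close> stays
  invertible.\<close>

lemma linear_family_bounded_below:
  fixes M :: "'a::metric_space \<Rightarrow> 'b::euclidean_space \<Rightarrow> 'c::euclidean_space"
  assumes "open U" "\<And>x. x \<in> U \<Longrightarrow> linear (M x)" "\<And>v. continuous_on U (\<lambda>x. M x v)"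
    and "x0 \<in> U" "inj (M x0)"
  obtains V c where "open V" "x0 \<in> V" "V \<subseteq> U" "c > 0" "\<And>x v. x \<in> V \<Longrightarrow> c * norm v \<le> norm (M x v)"
proof -
  obtain c where c: "c > 0" "\<And>v. c * norm v \<le> norm (M x0 v)"
    using linear_inj_bounded_below_pos assms(2,4,5) by metis
  \<comment> \<open>The values on the basis dominate the operator norm of the difference and are
    visibly continuous in x.\<close>
  define h where "h x = (\<Sum>b\<in>Basis. norm (M x b - M x0 b))" for x
  have "continuous_on U h"
    unfolding h_def using assms(3) by (intro continuous_intros)
  then have "open (U \<inter> h -` {..<c/2})"
    using assms(1) by (simp add: continuous_on_open_vimage Int_commute)
  moreover have "x0 \<in> U \<inter> h -` {..<c/2}"
    using assms(4) c by (simp add: h_def)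
  moreover have "c/2 * norm v \<le> norm (M x v)" if "x \<in> U \<inter> h -` {..<c/2}" for x v
  proof -
    have lin: "linear (\<lambda>v. M x v - M x0 v)"
      using that assms by (intro linear_compose_sub) auto
    have "M x v - M x0 v = (\<Sum>b\<in>Basis. (v \<bullet> b) *\<^sub>R (M x b - M x0 b))"
      using linear_sum[OF lin, of "\<lambda>b. (v \<bullet> b) *\<^sub>R b" Basis] linear_cmul[OF lin]
      by (simp add: euclidean_representation)
    also have "norm \<dots> \<le> (\<Sum>b\<in>Basis. norm v * norm (M x b - M x0 b))"
      by (rule sum_norm_le) (auto intro!: mult_right_mono Basis_le_norm)
    also have "\<dots> = norm v * h x" by (simp add: h_def sum_distrib_left)
    also have "\<dots> \<le> norm v * (c/2)" using that by (intro mult_left_mono) auto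
    finally have "norm (M x v - M x0 v) \<le> norm v * (c/2)" .
    moreover have "norm (M x0 v) \<le> norm (M x v) + norm (M x v - M x0 v)"
      by (metis norm_minus_commute norm_triangle_sub)
    ultimately show ?thesis using c(2)[of v] by (simp add: algebra_simps)
  qed
  ultimately show ?thesis using that[of "U \<inter> h -` {..<c/2}" "c/2"] c by auto
qed

text \<open>A product rule in which g is merely continuous: as h vanishes at x, the term with g y -
  g x is o(y - x). It lets an inverse be differentiated when so far only its continuity is
  known.\<close>

lemma has_derivative_scaleR_vanishing:
  fixes h :: "'a::real_normed_vector \<Rightarrow> real" and g :: "'a \<Rightarrow> 'b::real_normed_vector"
  assumes "(h has_derivative h') (at x)" "h x = 0" "isCont g x"
  shows "((\<lambda>y. h y *\<^sub>R g y) has_derivative (\<lambda>v. h' v *\<^sub>R g x)) (at x)"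
proof -
  have h': "bounded_linear h'" using assms(1) has_derivative_bounded_linear by blast
  have "((\<lambda>y. h y *\<^sub>R g x) has_derivative (\<lambda>v. h' v *\<^sub>R g x)) (at x)"
    using assms(1) by (rule has_derivative_scaleR_left)
  moreover have "((\<lambda>y. h y *\<^sub>R (g y - g x)) has_derivative (\<lambda>v. 0)) (at x)"
    unfolding has_derivative_at
  proof (intro conjI bounded_linear_zero)
    obtain B where B: "\<And>v. norm (h' v) \<le> norm v * B"
      using bounded_linear.bounded[OF h'] by blast
    have q: "((\<lambda>v. norm (h (x + v) - h x - h' v) / norm v) \<longlongrightarrow> 0) (at 0)"
      using assms(1) by (simp add: has_derivative_at)
    have g0: "((\<lambda>v. norm (g (x + v) - g x)) \<longlongrightarrow> 0) (at 0)"
      using assms(3) by (simp add: isCont_iff LIM_zero_iff tendsto_norm_zero_iff)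
    have "((\<lambda>v. (norm (h (x + v) - h x - h' v) / norm v + B) * norm (g (x + v) - g x)) \<longlongrightarrow> (0 + B) * 0) (at 0)"
      by (intro tendsto_intros q g0)
    then have *: "((\<lambda>v. (norm (h (x + v) - h x - h' v) / norm v + B) * norm (g (x + v) - g x)) \<longlongrightarrow> 0) (at 0)"
      by simp
    show "((\<lambda>v. norm (h (x + v) *\<^sub>R (g (x + v) - g x) - h x *\<^sub>R (g x - g x) - 0) / norm v) \<longlongrightarrow> 0) (at 0)"
    proof (rule Lim_null_comparison[OF _ *], rule eventuallyI)
      fix v :: 'a
      show "norm (norm (h (x + v) *\<^sub>R (g (x + v) - g x) - h x *\<^sub>R (g x - g x) - 0) / norm v)
        \<le> (norm (h (x + v) - h x - h' v) / norm v + B) * norm (g (x + v) - g x)"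
      proof (cases "v = 0")
        case True
        then show ?thesis by simp
      next
        case False
        have "norm (h (x + v)) \<le> norm (h (x + v) - h x - h' v) + norm v * B"
          using B[of v] assms(2) by simp
        then have "norm (h (x + v)) / norm v \<le> norm (h (x + v) - h x - h' v) / norm v + B"
          using False by (simp add: field_simps)
        from mult_right_mono[OF this, of "norm (g (x + v) - g x)"] show ?thesis
          by simp
      qed
    qed
  qed
  ultimately have "((\<lambda>y. h y *\<^sub>R g x + h y *\<^sub>R (g y - g x)) has_derivative (\<lambda>v. h' v *\<^sub>R g x + 0)) (at x)"
    by (rule has_derivative_add)
  then show ?thesis by (simp flip: scaleR_add_right)
qed

text \<open>With u = N x0 v, applying M x to N x v - u gives M x0 u - M x u, which tends to 0; the
  uniform lower bound on M then controls N x v - u.\<close>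

lemma inverse_family_continuous:
  fixes M :: "'a::metric_space \<Rightarrow> 'b::euclidean_space \<Rightarrow> 'b"
  assumes "open U" "\<And>x. x \<in> U \<Longrightarrow> linear (M x)" "\<And>v. continuous_on U (\<lambda>x. M x v)"
    and N: "\<And>x. x \<in> U \<Longrightarrow> linear (N x)" "\<And>x v. x \<in> U \<Longrightarrow> N x (M x v) = v"
      "\<And>x v. x \<in> U \<Longrightarrow> M x (N x v) = v"
  shows "continuous_on U (\<lambda>x. N x v)"
proof (rule continuous_at_imp_continuous_on, rule ballI)
  fix x0 assume x0: "x0 \<in> U"
  have "inj (M x0)" using N(2)[OF x0] by (metis injI)
  then obtain V c where V: "open V" "x0 \<in> V" "V \<subseteq> U" "c > 0"
    and c: "\<And>x v. x \<in> V \<Longrightarrow> c * norm v \<le> norm (M x v)"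
    using linear_family_bounded_below[OF assms(1,2,3) x0] by blast
  let ?u = "N x0 v"
  have "isCont (\<lambda>x. M x ?u) x0"
    using assms(3) assms(1) x0 continuous_on_eq_continuous_at by blast
  then have "((\<lambda>x. M x ?u) \<longlongrightarrow> M x0 ?u) (at x0)" by (simp add: isCont_def)
  then have *: "((\<lambda>x. norm (M x0 ?u - M x ?u) / c) \<longlongrightarrow> norm (M x0 ?u - M x0 ?u) / c) (at x0)"
    using V(4) by (intro tendsto_intros) auto
  have "((\<lambda>x. N x v - N x0 v) \<longlongrightarrow> 0) (at x0)"
  proof (rule Lim_null_comparison)
    show "\<forall>\<^sub>F x in at x0. norm (N x v - N x0 v) \<le> norm (M x0 ?u - M x ?u) / c"
    proof (rule eventually_at_topological[THEN iffD2], intro exI conjI ballI impI)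
      fix x assume "x \<in> V"
      then have x: "x \<in> U" using V by auto
      have "M x (N x v - ?u) = M x0 ?u - M x ?u"
        using assms(2)[OF x] N(3) x x0 by (simp add: linear_diff)
      then have "c * norm (N x v - ?u) \<le> norm (M x0 ?u - M x ?u)"
        using c[OF \<open>x \<in> V\<close>, of "N x v - ?u"] by simp
      then show "norm (N x v - N x0 v) \<le> norm (M x0 ?u - M x ?u) / c"
        using V(4) by (simp add: pos_le_divide_eq mult.commute)
    qed (use V in auto)
  qed (use * in simp)
  then show "isCont (\<lambda>x. N x v) x0"
    by (simp add: isCont_def LIM_zero_iff)
qed

text \<open>The identity N x v = N x0 v + N x (h x) pairs N x, not yet known to be differentiable,
  with a factor \<open>h x\<close> that vanishes at x0.\<close>

lemma inverse_family_has_derivative: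
  fixes M :: "'a::real_normed_vector \<Rightarrow> 'b::euclidean_space \<Rightarrow> 'b"
  assumes "open U" "\<And>x. x \<in> U \<Longrightarrow> linear (M x)" "\<And>v. continuous_on U (\<lambda>x. M x v)"
    and N: "\<And>x. x \<in> U \<Longrightarrow> linear (N x)" "\<And>x v. x \<in> U \<Longrightarrow> N x (M x v) = v"
      "\<And>x v. x \<in> U \<Longrightarrow> M x (N x v) = v"
    and x0: "x0 \<in> U" and der: "((\<lambda>x. M x (N x0 v)) has_derivative D) (at x0)"
  shows "((\<lambda>x. N x v) has_derivative (\<lambda>w. - N x0 (D w))) (at x0)"
proof -
  let ?u = "N x0 v"
  define h where "h x = M x0 ?u - M x ?u" for x
  have h: "(h has_derivative (\<lambda>w. - D w)) (at x0)"
    unfolding h_def using has_derivative_diff[OF has_derivative_const der] by simp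
  have "((\<lambda>x. (h x \<bullet> b) *\<^sub>R N x b) has_derivative (\<lambda>w. (- D w \<bullet> b) *\<^sub>R N x0 b)) (at x0)" for b
  proof (rule has_derivative_scaleR_vanishing)
    show "((\<lambda>x. h x \<bullet> b) has_derivative (\<lambda>w. - D w \<bullet> b)) (at x0)"
      using h by (rule has_derivative_inner_left)
    show "isCont (\<lambda>x. N x b) x0"
      using inverse_family_continuous[OF assms(1-6)] assms(1) x0 continuous_on_eq_continuous_at by blast
  qed (simp add: h_def)
  then have "((\<lambda>x. \<Sum>b\<in>Basis. (h x \<bullet> b) *\<^sub>R N x b) has_derivative
      (\<lambda>w. \<Sum>b\<in>Basis. (- D w \<bullet> b) *\<^sub>R N x0 b)) (at x0)"
    by (rule has_derivative_sum)
  then have "((\<lambda>x. N x0 v + (\<Sum>b\<in>Basis. (h x \<bullet> b) *\<^sub>R N x b)) has_derivative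
      (\<lambda>w. \<Sum>b\<in>Basis. (- D w \<bullet> b) *\<^sub>R N x0 b)) (at x0)"
    by (auto intro: derivative_eq_intros)
  moreover have rep: "(\<Sum>b\<in>Basis. (z \<bullet> b) *\<^sub>R N x b) = N x z" if "x \<in> U" for x z
    using linear_sum[OF N(1)[OF that], of "\<lambda>b. (z \<bullet> b) *\<^sub>R b" Basis] linear_cmul[OF N(1)[OF that]]
    by (simp add: euclidean_representation)
  moreover have "N x v = N x0 v + N x (h x)" if "x \<in> U" for x
  proof -
    have "N x (h x) = N x (M x0 ?u) - N x (M x ?u)"
      unfolding h_def using N(1)[OF that] by (simp add: linear_diff)
    then show ?thesis using N that x0 by simp
  qed
  ultimately have "((\<lambda>x. N x v) has_derivative (\<lambda>w. \<Sum>b\<in>Basis. (- D w \<bullet> b) *\<^sub>R N x0 b)) (at x0)"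
    by (elim has_derivative_transform_within_open[OF _ assms(1) x0]) auto
  then show ?thesis
    unfolding rep[OF x0] using N(1)[OF x0] by (simp add: linear_neg)
qed

text \<open>The derivative is assembled from N itself, undifferentiated, and the derivative of M, so
  the regularity of N climbs one order at a time up to that of M.\<close>

lemma Ck_on_inverse_family:
  fixes M :: "'a::euclidean_space \<Rightarrow> 'b::euclidean_space \<Rightarrow> 'b"
  assumes "open U" "\<And>x. x \<in> U \<Longrightarrow> linear (M x)" "\<And>v. Ck_on n (\<lambda>x. M x v) U"
    and N: "\<And>x. x \<in> U \<Longrightarrow> linear (N x)" "\<And>x v. x \<in> U \<Longrightarrow> N x (M x v) = v"
      "\<And>x v. x \<in> U \<Longrightarrow> M x (N x v) = v"
  shows "Ck_on n (\<lambda>x. N x v) U"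
  using assms(3)
proof (induction n arbitrary: v)
  case 0
  then show ?case using inverse_family_continuous[OF assms(1,2) _ N] by auto
next
  case (Suc n)
  have M: "Ck_on n (\<lambda>x. M x v) U" for v using Suc.prems Ck_on_Suc_imp by blast
  let ?D = "\<lambda>x u. frechet_derivative (\<lambda>x. M x u) (at x)"
  have D: "((\<lambda>x. M x u) has_derivative ?D x u) (at x)" if "x \<in> U" for x u
    using Ck_on_SucD[OF Suc.prems that] .
  \<comment> \<open>\<open>Ck_on_family_apply\<close> needs the derivative to be linear in the
    argument u of M; uniqueness of derivatives transfers this from M x.\<close>
  have linD: "linear (\<lambda>u. ?D x u w)" if x: "x \<in> U" for x w
  proof (rule linearI)
    fix a b
    have "((\<lambda>y. M y (a + b)) has_derivative (\<lambda>w. ?D x a w + ?D x b w)) (at x)"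
      by (rule has_derivative_transform_within_open[OF has_derivative_add[OF D[OF x] D[OF x]] assms(1) x])
         (simp add: assms(2) linear_add)
    then show "?D x (a + b) w = ?D x a w + ?D x b w"
      using has_derivative_unique[OF D[OF x]] by metis
  next
    fix c :: real and a
    have "((\<lambda>y. M y (c *\<^sub>R a)) has_derivative (\<lambda>w. c *\<^sub>R ?D x a w)) (at x)"
      by (rule has_derivative_transform_within_open[OF has_derivative_scaleR_right[OF D[OF x]] assms(1) x])
         (simp add: assms(2) linear_cmul)
    then show "?D x (c *\<^sub>R a) w = c *\<^sub>R ?D x a w"
      using has_derivative_unique[OF D[OF x]] by metis
  qed
  show ?case
  proof (rule Ck_on_Suc_intro[where f' = "\<lambda>x w. - N x (?D x (N x v) w)"])
    show "((\<lambda>x. N x v) has_derivative (\<lambda>w. - N x (?D x (N x v) w))) (at x)" if "x \<in> U" for x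
      using inverse_family_has_derivative[OF assms(1,2) Ck_on_imp_continuous_on[OF M] N that D[OF that]] .
    fix w
    have "Ck_on n (\<lambda>x. ?D x u w) U" for u using Suc.prems by simp
    then have "Ck_on n (\<lambda>x. ?D x (N x v) w) U"
      by (intro Ck_on_family_apply[where M = "\<lambda>x u. ?D x u w", OF assms(1) linD _ Suc.IH[OF M]])
    then have "Ck_on n (\<lambda>x. N x (?D x (N x v) w)) U"
      by (intro Ck_on_family_apply[where M = N, OF assms(1) N(1) Suc.IH[OF M]])
    then show "Ck_on n (\<lambda>x. - N x (?D x (N x v) w)) U"
      by (rule Ck_on_minus[OF _ assms(1)])
  qed (use assms in auto)
qed

subsection \<open>The smooth inverse function theorem\<close>

text \<open>Bootstrapping: the derivative of g at y is the inverse of the derivative of f at g y. If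
  g is C^n, that family is C^n, hence so is its inverse, and g is C^(n+1).\<close>

lemma smooth_inverse_function:
  fixes f :: "'a::euclidean_space \<Rightarrow> 'a"
  assumes "open U" "\<And>n. Ck_on n f U" "x0 \<in> U" "inj (frechet_derivative f (at x0))"
  obtains U' V g where "open U'" "U' \<subseteq> U" "x0 \<in> U'" "open V" "f x0 \<in> V" "homeomorphism U' V f g"
    "\<And>n. Ck_on n g V"
proof -
  let ?D = "\<lambda>x. frechet_derivative f (at x)"
  have D: "(f has_derivative ?D x) (at x)" if "x \<in> U" for x
    using Ck_on_SucD[OF assms(2) that] .
  have Dbl: "bounded_linear (?D x)" if "x \<in> U" for x
    using D[OF that] has_derivative_bounded_linear by blast
  define f' where "f' x = Blinfun (?D x)" for x
  have f'_apply: "blinfun_apply (f' x) = ?D x" if "x \<in> U" for x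
    unfolding f'_def using Dbl[OF that] by (rule bounded_linear_Blinfun_apply)
  have DCk: "Ck_on n (\<lambda>x. ?D x v) U" for n v using assms(2)[of "Suc n"] by simp
  have cont: "continuous_on U f'"
  proof (rule continuous_on_blinfun_componentwise)
    fix b :: 'a
    show "continuous_on U (\<lambda>x. blinfun_apply (f' x) b)"
      using Ck_on_imp_continuous_on[OF DCk] by (simp add: f'_apply cong: continuous_on_cong)
  qed
  obtain h where h: "linear h" "h \<circ> ?D x0 = id"
    using linear_injective_left_inverse[OF _ assms(4)] Dbl[OF assms(3)] bounded_linear.linear by blast
  define invf where "invf = Blinfun h"
  have invf: "invf o\<^sub>L f' x0 = id_blinfun"
  proof (rule blinfun_eqI)
    fix v show "blinfun_apply (invf o\<^sub>L f' x0) v = blinfun_apply id_blinfun v"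
      using h by (simp add: invf_def f'_apply assms(3) bounded_linear_Blinfun_apply linear_linear pointfree_idE)
  qed
  from inverse_function_theorem[of U f f' x0 invf, OF assms(1) _ cont assms(3) invf] D f'_apply
  obtain U' V g g' where *: "open U'" "U' \<subseteq> U" "x0 \<in> U'" "open V" "f x0 \<in> V" "homeomorphism U' V f g"
    and g': "\<And>y. y \<in> V \<Longrightarrow> (g has_derivative (g' y)) (at y)"
    and inv: "\<And>y. y \<in> V \<Longrightarrow> g' y = inv (blinfun_apply (f'(g y)))"
    and bij: "\<And>y. y \<in> V \<Longrightarrow> bij (blinfun_apply (f'(g y)))"
    by (metis (no_types, lifting))
  have gU: "g y \<in> U" if "y \<in> V" for y
    using *(2,6) that by (auto simp: homeomorphism_def)
  have "Ck_on n g V" for n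
  proof (induction n)
    case 0
    then show ?case using *(6) by (simp add: homeomorphism_def)
  next
    case (Suc n)
    show ?case
    proof (rule Ck_on_Suc_intro[OF g' *(4)])
      fix v
      have b: "bij (?D (g y))" "g' y = inv (?D (g y))" if "y \<in> V" for y
        using bij[OF that] inv[OF that] f'_apply[OF gU[OF that]] by auto
      show "Ck_on n (\<lambda>y. g' y v) V"
      proof (rule Ck_on_inverse_family[where M = "\<lambda>y. ?D (g y)"])
        show "Ck_on n (\<lambda>y. ?D (g y) v) V" for v
          using gU by (intro Ck_on_compose[OF Suc DCk _ *(4) assms(1)]) auto
        show "linear (?D (g y))" if "y \<in> V" for y
          using Dbl gU that bounded_linear.linear by blast
        show "linear (g' y)" if "y \<in> V" for y
          using g' has_derivative_linear that by blast
      qed (use b * in \<open>auto simp: bij_is_inj bij_is_surj surj_f_inv_f\<close>)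
    qed
  qed
  with * that show ?thesis by blast
qed

section \<open>Smooth maps on subsets and charts of submanifolds\<close>

lemma smooth_map_onI:
  assumes "open U" "\<And>n. Ck_on n F U" "M \<subseteq> U" "\<And>x. x \<in> M \<Longrightarrow> F x = f x"
  shows "smooth_map_on f M"
  unfolding smooth_map_on_def using assms by blast

lemma smooth_map_onE:
  assumes "smooth_map_on f M" "x \<in> M"
  obtains U F where "open U \<and> x \<in> U \<and> (\<forall>n. Ck_on n F U) \<and> (\<forall>y\<in>M \<inter> U. F y = f y)"
  using assms unfolding smooth_map_on_def by (elim ballE exE) auto

lemma smooth_map_on_compose:
  fixes f :: "'a::euclidean_space \<Rightarrow> 'b::euclidean_space" and g :: "'b \<Rightarrow> 'c::euclidean_space"
  assumes f: "smooth_map_on f M" and g: "smooth_map_on g N" and "f ` M \<subseteq> N"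
  shows "smooth_map_on (\<lambda>x. g (f x)) M"
  unfolding smooth_map_on_def
proof
  fix x assume x: "x \<in> M"
  then have fx: "f x \<in> N" using assms(3) by auto
  obtain U F where UF: "open U \<and> x \<in> U \<and> (\<forall>n. Ck_on n F U) \<and> (\<forall>y\<in>M \<inter> U. F y = f y)"
    by (rule smooth_map_onE[OF f x])
  then have U: "open U" "x \<in> U" "\<And>n. Ck_on n F U" "\<And>y. y \<in> M \<Longrightarrow> y \<in> U \<Longrightarrow> F y = f y" by auto
  obtain V G where VG: "open V \<and> f x \<in> V \<and> (\<forall>n. Ck_on n G V) \<and> (\<forall>y\<in>N \<inter> V. G y = g y)"
    by (rule smooth_map_onE[OF g fx])
  then have V: "open V" "f x \<in> V" "\<And>n. Ck_on n G V" "\<And>y. y \<in> N \<Longrightarrow> y \<in> V \<Longrightarrow> G y = g y" by auto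
  have o: "open (U \<inter> F -` V)"
    using Ck_on_imp_continuous_on[OF U(3)] U(1) V(1) continuous_on_open_vimage
    by (simp add: Int_commute continuous_on_open_vimage)
  have "Ck_on n (\<lambda>x. G (F x)) (U \<inter> F -` V)" for n
  proof (rule Ck_on_compose[where V = V])
    show "Ck_on n F (U \<inter> F -` V)" using U(3) by (rule Ck_on_subset) simp
  qed (use V o in auto)
  moreover have "G (F y) = g (f y)" if "y \<in> M \<inter> (U \<inter> F -` V)" for y
  proof -
    have "F y = f y" "F y \<in> V" using that U(4) by auto
    moreover have "f y \<in> N" using that assms(3) by auto
    ultimately show ?thesis using V(4) by simp
  qed
  moreover have "x \<in> U \<inter> F -` V" using U(2,4) V(2) x by simp
  ultimately show "\<exists>U F. open U \<and> x \<in> U \<and> (\<forall>n. Ck_on n F U) \<and> (\<forall>y\<in>M \<inter> U. F y = g (f y))"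
    by (intro exI[of _ "U \<inter> F -` V"] exI[of _ "\<lambda>x. G (F x)"] conjI allI ballI o) 
qed

lemma smooth_map_on_linear: "linear L \<Longrightarrow> smooth_map_on L M"
  by (rule smooth_map_onI[of UNIV L, OF _ Ck_on_linear]) auto

lemma smooth_map_on_cong:
  fixes f g :: "'a::euclidean_space \<Rightarrow> 'b::euclidean_space"
  assumes "smooth_map_on f M" "\<And>x. x \<in> M \<Longrightarrow> f x = g x"
  shows "smooth_map_on g M"
  unfolding smooth_map_on_def
proof
  fix x assume x: "x \<in> M"
  obtain U F where "open U \<and> x \<in> U \<and> (\<forall>n. Ck_on n F U) \<and> (\<forall>y\<in>M \<inter> U. F y = f y)"
    by (rule smooth_map_onE[OF assms(1) x])
  then show "\<exists>U F. open U \<and> x \<in> U \<and> (\<forall>n. Ck_on n F U) \<and> (\<forall>y\<in>M \<inter> U. F y = g y)"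
    using assms(2) by (intro exI[of _ U] exI[of _ F]) auto
qed

lemma diffeomorphismI:
  assumes "smooth_map_on f M" "smooth_map_on g N" "f ` M \<subseteq> N" "g ` N \<subseteq> M"
    and "\<And>x. x \<in> M \<Longrightarrow> g (f x) = x" "\<And>y. y \<in> N \<Longrightarrow> f (g y) = y"
  shows "diffeomorphism f M N"
proof -
  have b: "bij_betw f M N"
    by (rule bij_betw_byWitness[where f' = g]) (use assms in auto)
  moreover have "inv_into M f y = g y" if "y \<in> N" for y
    using b assms that by (metis bij_betw_imp_inj_on image_subset_iff inv_into_f_eq)
  ultimately show ?thesis
    unfolding diffeomorphism_def using assms(1) smooth_map_on_cong[OF assms(2), of "inv_into M f"] by simp
qed

lemma embedded_submanifoldI:
  fixes M L :: "'a::euclidean_space set"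
  assumes "subspace L"
    and "\<And>x. x \<in> M \<Longrightarrow> \<exists>U V f g. open U \<and> x \<in> U \<and> open V \<and> smooth_map_on f U \<and> smooth_map_on g V \<and>
      f ` U \<subseteq> V \<and> g ` V \<subseteq> U \<and> (\<forall>x\<in>U. g (f x) = x) \<and> (\<forall>y\<in>V. f (g y) = y) \<and>
      (\<forall>x\<in>U. x \<in> M \<longleftrightarrow> f x \<in> L)"
  shows "embedded_submanifold M"
  unfolding embedded_submanifold_def
proof (intro exI[of _ "dim L"] ballI)
  fix x assume "x \<in> M"
  then obtain U V f g where *: "open U" "x \<in> U" "open V" "smooth_map_on f U" "smooth_map_on g V"
      "f ` U \<subseteq> V" "g ` V \<subseteq> U" "\<forall>x\<in>U. g (f x) = x" "\<forall>y\<in>V. f (g y) = y"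
      "\<forall>x\<in>U. x \<in> M \<longleftrightarrow> f x \<in> L" using assms(2) by metis
  have "diffeomorphism f U V" by (rule diffeomorphismI[of _ _ g]) (use * in auto)
  moreover have "f ` (M \<inter> U) = L \<inter> V"
  proof (intro equalityI subsetI)
    fix y assume "y \<in> f ` (M \<inter> U)" then show "y \<in> L \<inter> V" using * by blast
  next
    fix y assume y: "y \<in> L \<inter> V"
    then have "g y \<in> M \<inter> U" "f (g y) = y" using * by auto
    then show "y \<in> f ` (M \<inter> U)" by (metis imageI)
  qed
  ultimately have "open U \<and> x \<in> U \<and> open V \<and> subspace L \<and> dim L = dim L \<and>
      diffeomorphism f U V \<and> f ` (M \<inter> U) = L \<inter> V"
    using * assms(1) by auto
  then show "\<exists>U V L' \<phi>. open U \<and> x \<in> U \<and> open (V :: 'a set) \<and> subspace L' \<and> dim L' = dim L \<and>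
      diffeomorphism \<phi> U V \<and> \<phi> ` (M \<inter> U) = L' \<inter> V"
    by (intro exI)
qed

section \<open>The exponential of a linear map\<close>

lemma blinfun_compose_power_apply:
  fixes A :: "'g::euclidean_space \<Rightarrow>\<^sub>L 'g"
  shows "blinfun_apply ((((o\<^sub>L) A) ^^ n) id_blinfun) v = (blinfun_apply A ^^ n) v"
  by (induction n) auto

lemma norm_blinfun_compose_power:
  fixes A :: "'g::euclidean_space \<Rightarrow>\<^sub>L 'g"
  shows "norm ((((o\<^sub>L) A) ^^ n) id_blinfun) \<le> norm A ^ n"
proof (induction n)
  case (Suc n)
  have "norm ((((o\<^sub>L) A) ^^ Suc n) id_blinfun) \<le> norm A * norm ((((o\<^sub>L) A) ^^ n) id_blinfun)"
    by (simp add: norm_blinfun_compose)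
  also have "\<dots> \<le> norm A * norm A ^ n"
    using Suc by (intro mult_left_mono) auto
  finally show ?case by simp
qed (simp add: norm_blinfun_id)

lemma summable_blinfun_exp:
  fixes A :: "'g::euclidean_space \<Rightarrow>\<^sub>L 'g"
  shows "summable (\<lambda>n. (1 / fact n) *\<^sub>R (((o\<^sub>L) A) ^^ n) id_blinfun)"
proof (rule summable_comparison_test')
  show "summable (\<lambda>n. inverse (fact n) *\<^sub>R (norm A ^ n))"
    using summable_exp[of "norm A"] by simp
  show "norm ((1 / fact n) *\<^sub>R (((o\<^sub>L) A) ^^ n) id_blinfun) \<le> inverse (fact n) *\<^sub>R (norm A ^ n)"
    if "n \<ge> 0" for n
    using norm_blinfun_compose_power[of n A] by (simp add: divide_simps)
qed

lemma blinfun_exp_sums: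
  fixes A :: "'g::euclidean_space \<Rightarrow>\<^sub>L 'g"
  shows "(\<lambda>n. (1 / fact n) *\<^sub>R (blinfun_apply A ^^ n) v) sums blinfun_apply (blinfun_exp A) v"
  using bounded_linear.sums[OF blinfun.bounded_linear_left[of v] summable_sums[OF summable_blinfun_exp[of A]]]
  by (simp add: blinfun_exp_def blinfun.scaleR_left blinfun_compose_power_apply)

lemma blinfun_exp_zero [simp]: "blinfun_exp (0 :: 'g::euclidean_space \<Rightarrow>\<^sub>L 'g) = id_blinfun"
proof (rule blinfun_eqI)
  fix v :: 'g
  have "(\<lambda>n. (1 / fact n) *\<^sub>R (blinfun_apply (0 :: 'g \<Rightarrow>\<^sub>L 'g) ^^ n) v) sums
      (\<Sum>n\<in>{0}. (1 / fact n) *\<^sub>R (blinfun_apply (0 :: 'g \<Rightarrow>\<^sub>L 'g) ^^ n) v)"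
  proof (rule sums_finite)
    fix n :: nat assume "n \<notin> {0}"
    then show "(1 / fact n) *\<^sub>R (blinfun_apply (0 :: 'g \<Rightarrow>\<^sub>L 'g) ^^ n) v = 0"
      by (cases n) auto
  qed auto
  then show "blinfun_apply (blinfun_exp 0) v = blinfun_apply id_blinfun v"
    using sums_unique2[OF blinfun_exp_sums[of 0 v]] by simp
qed

lemma blinfun_exp_commute:
  fixes A :: "'g::euclidean_space \<Rightarrow>\<^sub>L 'g"
  shows "blinfun_exp A (A v) = A (blinfun_exp A v)"
proof -
  have "(\<lambda>n. A ((1 / fact n) *\<^sub>R (blinfun_apply A ^^ n) v)) sums A (blinfun_exp A v)"
    by (intro bounded_linear.sums[OF blinfun.bounded_linear_right] blinfun_exp_sums)
  moreover have "A ((1 / fact n) *\<^sub>R (blinfun_apply A ^^ n) v) = (1 / fact n) *\<^sub>R (blinfun_apply A ^^ n) (A v)" for n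
    by (simp add: blinfun.scaleR_right funpow_swap1)
  ultimately show ?thesis
    using sums_unique2[OF blinfun_exp_sums[of A "A v"]] by simp
qed

lemma blinfun_exp_preserves:
  fixes A :: "'g::euclidean_space \<Rightarrow>\<^sub>L 'g"
  assumes "subspace W" "\<And>w. w \<in> W \<Longrightarrow> A w \<in> W" "v \<in> W"
  shows "blinfun_exp A v \<in> W"
proof -
  have "(blinfun_apply A ^^ n) v \<in> W" for n
    by (induction n) (use assms in auto)
  then have "(\<Sum>i<n. (1 / fact i) *\<^sub>R (blinfun_apply A ^^ i) v) \<in> W" for n
    using assms(1) by (intro subspace_sum subspace_scale) auto
  then show ?thesis
    using blinfun_exp_sums[of A v] closed_subspace[OF assms(1)]
    unfolding sums_def by (metis (no_types, lifting) closed_sequentially)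
qed

text \<open>Without the term n = 0 the series involves only A v and its images, so v itself may lie
  outside W. This is how an exponential is seen to act as the identity modulo W.\<close>

lemma blinfun_exp_diff_mem:
  fixes A :: "'g::euclidean_space \<Rightarrow>\<^sub>L 'g"
  assumes "subspace W" "\<And>w. w \<in> W \<Longrightarrow> A w \<in> W" "A v \<in> W"
  shows "blinfun_exp A v - v \<in> W"
proof -
  let ?a = "\<lambda>n. (1 / fact n) *\<^sub>R (blinfun_apply A ^^ n) v"
  have "(blinfun_apply A ^^ Suc n) v \<in> W" for n
    by (induction n) (use assms in auto)
  then have mem: "(\<Sum>i<n. ?a (Suc i)) \<in> W" for n
    using assms(1) by (intro subspace_sum subspace_scale) auto
  have "(\<lambda>n. ?a (Suc n)) sums (blinfun_exp A v - v)"
    using blinfun_exp_sums[of A v] by (subst sums_Suc_iff) simp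
  then show ?thesis
    using mem closed_subspace[OF assms(1)]
    unfolding sums_def by (metis (no_types, lifting) closed_sequentially)
qed

lemma scaled_power_apply:
  fixes A :: "'g::euclidean_space \<Rightarrow>\<^sub>L 'g"
  shows "(blinfun_apply (t *\<^sub>R A) ^^ n) v = t ^ n *\<^sub>R (blinfun_apply A ^^ n) v"
  by (induction n) (auto simp: blinfun.scaleR_left blinfun.scaleR_right)

text \<open>Each coordinate is an everywhere convergent real power series in t and may be
  differentiated termwise; \<open>diffs\<close> turns the coefficients for v into those for A
  v.\<close>

lemma blinfun_exp_has_vector_derivative:
  fixes A :: "'g::euclidean_space \<Rightarrow>\<^sub>L 'g"
  shows "((\<lambda>t. blinfun_exp (t *\<^sub>R A) v) has_vector_derivative blinfun_exp (t *\<^sub>R A) (A v)) (at t)"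
proof -
  have ps: "(\<lambda>n. ((blinfun_apply A ^^ n) v \<bullet> b / fact n) * t ^ n) sums (blinfun_exp (t *\<^sub>R A) v \<bullet> b)" for b v t
    using bounded_linear.sums[OF bounded_linear_inner_left blinfun_exp_sums[of "t *\<^sub>R A" v], of b]
    by (simp add: scaled_power_apply divide_inverse mult_ac)
  have "((\<lambda>t. blinfun_exp (t *\<^sub>R A) v \<bullet> b) has_real_derivative blinfun_exp (t *\<^sub>R A) (A v) \<bullet> b) (at t)" for b
  proof -
    let ?c = "\<lambda>n. (blinfun_apply A ^^ n) v \<bullet> b / fact n"
    have "((\<lambda>t. \<Sum>n. ?c n * t ^ n) has_real_derivative (\<Sum>n. diffs ?c n * t ^ n)) (at t)"
      by (rule termdiffs_strong_converges_everywhere) (use ps sums_summable in blast)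
    moreover have "diffs ?c n = (blinfun_apply A ^^ n) (A v) \<bullet> b / fact n" for n
      by (simp add: diffs_def funpow_swap1 field_simps del: of_nat_Suc)
    ultimately show ?thesis
      using ps[of v b, THEN sums_unique, symmetric] ps[of "A v" b t, THEN sums_unique, symmetric]
      by simp
  qed
  then have "((\<lambda>t. blinfun_exp (t *\<^sub>R A) v \<bullet> b) has_derivative (\<lambda>x. (x *\<^sub>R blinfun_exp (t *\<^sub>R A) (A v)) \<bullet> b)) (at t)" for b
    by (simp add: has_field_derivative_def mult.commute[of _ "_ \<bullet> _"])
  then show ?thesis
    unfolding has_vector_derivative_def by (subst has_derivative_componentwise_within) auto
qed

lemma blinfun_exp_apply_has_vector_derivative:
  fixes A :: "'g::euclidean_space \<Rightarrow>\<^sub>L 'g"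
  assumes "(u has_vector_derivative u') (at t)"
  shows "((\<lambda>t. blinfun_exp (t *\<^sub>R A) (u t)) has_vector_derivative
    blinfun_exp (t *\<^sub>R A) (u' + A (u t))) (at t)"
proof -
  have rep: "(\<Sum>b\<in>Basis. (x \<bullet> b) *\<^sub>R B b) = blinfun_apply B x" for B :: "'g \<Rightarrow>\<^sub>L 'g" and x
    by (simp add: euclidean_representation flip: blinfun.scaleR_right blinfun.sum_right)
  have "((\<lambda>t. \<Sum>b\<in>Basis. (u t \<bullet> b) *\<^sub>R blinfun_exp (t *\<^sub>R A) b) has_vector_derivative
     (\<Sum>b\<in>Basis. (u t \<bullet> b) *\<^sub>R blinfun_exp (t *\<^sub>R A) (A b) + (u' \<bullet> b) *\<^sub>R blinfun_exp (t *\<^sub>R A) b)) (at t)"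
  proof (rule has_vector_derivative_sum)
    fix b :: 'g
    have "((\<lambda>t. u t \<bullet> b) has_real_derivative u' \<bullet> b) (at t)"
      using bounded_linear.has_vector_derivative[OF bounded_linear_inner_left assms]
      by (simp add: has_real_derivative_iff_has_vector_derivative)
    then show "((\<lambda>t. (u t \<bullet> b) *\<^sub>R blinfun_exp (t *\<^sub>R A) b) has_vector_derivative
       (u t \<bullet> b) *\<^sub>R blinfun_exp (t *\<^sub>R A) (A b) + (u' \<bullet> b) *\<^sub>R blinfun_exp (t *\<^sub>R A) b) (at t)"
      by (intro has_vector_derivative_scaleR blinfun_exp_has_vector_derivative)
  qed
  moreover have "(\<Sum>b\<in>Basis. (u t \<bullet> b) *\<^sub>R blinfun_exp (t *\<^sub>R A) (A b)) = blinfun_exp (t *\<^sub>R A) (A (u t))"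
    using rep[of "u t" "blinfun_exp (t *\<^sub>R A) o\<^sub>L A"] by simp
  ultimately show ?thesis
    by (simp add: rep sum.distrib blinfun.add_right add.commute)
qed

text \<open>An integrating factor: exp (- t A) u(t) has derivative 0. From this uniqueness the
  inverse, eigenvector, intertwining and derivation properties of the exponential all follow by
  checking one differential equation, without multiplying series.\<close>

lemma blinfun_exp_unique_aux:
  fixes A :: "'g::euclidean_space \<Rightarrow>\<^sub>L 'g"
  assumes "\<And>t. (u has_vector_derivative A (u t)) (at t)"
  shows "blinfun_exp (- t *\<^sub>R A) (u t) = u 0"
proof -
  have "((\<lambda>t. blinfun_exp (t *\<^sub>R (- A)) (u t)) has_derivative (\<lambda>h. 0)) (at s)" for s
    using blinfun_exp_apply_has_vector_derivative[OF assms, of "- A" s]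
    by (simp add: blinfun.minus_left has_vector_derivative_def)
  then have "\<exists>c. \<forall>t. blinfun_exp (t *\<^sub>R (- A)) (u t) = c"
    using has_derivative_zero_constant[OF convex_UNIV] by auto
  then obtain c where "\<And>t. blinfun_exp (t *\<^sub>R (- A)) (u t) = c" by blast
  from this[of t] this[of 0] show ?thesis by simp
qed

lemma blinfun_exp_minus_left [simp]:
  fixes A :: "'g::euclidean_space \<Rightarrow>\<^sub>L 'g"
  shows "blinfun_exp (- A) (blinfun_exp A v) = v"
proof -
  have "((\<lambda>t. blinfun_exp (t *\<^sub>R A) v) has_vector_derivative A (blinfun_exp (t *\<^sub>R A) v)) (at t)" for t
  proof (cases "t = 0")
    case True
    then show ?thesis using blinfun_exp_has_vector_derivative[of A v t] by simp
  next
    case False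
    have "blinfun_exp (t *\<^sub>R A) ((t *\<^sub>R A) v) = (t *\<^sub>R A) (blinfun_exp (t *\<^sub>R A) v)"
      by (rule blinfun_exp_commute)
    then have "blinfun_exp (t *\<^sub>R A) (A v) = A (blinfun_exp (t *\<^sub>R A) v)"
      using False by (simp add: blinfun.scaleR_left blinfun.scaleR_right)
    then show ?thesis using blinfun_exp_has_vector_derivative[of A v t] by simp
  qed
  from blinfun_exp_unique_aux[OF this, of 1] show ?thesis by simp
qed

lemma blinfun_exp_minus_right [simp]:
  fixes A :: "'g::euclidean_space \<Rightarrow>\<^sub>L 'g"
  shows "blinfun_exp A (blinfun_exp (- A) v) = v"
  using blinfun_exp_minus_left[of "- A" v] by simp

lemma blinfun_exp_scale_commute:
  fixes A :: "'g::euclidean_space \<Rightarrow>\<^sub>L 'g"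
  shows "blinfun_exp (t *\<^sub>R A) (A v) = A (blinfun_exp (t *\<^sub>R A) v)"
proof (cases "t = 0")
  case False
  then show ?thesis
    using blinfun_exp_commute[of "t *\<^sub>R A" v]
    by (simp add: blinfun.scaleR_left blinfun.scaleR_right)
qed simp

lemma blinfun_exp_unique:
  fixes A :: "'g::euclidean_space \<Rightarrow>\<^sub>L 'g"
  assumes "\<And>t. (u has_vector_derivative A (u t)) (at t)"
  shows "u t = blinfun_exp (t *\<^sub>R A) (u 0)"
  using blinfun_exp_unique_aux[of u A t, OF assms] blinfun_exp_minus_right[of "t *\<^sub>R A" "u t"]
  by simp

lemma blinfun_exp_eigenvector:
  fixes A :: "'g::euclidean_space \<Rightarrow>\<^sub>L 'g"
  assumes "A v = c *\<^sub>R v"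
  shows "blinfun_exp (t *\<^sub>R A) v = exp (t * c) *\<^sub>R v"
proof -
  have "((\<lambda>t. exp (t * c) *\<^sub>R v) has_vector_derivative A (exp (t * c) *\<^sub>R v)) (at t)" for t
    by (auto intro!: derivative_eq_intros simp: assms blinfun.scaleR_right has_vector_derivative_def
        has_field_derivative_def algebra_simps)
  from blinfun_exp_unique[OF this, of t] show ?thesis by simp
qed

lemma blinfun_exp_intertwine:
  fixes A B :: "'g::euclidean_space \<Rightarrow>\<^sub>L 'g"
  assumes "linear L" "\<And>v. L (A v) = B (L v)"
  shows "L (blinfun_exp A v) = blinfun_exp B (L v)"
proof -
  have "((\<lambda>t. L (blinfun_exp (t *\<^sub>R A) v)) has_vector_derivative B (L (blinfun_exp (t *\<^sub>R A) v))) (at t)" for t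
    using bounded_linear.has_vector_derivative[OF _ blinfun_exp_has_vector_derivative[of A v], of L]
      assms linear_linear by (auto simp: blinfun_exp_scale_commute)
  from blinfun_exp_unique[OF this, of 1] show ?thesis by simp
qed

lemma continuous_blinfun_exp_scale:
  fixes A :: "'g::euclidean_space \<Rightarrow>\<^sub>L 'g"
  shows "continuous_on UNIV (\<lambda>t. blinfun_exp (t *\<^sub>R A))"
proof (rule continuous_on_blinfun_componentwise)
  fix b :: 'g
  show "continuous_on UNIV (\<lambda>t. blinfun_exp (t *\<^sub>R A) b)"
    using blinfun_exp_has_vector_derivative[of A b]
    by (meson continuous_at_imp_continuous_on has_vector_derivative_continuous)
qed

lemma Ck_on_blinfun_exp_scale:
  fixes A :: "'g::euclidean_space \<Rightarrow>\<^sub>L 'g"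
  shows "Ck_on n (\<lambda>t. blinfun_exp (t *\<^sub>R A) v) UNIV"
proof (induction n arbitrary: v)
  case 0
  show ?case
    using blinfun_exp_has_vector_derivative[of A v]
    by (auto intro!: continuous_at_imp_continuous_on has_vector_derivative_continuous)
next
  case (Suc n)
  show ?case
  proof (rule Ck_on_Suc_intro)
    show "((\<lambda>t. blinfun_exp (t *\<^sub>R A) v) has_derivative (\<lambda>h. h *\<^sub>R blinfun_exp (t *\<^sub>R A) (A v))) (at t)" for t
      using blinfun_exp_has_vector_derivative[of A v t] by (simp add: has_vector_derivative_def)
    show "Ck_on n (\<lambda>t. h *\<^sub>R blinfun_exp (t *\<^sub>R A) (A v)) UNIV" for h
      by (rule Ck_on_linear_compose[OF bounded_linear_scaleR_right Suc]) simp
  qed simp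
qed

lemma Ck_on_blinfun_exp_compose:
  fixes A :: "'g::euclidean_space \<Rightarrow>\<^sub>L 'g"
  assumes "linear l" "Ck_on n f UNIV"
  shows "Ck_on n (\<lambda>x. blinfun_exp (l x *\<^sub>R A) (f x)) UNIV"
proof (rule Ck_on_family_apply[where M = "\<lambda>x v. blinfun_exp (l x *\<^sub>R A) v", OF open_UNIV _ _ assms(2)])
  show "linear (\<lambda>v. blinfun_exp (l x *\<^sub>R A) v)" for x
    by (simp add: blinfun.bounded_linear_right bounded_linear.linear)
  show "Ck_on n (\<lambda>x. blinfun_exp (l x *\<^sub>R A) v) UNIV" for v
    by (rule Ck_on_compose[OF Ck_on_linear[OF assms(1)] Ck_on_blinfun_exp_scale]) auto
qed

text \<open>At 0 the exponential is the identity, which removes every exponential factor from the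
  product rule.\<close>

lemma blinfun_exp_compose_has_derivative:
  fixes A :: "'g::euclidean_space \<Rightarrow>\<^sub>L 'g" and l :: "'h::euclidean_space \<Rightarrow> real"
  assumes "linear l" "(f has_derivative f') (at 0)"
  shows "((\<lambda>x. blinfun_exp (l x *\<^sub>R A) (f x)) has_derivative (\<lambda>v. l v *\<^sub>R A (f 0) + f' v)) (at 0)"
proof -
  have l: "(l has_derivative l) (at 0)" and l0: "l 0 = 0"
    using assms(1) linear_linear bounded_linear_imp_has_derivative linear_0 by blast+
  have "((\<lambda>x. blinfun_exp (l x *\<^sub>R A) b) has_derivative (\<lambda>v. l v *\<^sub>R A b)) (at 0)" for b
    using diff_chain_at[OF l, of "\<lambda>t. blinfun_exp (t *\<^sub>R A) b" "\<lambda>h. h *\<^sub>R A b"]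
      blinfun_exp_has_vector_derivative[of A b 0] by (simp add: has_vector_derivative_def l0 o_def)
  then have "((\<lambda>x. (f x \<bullet> b) *\<^sub>R blinfun_exp (l x *\<^sub>R A) b) has_derivative
     (\<lambda>v. (f 0 \<bullet> b) *\<^sub>R l v *\<^sub>R A b + (f' v \<bullet> b) *\<^sub>R b)) (at 0)" for b
    using has_derivative_scaleR[OF has_derivative_inner_left[OF assms(2), of b], of "\<lambda>x. blinfun_exp (l x *\<^sub>R A) b"]
    by (fastforce simp: l0)
  then have "((\<lambda>x. \<Sum>b\<in>Basis. (f x \<bullet> b) *\<^sub>R blinfun_exp (l x *\<^sub>R A) b) has_derivative
     (\<lambda>v. \<Sum>b\<in>Basis. (f 0 \<bullet> b) *\<^sub>R l v *\<^sub>R A b + (f' v \<bullet> b) *\<^sub>R b)) (at 0)"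
    by (rule has_derivative_sum)
  moreover have "(\<Sum>b\<in>Basis. (x \<bullet> b) *\<^sub>R B b) = blinfun_apply B x" for B :: "'g \<Rightarrow>\<^sub>L 'g" and x
    by (simp add: euclidean_representation flip: blinfun.scaleR_right blinfun.sum_right)
  moreover have "(\<Sum>b\<in>Basis. (f 0 \<bullet> b) *\<^sub>R l v *\<^sub>R A b) = l v *\<^sub>R A (f 0)"
    if "\<And>x B. (\<Sum>b\<in>Basis. (x \<bullet> b) *\<^sub>R blinfun_apply B b) = blinfun_apply (B :: 'g \<Rightarrow>\<^sub>L 'g) x" for v
  proof -
    have "(\<Sum>b\<in>Basis. (f 0 \<bullet> b) *\<^sub>R l v *\<^sub>R A b) = l v *\<^sub>R (\<Sum>b\<in>Basis. (f 0 \<bullet> b) *\<^sub>R A b)"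
      by (simp add: scaleR_sum_right mult.commute)
    with that show ?thesis by simp
  qed
  ultimately show ?thesis
    by (simp add: sum.distrib euclidean_representation)
qed

section \<open>Commuting self-adjoint operators\<close>

text \<open>The Euclidean product of the type supplies the topology, but ad H is self-adjoint for
  the Cartan inner product. The spectral theory is therefore developed for an arbitrary positive
  definite form.\<close>

locale inner_form =
  fixes ip :: "'a::euclidean_space \<Rightarrow> 'a \<Rightarrow> real"
  assumes bilinear_ip: "bilinear ip"
    and ip_commute: "ip x y = ip y x"
    and ip_pos: "x \<noteq> 0 \<Longrightarrow> ip x x > 0"
begin

lemma linear_ip_right: "linear (ip x)"
  using bilinear_ip by (simp add: bilinear_def)

lemma ip_simps [simp]:
  "ip (x + y) z = ip x z + ip y z" "ip x (y + z) = ip x y + ip x z"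
  "ip (c *\<^sub>R x) z = c * ip x z" "ip x (c *\<^sub>R z) = c * ip x z"
  "ip (x - y) z = ip x z - ip y z" "ip x (y - z) = ip x y - ip x z"
  "ip (- x) z = - ip x z" "ip x (- z) = - ip x z" "ip 0 z = 0" "ip x 0 = 0"
  using bilinear_ladd[OF bilinear_ip] bilinear_radd[OF bilinear_ip] bilinear_lmul[OF bilinear_ip]
    bilinear_rmul[OF bilinear_ip] bilinear_lsub[OF bilinear_ip] bilinear_rsub[OF bilinear_ip]
    bilinear_lneg[OF bilinear_ip] bilinear_rneg[OF bilinear_ip] bilinear_lzero[OF bilinear_ip]
    bilinear_rzero[OF bilinear_ip]
  by simp_all

lemma ip_eq_0_iff [simp]: "ip x x = 0 \<longleftrightarrow> x = 0"
  by (metis ip_pos ip_simps(9) less_irrefl)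

lemma ip_ge_0 [simp]: "ip x x \<ge> 0"
  by (cases "x = 0") (auto dest: ip_pos)

lemma continuous_on_ip:
  "continuous_on S f \<Longrightarrow> continuous_on S g \<Longrightarrow> continuous_on S (\<lambda>x. ip (f x) (g x))"
  by (rule bounded_bilinear.continuous_on[OF bilinear_ip[unfolded bilinear_conv_bounded_bilinear]])

lemma ip_norm_bounds:
  obtains c C where "c > 0" "C > 0" "\<And>x. c * (norm x)\<^sup>2 \<le> ip x x" "\<And>x. ip x x \<le> C * (norm x)\<^sup>2"
proof -
  have ne: "sphere (0::'a) 1 \<noteq> {}" by simp
  have cont: "continuous_on (sphere 0 1) (\<lambda>x. ip x x)"
    by (rule continuous_on_ip[OF continuous_on_id continuous_on_id])
  obtain a where a: "norm a = 1" "\<And>x. norm x = 1 \<Longrightarrow> ip a a \<le> ip x x"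
    using continuous_attains_inf[OF compact_sphere ne cont] by auto
  obtain b where b: "norm b = 1" "\<And>x. norm x = 1 \<Longrightarrow> ip x x \<le> ip b b"
    using continuous_attains_sup[OF compact_sphere ne cont] by auto
  have sc: "ip x x = (norm x)\<^sup>2 * ip (inverse (norm x) *\<^sub>R x) (inverse (norm x) *\<^sub>R x)" if "x \<noteq> 0" for x
    using that by (simp add: power2_eq_square field_simps)
  show ?thesis
  proof
    show "ip a a > 0" "ip b b > 0" using a(1) b(1) by (auto intro: ip_pos)
    show "ip a a * (norm x)\<^sup>2 \<le> ip x x" for x
    proof (cases "x = 0")
      case False
      then have "norm (inverse (norm x) *\<^sub>R x) = 1" by simp
      from a(2)[OF this] show ?thesis
        unfolding sc[OF False] by (subst mult.commute) (rule mult_left_mono, auto)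
    qed simp
    show "ip x x \<le> ip b b * (norm x)\<^sup>2" for x
    proof (cases "x = 0")
      case False
      then have "norm (inverse (norm x) *\<^sub>R x) = 1" by simp
      from b(2)[OF this] show ?thesis
        unfolding sc[OF False] by (subst mult.commute[of "ip b b"]) (rule mult_left_mono, auto)
    qed simp
  qed
qed

text \<open>The constant depends on the form alone and so bounds all isometries at once; for the
  group \<open>K\<close> this does the work of compactness.\<close>

lemma ip_isometry_bound:
  obtains C where "C > 0" "\<And>f x. (\<And>x. ip (f x) (f x) = ip x x) \<Longrightarrow> norm (f x) \<le> C * norm x"
proof -
  obtain c C where *: "c > 0" "C > 0" "\<And>x. c * (norm x)\<^sup>2 \<le> ip x x" "\<And>x. ip x x \<le> C * (norm x)\<^sup>2"
    using ip_norm_bounds by blast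
  show ?thesis
  proof
    show "sqrt (C / c) > 0" using * by simp
    fix f :: "'a \<Rightarrow> 'a" and x assume "\<And>x. ip (f x) (f x) = ip x x"
    then have "c * (norm (f x))\<^sup>2 \<le> C * (norm x)\<^sup>2" using *(3)[of "f x"] *(4)[of x] by simp
    then have "(norm (f x))\<^sup>2 \<le> C / c * (norm x)\<^sup>2" using *(1) by (simp add: field_simps)
    then have "sqrt ((norm (f x))\<^sup>2) \<le> sqrt (C / c * (norm x)\<^sup>2)" by (rule real_sqrt_le_mono)
    then show "norm (f x) \<le> sqrt (C / c) * norm x" by (simp add: real_sqrt_mult real_sqrt_divide)
  qed
qed

text \<open>Cauchy-Schwarz for a form that is only positive semidefinite on W.\<close>

lemma psd_form_null:
  assumes "subspace W" "\<And>y. y \<in> W \<Longrightarrow> ip (f y) y \<ge> 0" "linear f"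
    and "\<And>y z. y \<in> W \<Longrightarrow> z \<in> W \<Longrightarrow> ip (f y) z = ip y (f z)"
    and "x \<in> W" "z \<in> W" "ip (f x) x = 0"
  shows "ip (f x) z = 0"
proof -
  let ?N = "ip (f z) z" and ?b = "ip (f x) z"
  \<comment> \<open>This t makes the polynomial 2 t ?b + t^2 ?N negative unless ?b = 0; the summand
    1 in the denominator covers the case ?N = 0.\<close>
  define t where "t = - ?b / (?N + 1)"
  have N: "?N \<ge> 0" using assms by auto
  have "x + t *\<^sub>R z \<in> W"
    by (rule subspace_add[OF assms(1,5) subspace_scale[OF assms(1,6)]])
  then have "0 \<le> ip (f (x + t *\<^sub>R z)) (x + t *\<^sub>R z)"
    by (rule assms(2))
  also have "\<dots> = 2 * t * ?b + t\<^sup>2 * ?N"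
    using assms(4)[OF assms(6,5)] assms(7) ip_commute[of z "f x"]
    by (simp add: linear_add[OF assms(3)] linear_cmul[OF assms(3)] power2_eq_square algebra_simps)
  finally have "0 \<le> (2 * t * ?b + t\<^sup>2 * ?N) * (?N + 1)\<^sup>2" by simp
  also have "\<dots> = 2 * (t * (?N + 1)) * ?b * (?N + 1) + (t * (?N + 1))\<^sup>2 * ?N"
    by (simp add: power2_eq_square algebra_simps)
  also have "t * (?N + 1) = - ?b" using N by (simp add: t_def)
  also have "2 * - ?b * ?b * (?N + 1) + (- ?b)\<^sup>2 * ?N = - (?b\<^sup>2 * (?N + 2))"
    by (simp add: power2_eq_square algebra_simps)
  finally have "?b\<^sup>2 * (?N + 2) \<le> 0" by simp
  then have "?b\<^sup>2 \<le> 0" using N by (simp add: mult_le_0_iff)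
  then show ?thesis by simp
qed

text \<open>At a maximiser x of the Rayleigh quotient q, the operator \<open>q x\<close> minus f is
  positive semidefinite on W and null at x. Then \<open>psd_form_null\<close>, applied with its
  value at x as second vector, shows that this value is 0.\<close>

lemma selfadjoint_eigenvector:
  assumes W: "subspace W" "W \<noteq> {0}" and f: "linear f" "f ` W \<subseteq> W"
    and sa: "\<And>x y. ip (f x) y = ip x (f y)"
  obtains x \<mu> where "x \<in> W" "x \<noteq> 0" "f x = \<mu> *\<^sub>R x"
proof -
  let ?S = "sphere 0 1 \<inter> W"
  obtain w where w: "w \<in> W" "w \<noteq> 0" using W subspace_0 by blast
  have S: "compact ?S" "?S \<noteq> {}"
  proof -
    show "compact ?S" using W(1) by (intro compact_Int_closed compact_sphere closed_subspace)
    have "inverse (norm w) *\<^sub>R w \<in> ?S" using w W(1) by (simp add: subspace_scale)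
    then show "?S \<noteq> {}" by blast
  qed
  define q where "q x = ip (f x) x / ip x x" for x
  have "continuous_on ?S q"
    unfolding q_def using f(1)
    by (intro continuous_intros continuous_on_ip) (auto simp: linear_continuous_on linear_linear)
  then obtain x where x: "x \<in> ?S" "\<And>y. y \<in> ?S \<Longrightarrow> q y \<le> q x"
    using continuous_attains_sup[OF S] by blast
  define g where "g y = q x *\<^sub>R y - f y" for y
  have lg: "linear g" unfolding g_def
    by (rule linearI) (simp_all add: linear_add[OF f(1)] linear_cmul[OF f(1)] algebra_simps)
  have sag: "ip (g y) z = ip y (g z)" for y z by (simp add: g_def sa)
  have ge: "ip (g y) y \<ge> 0" if "y \<in> W" for y
  proof (cases "y = 0")
    case False
    have "inverse (norm y) *\<^sub>R y \<in> ?S" using False that W(1) by (simp add: subspace_scale)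
    from x(2)[OF this] have "q y \<le> q x"
      using False by (simp add: q_def linear_cmul[OF f(1)])
    then show ?thesis
      using ip_pos[OF False] by (simp add: g_def q_def field_simps)
  qed (simp add: g_def)
  have gx: "ip (g x) x = 0" using x(1) by (auto simp: g_def q_def)
  have "g x \<in> W" using x f W(1) by (auto simp: g_def intro!: subspace_diff subspace_scale)
  with psd_form_null[OF W(1) ge lg sag _ _ gx] x have "ip (g x) (g x) = 0" by blast
  then have "g x = 0" by (simp only: ip_eq_0_iff)
  then have "f x = q x *\<^sub>R x" by (simp add: g_def)
  with x(1) show ?thesis by (intro that[of x "q x"]) auto
qed

text \<open>If every member of F is scalar on W, any nonzero vector will do. Otherwise an eigenspace
  of a nonscalar member is a smaller subspace, invariant under all of F by commutation. The family
  may be infinite.\<close>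

lemma joint_eigenvector:
  assumes "subspace W" "W \<noteq> {0}" "\<And>f. f \<in> F \<Longrightarrow> linear f" "\<And>f. f \<in> F \<Longrightarrow> f ` W \<subseteq> W"
    and "\<And>f x y. f \<in> F \<Longrightarrow> ip (f x) y = ip x (f y)"
    and "\<And>f g x. f \<in> F \<Longrightarrow> g \<in> F \<Longrightarrow> f (g x) = g (f x)"
  shows "\<exists>x\<in>W. x \<noteq> 0 \<and> (\<forall>f\<in>F. \<exists>\<mu>. f x = \<mu> *\<^sub>R x)"
  using assms(1,2,4)
proof (induction "dim W" arbitrary: W rule: less_induct)
  case less
  show ?case
  proof (cases "\<forall>f\<in>F. \<exists>\<mu>. \<forall>x\<in>W. f x = \<mu> *\<^sub>R x")
    case True
    obtain x where "x \<in> W" "x \<noteq> 0" using less.prems subspace_0 by blast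
    with True show ?thesis by blast
  next
    case False
    then obtain f where f: "f \<in> F" "\<not> (\<exists>\<mu>. \<forall>x\<in>W. f x = \<mu> *\<^sub>R x)" by blast
    have "ip (f x) y = ip x (f y)" for x y using assms(5)[OF f(1)] .
    then obtain x \<mu> where x: "x \<in> W" "x \<noteq> 0" "f x = \<mu> *\<^sub>R x"
      using selfadjoint_eigenvector[OF less.prems(1,2) assms(3)[OF f(1)] less.prems(3)[OF f(1)]] by blast
    define W' where "W' = {y \<in> W. f y = \<mu> *\<^sub>R y}"
    have lf: "linear f" using assms(3) f(1) by blast
    have W': "subspace W'" unfolding W'_def subspace_def using less.prems(1)
      by (auto simp: subspace_0 subspace_add subspace_scale linear_0[OF lf] linear_add[OF lf]
          linear_cmul[OF lf] scaleR_add_right)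
    have "W' \<subset> W" using f(2) by (auto simp: W'_def)
    then have "dim W' < dim W"
      using W' less.prems(1) by (metis dim_subset dim_psubset span_eq_iff)
    moreover have "g ` W' \<subseteq> W'" if "g \<in> F" for g
      using less.prems(3)[OF that] assms(6)[OF f(1) that] linear_cmul[OF assms(3)[OF that]]
      by (auto simp: W'_def)
    moreover have "W' \<noteq> {0}" using x by (auto simp: W'_def)
    ultimately have "\<exists>x\<in>W'. x \<noteq> 0 \<and> (\<forall>f\<in>F. \<exists>\<mu>. f x = \<mu> *\<^sub>R x)"
      using less.hyps W' by blast
    then show ?thesis by (auto simp: W'_def)
  qed
qed

lemma orthogonal_vector_exists:
  assumes "span J \<noteq> UNIV"
  obtains w where "w \<noteq> 0" "\<And>j. j \<in> J \<Longrightarrow> ip j w = 0"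
proof -
  obtain a where a: "a \<noteq> 0" "\<And>x. x \<in> span J \<Longrightarrow> a \<bullet> x = 0"
    using span_not_univ_subset_hyperplane[OF assms] by auto
  \<comment> \<open>The Riesz map that translates \<open>ip\<close> into the Euclidean product, for
    which separation by hyperplanes is available.\<close>
  define P where "P x = (\<Sum>b\<in>Basis. ip x b *\<^sub>R b)" for x
  have lP: "linear P" unfolding P_def
    by (rule linearI) (simp_all add: scaleR_add_left sum.distrib scaleR_sum_right)
  have P: "P x \<bullet> y = ip x y" for x y
  proof -
    have "ip x y = ip x (\<Sum>b\<in>Basis. (y \<bullet> b) *\<^sub>R b)" by (simp only: euclidean_representation)
    also have "\<dots> = (\<Sum>b\<in>Basis. (y \<bullet> b) * ip x b)" by (simp add: linear_sum[OF linear_ip_right] del: euclidean_representation)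
    finally show ?thesis by (simp add: P_def inner_sum_left inner_commute[of y] mult.commute)
  qed
  have "inj P"
    unfolding linear_injective_0[OF lP] using P ip_eq_0_iff by (metis inner_zero_left)
  then obtain w where "P w = a" using linear_injective_imp_surjective[OF lP] by (metis surjD)
  then show ?thesis using that[of w] a P ip_commute linear_0[OF lP] by (metis span_base)
qed

text \<open>The \<open>ip\<close>-complement of the joint eigenvectors is invariant by
  self-adjointness; were it nonzero, it would contain a joint eigenvector, orthogonal to
  itself.\<close>

lemma span_joint_eigenvectors:
  assumes "\<And>f. f \<in> F \<Longrightarrow> linear f" "\<And>f x y. f \<in> F \<Longrightarrow> ip (f x) y = ip x (f y)"
    and "\<And>f g x. f \<in> F \<Longrightarrow> g \<in> F \<Longrightarrow> f (g x) = g (f x)"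
  shows "span {x. \<forall>f\<in>F. \<exists>\<mu>. f x = \<mu> *\<^sub>R x} = UNIV"
proof (rule ccontr)
  let ?J = "{x. \<forall>f\<in>F. \<exists>\<mu>. f x = \<mu> *\<^sub>R x}"
  let ?W = "{w. \<forall>j\<in>?J. ip j w = 0}"
  assume "span ?J \<noteq> UNIV"
  then obtain w where "w \<noteq> 0" "\<And>j. j \<in> ?J \<Longrightarrow> ip j w = 0"
    using orthogonal_vector_exists by blast
  then have ne: "?W \<noteq> {0}" by blast
  have W: "subspace ?W" by (simp add: subspace_def)
  have inv: "f ` ?W \<subseteq> ?W" if "f \<in> F" for f
  proof (intro image_subsetI CollectI ballI)
    fix w j assume "w \<in> ?W" and j: "j \<in> ?J"
    moreover have "\<exists>\<mu>. f j = \<mu> *\<^sub>R j" using j that by simp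
    then obtain \<mu> where "f j = \<mu> *\<^sub>R j" by (elim exE)
    ultimately show "ip j (f w) = 0" using assms(2)[OF that, of j w] by simp
  qed
  have "\<exists>x\<in>?W. x \<noteq> 0 \<and> (\<forall>f\<in>F. \<exists>\<mu>. f x = \<mu> *\<^sub>R x)"
  proof (rule joint_eigenvector[OF W ne])
    show "linear f" "f ` ?W \<subseteq> ?W" if "f \<in> F" for f
      using assms(1)[OF that] inv[OF that] by this+
    show "ip (f x) y = ip x (f y)" if "f \<in> F" for f x y
      using assms(2)[OF that] .
    show "f (g x) = g (f x)" if "f \<in> F" "g \<in> F" for f g x
      using assms(3)[OF that] .
  qed
  then obtain x where x: "x \<in> ?W" "x \<noteq> 0" "x \<in> ?J" by auto
  have "\<forall>j\<in>?J. ip j x = 0" using x(1) by (rule CollectD)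
  from bspec[OF this x(3)] x(2) show False by simp
qed

end

section \<open>The Killing form and the Cartan inner product\<close>

lemma trace_map_compose_commute:
  fixes f g :: "'g::euclidean_space \<Rightarrow> 'g"
  assumes "linear f" "linear g"
  shows "trace_map (\<lambda>x. f (g x)) = trace_map (\<lambda>x. g (f x))"
proof -
  have expand: "f (g b) \<bullet> b = (\<Sum>c\<in>Basis. (g b \<bullet> c) * (f c \<bullet> b))" if "linear f" for f g :: "'g \<Rightarrow> 'g" and b
  proof -
    have "f (g b) = f (\<Sum>c\<in>Basis. (g b \<bullet> c) *\<^sub>R c)" by (simp only: euclidean_representation)
    also have "\<dots> = (\<Sum>c\<in>Basis. (g b \<bullet> c) *\<^sub>R f c)"
      by (simp only: linear_sum[OF that] linear_cmul[OF that])
    finally show ?thesis by (simp add: inner_sum_left)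
  qed
  have "trace_map (\<lambda>x. f (g x)) = (\<Sum>b\<in>Basis. \<Sum>c\<in>Basis. (g b \<bullet> c) * (f c \<bullet> b))"
    by (simp only: trace_map_def expand[OF assms(1)])
  also have "\<dots> = (\<Sum>c\<in>Basis. \<Sum>b\<in>Basis. (g b \<bullet> c) * (f c \<bullet> b))"
    by (rule sum.swap)
  also have "\<dots> = (\<Sum>c\<in>Basis. \<Sum>b\<in>Basis. (f c \<bullet> b) * (g b \<bullet> c))"
    by (simp only: mult.commute)
  also have "\<dots> = trace_map (\<lambda>x. g (f x))"
    by (simp only: trace_map_def expand[OF assms(2)])
  finally show ?thesis .
qed

lemma trace_map_simps:
  "trace_map (\<lambda>x. f x + g x) = trace_map f + trace_map g"
  "trace_map (\<lambda>x. f x - g x) = trace_map f - trace_map g"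
  "trace_map (\<lambda>x. c *\<^sub>R f x) = c * trace_map f"
  by (simp_all add: trace_map_def inner_add_left inner_diff_left sum.distrib sum_subtractf sum_distrib_left)

locale real_lie_algebra =
  fixes br :: "'g::euclidean_space \<Rightarrow> 'g \<Rightarrow> 'g"
  assumes lie: "lie_algebra br"
begin

lemma bilinear_br: "bilinear br"
  using lie by (simp add: lie_algebra_def)

lemma br_simps:
  "br (x + y) z = br x z + br y z" "br x (y + z) = br x y + br x z"
  "br (c *\<^sub>R x) z = c *\<^sub>R br x z" "br x (c *\<^sub>R z) = c *\<^sub>R br x z"
  "br (x - y) z = br x z - br y z" "br x (y - z) = br x y - br x z"
  "br (- x) z = - br x z" "br x (- z) = - br x z" "br 0 z = 0" "br x 0 = 0" "br x x = 0"
  using bilinear_ladd[OF bilinear_br] bilinear_radd[OF bilinear_br] bilinear_lmul[OF bilinear_br]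
    bilinear_rmul[OF bilinear_br] bilinear_lsub[OF bilinear_br] bilinear_rsub[OF bilinear_br]
    bilinear_lneg[OF bilinear_br] bilinear_rneg[OF bilinear_br] bilinear_lzero[OF bilinear_br]
    bilinear_rzero[OF bilinear_br] lie
  by (simp_all add: lie_algebra_def)

lemma linear_br: "linear (br x)" and linear_br_left: "linear (\<lambda>x. br x y)"
  by (rule linearI; simp add: br_simps)+

lemma br_anti: "br x y = - br y x"
proof -
  have "br (x + y) (x + y) = (br x x + br y x) + (br x y + br y y)" by (simp only: br_simps(1,2))
  then have "br x y + br y x = 0" by (simp add: br_simps(11) add.commute)
  then show ?thesis by (simp add: eq_neg_iff_add_eq_0)
qed

lemma br_jacobi: "br x (br y z) = br (br x y) z + br y (br x z)"
proof -
  have "br x (br y z) + br y (br z x) + br z (br x y) = 0"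
    using lie by (simp add: lie_algebra_def)
  moreover have "br y (br z x) = - br y (br x z)"
    by (subst br_anti[of z x]) (simp add: br_simps)
  moreover have "br z (br x y) = - br (br x y) z" by (rule br_anti)
  ultimately show ?thesis by (simp add: algebra_simps)
qed

lemma ad_apply [simp]: "blinfun_apply (ad br x) = br x"
  unfolding ad_def by (rule bounded_linear_Blinfun_apply) (use linear_br in \<open>simp add: linear_linear\<close>)

lemma linear_ad: "linear (ad br)"
  by (rule linearI) (auto intro!: blinfun_eqI simp: br_simps blinfun.add_left blinfun.scaleR_left)

lemma killing_form_simps:
  "killing_form br (x + y) z = killing_form br x z + killing_form br y z"
  "killing_form br (c *\<^sub>R x) z = c * killing_form br x z"
  by (simp_all add: killing_form_def br_simps trace_map_simps)

lemma killing_form_commute: "killing_form br x y = killing_form br y x"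
  unfolding killing_form_def by (rule trace_map_compose_commute[OF linear_br linear_br])

lemma killing_form_invariant: "killing_form br (br x y) z = - killing_form br y (br x z)"
proof -
  have lin: "linear (\<lambda>w. br y (br z w))"
    using linear_compose[OF linear_br linear_br, of y z] by (simp add: o_def)
  have *: "br (br x y) w = br x (br y w) - br y (br x w)" for x y w
    using br_jacobi[of x y w] by simp
  have "killing_form br (br x y) z + killing_form br y (br x z)
      = trace_map (\<lambda>w. br x (br y (br z w))) - trace_map (\<lambda>w. br y (br z (br x w)))"
    by (simp add: killing_form_def * br_simps trace_map_simps)
  also have "\<dots> = 0"
    using trace_map_compose_commute[OF linear_br lin, of x] by simp
  finally show ?thesis by simp
qed

lemma killing_form_hom:
  assumes "linear f" "linear h" "\<And>x. h (f x) = x" "\<And>x. f (h x) = x"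
    and "\<And>x y. f (br x y) = br (f x) (f y)"
  shows "killing_form br (f x) (f y) = killing_form br x y"
proof -
  have lin: "linear (\<lambda>z. br x (br y (h z)))"
    using linear_compose[OF assms(2) linear_compose[OF linear_br linear_br]] by (simp add: o_def)
  have "br (f x) (br (f y) z) = f (br x (br y (h z)))" for z
    by (simp add: assms)
  then have "killing_form br (f x) (f y) = trace_map (\<lambda>z. f (br x (br y (h z))))"
    by (simp add: killing_form_def)
  also have "\<dots> = trace_map (\<lambda>z. br x (br y (h (f z))))"
    by (rule trace_map_compose_commute[OF assms(1) lin])
  finally show ?thesis by (simp add: assms killing_form_def)
qed

subsection \<open>Products of translates of adjoint maps\<close>

text \<open>This is p (ad z) for the monic polynomial p with roots \<open>cs\<close>; given by its
  roots instead of its coefficients, it can be treated one linear factor at a time.\<close>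

primrec adprod :: "real list \<Rightarrow> 'g \<Rightarrow> 'g \<Rightarrow> 'g" where
  "adprod [] z v = v"
| "adprod (c # cs) z v = adprod cs z (br z v - c *\<^sub>R v)"

lemma linear_adprod: "linear (adprod cs z)"
proof (induction cs)
  case Nil
  then show ?case by (simp add: linear_id[unfolded id_def])
next
  case (Cons c cs)
  have "linear (\<lambda>v. br z v - c *\<^sub>R v)"
    by (rule linearI) (simp_all add: br_simps algebra_simps)
  from linear_compose[OF this Cons] show ?case by (simp add: o_def)
qed

lemma adprod_commute: "adprod cs z (br z v - c *\<^sub>R v) = br z (adprod cs z v) - c *\<^sub>R adprod cs z v"
proof (induction cs arbitrary: v)
  case (Cons d cs)
  have "adprod (d # cs) z (br z v - c *\<^sub>R v) = adprod cs z (br z (br z v - d *\<^sub>R v) - c *\<^sub>R (br z v - d *\<^sub>R v))"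
    by (simp add: br_simps algebra_simps)
  also note Cons
  finally show ?case by simp
qed simp

lemma adprod_eigenvector:
  "br z v = c *\<^sub>R v \<Longrightarrow> adprod cs z v = (\<Prod>d\<leftarrow>cs. c - d) *\<^sub>R v"
proof (induction cs)
  case (Cons d cs)
  have "br z v - d *\<^sub>R v = (c - d) *\<^sub>R v" using Cons.prems by (simp add: algebra_simps)
  then show ?case
    using Cons by (simp add: linear_cmul[OF linear_adprod])
qed simp

lemma adprod_eigenvector_zero: "br z v = c *\<^sub>R v \<Longrightarrow> c \<in> set cs \<Longrightarrow> adprod cs z v = 0"
  using adprod_eigenvector[of z v c cs] by (auto simp: prod_list_zero_iff)

lemma adprod_mem:
  assumes "subspace W" "\<And>w. w \<in> W \<Longrightarrow> br z w \<in> W"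
  shows "v \<in> W \<Longrightarrow> adprod cs z v \<in> W"
proof (induction cs arbitrary: v)
  case (Cons c cs)
  then have "br z v - c *\<^sub>R v \<in> W" using assms by (simp add: subspace_diff subspace_scale)
  with Cons show ?case by simp
qed simp

lemma adprod_hom:
  assumes "linear g" "\<And>x y. g (br x y) = br (g x) (g y)"
  shows "adprod cs (g z) (g v) = g (adprod cs z v)"
proof (induction cs arbitrary: v)
  case (Cons c cs)
  have "br (g z) (g v) - c *\<^sub>R g v = g (br z v - c *\<^sub>R v)"
    by (simp add: assms linear_diff linear_cmul)
  with Cons show ?case by simp
qed simp

lemma Ck_on_adprod:
  assumes "linear a" "Ck_on n f UNIV"
  shows "Ck_on n (\<lambda>x. adprod cs (a x) (f x)) UNIV"
  using assms(2)
proof (induction cs arbitrary: f)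
  case (Cons c cs)
  have bb: "bounded_bilinear br" using bilinear_br by (simp add: bilinear_conv_bounded_bilinear)
  have "Ck_on n (\<lambda>x. br (a x) (f x) - c *\<^sub>R f x) UNIV"
    by (rule Ck_on_diff[OF Ck_on_bilinear[OF bb Ck_on_linear[OF assms(1)] Cons.prems]
          Ck_on_linear_compose[OF bounded_linear_scaleR_right Cons.prems]]) simp_all
  from Cons.IH[OF this] show ?case by simp
qed simp

section \<open>Automorphism groups and adjoint orbits\<close>

lemma lie_automorphisms_id: "id_blinfun \<in> lie_automorphisms br"
  by (simp add: lie_automorphisms_def bij_id[unfolded id_def] id_blinfun.rep_eq)

lemma lie_automorphisms_compose:
  assumes "g \<in> lie_automorphisms br" "h \<in> lie_automorphisms br"
  shows "g o\<^sub>L h \<in> lie_automorphisms br"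
proof -
  have "blinfun_apply (g o\<^sub>L h) = blinfun_apply g \<circ> blinfun_apply h" by auto
  then show ?thesis using assms by (simp add: lie_automorphisms_def bij_comp)
qed

lemma lie_automorphisms_inverse:
  assumes "g \<in> lie_automorphisms br"
  obtains h where "h \<in> lie_automorphisms br" "h o\<^sub>L g = id_blinfun" "g o\<^sub>L h = id_blinfun"
    "\<And>x. h (g x) = x" "\<And>x. g (h x) = x"
proof -
  have b: "bij (blinfun_apply g)" and hom: "g (br x y) = br (g x) (g y)" for x y
    using assms by (auto simp: lie_automorphisms_def)
  have "linear (inv (blinfun_apply g))" 
  proof (rule linearI)
    have "inj (blinfun_apply g)" and gi: "g (inv (blinfun_apply g) x) = x" for x
      using b by (simp_all add: bij_is_inj bij_is_surj surj_f_inv_f)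
    then show "inv (blinfun_apply g) (x + y) = inv (blinfun_apply g) x + inv (blinfun_apply g) y" for x y
      by (intro inv_f_eq) (simp_all add: blinfun.add_right)
    show "inv (blinfun_apply g) (c *\<^sub>R x) = c *\<^sub>R inv (blinfun_apply g) x" for c x
      using \<open>inj (blinfun_apply g)\<close> gi by (intro inv_f_eq) (simp_all add: blinfun.scaleR_right)
  qed
  then have h: "blinfun_apply (Blinfun (inv (blinfun_apply g))) = inv (blinfun_apply g)"
    by (intro bounded_linear_Blinfun_apply) (simp add: linear_linear)
  let ?h = "Blinfun (inv (blinfun_apply g))"
  have hg: "?h (g x) = x" and gh: "g (?h x) = x" for x
    using b by (simp_all add: h bij_is_inj bij_is_surj surj_f_inv_f)
  have "?h (br x y) = br (?h x) (?h y)" for x y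
    using hg[of "br (?h x) (?h y)"] by (simp add: hom gh)
  then have "?h \<in> lie_automorphisms br"
    using b by (simp add: lie_automorphisms_def h bij_imp_bij_inv)
  then show ?thesis
    by (rule that) (auto intro!: blinfun_eqI simp: hg gh)
qed

lemma connected_component_image:
  assumes "continuous_on S f" "f ` S \<subseteq> T" "a \<in> S"
  shows "f ` connected_component_set S a \<subseteq> connected_component_set T (f a)"
proof (rule connected_component_maximal)
  show "f a \<in> f ` connected_component_set S a"
    using assms(3) by (simp add: connected_component_refl)
  show "connected (f ` connected_component_set S a)"
    using assms(1) connected_component_subset continuous_on_subset
    by (intro connected_continuous_image) (blast, simp)
  show "f ` connected_component_set S a \<subseteq> T"
    using assms(2) connected_component_subset by blast
qed

lemma Aut0_subset: "Aut0 br \<subseteq> lie_automorphisms br"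
  by (simp add: Aut0_def connected_component_subset)

lemma id_in_Aut0: "id_blinfun \<in> Aut0 br"
  by (simp add: Aut0_def connected_component_refl lie_automorphisms_id)

lemma Aut0_compose:
  assumes "g \<in> Aut0 br" "h \<in> Aut0 br"
  shows "g o\<^sub>L h \<in> Aut0 br"
proof -
  have h: "h \<in> lie_automorphisms br" using assms Aut0_subset by auto
  have "(\<lambda>g. g o\<^sub>L h) ` Aut0 br \<subseteq> connected_component_set (lie_automorphisms br) (id_blinfun o\<^sub>L h)"
    unfolding Aut0_def
    using lie_automorphisms_compose[OF _ h] lie_automorphisms_id
    by (intro connected_component_image) (auto intro!: continuous_intros)
  also have "id_blinfun o\<^sub>L h = h" by (rule blinfun_eqI) simp
  also have "connected_component_set (lie_automorphisms br) h = Aut0 br"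
    using assms(2) unfolding Aut0_def by (metis connected_component_eq)
  finally show ?thesis using assms(1) by auto
qed

text \<open>Left translation by the inverse h moves g to the identity, hence maps the component of g
  into that of the identity. Both are \<open>Aut0\<close>, and the image of the identity is
  h.\<close>

lemma Aut0_inverse:
  assumes "g \<in> Aut0 br"
  obtains h where "h \<in> Aut0 br" "\<And>x. h (g x) = x" "\<And>x. g (h x) = x"
proof -
  have "g \<in> lie_automorphisms br" using assms Aut0_subset by auto
  from lie_automorphisms_inverse[OF this] obtain h where h: "h \<in> lie_automorphisms br"
    "h o\<^sub>L g = id_blinfun" "\<And>x. h (g x) = x" "\<And>x. g (h x) = x" by metis
  have eq: "connected_component_set (lie_automorphisms br) g = Aut0 br"
    using assms unfolding Aut0_def by (metis connected_component_eq)
  have "(\<lambda>x. h o\<^sub>L x) ` connected_component_set (lie_automorphisms br) g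
      \<subseteq> connected_component_set (lie_automorphisms br) (h o\<^sub>L g)"
    using lie_automorphisms_compose[OF h(1)] \<open>g \<in> lie_automorphisms br\<close>
    by (intro connected_component_image) (auto intro!: continuous_intros)
  then have "h o\<^sub>L id_blinfun \<in> connected_component_set (lie_automorphisms br) (h o\<^sub>L g)"
    using id_in_Aut0 unfolding eq by blast
  then have "h o\<^sub>L id_blinfun \<in> Aut0 br" by (simp only: h(2) Aut0_def)
  moreover have "h o\<^sub>L id_blinfun = h" by (rule blinfun_eqI) simp
  ultimately show ?thesis using that h by simp
qed

lemma Aut0_hom: "g \<in> Aut0 br \<Longrightarrow> g (br x y) = br (g x) (g y)"
  using Aut0_subset by (auto simp: lie_automorphisms_def)

lemma linear_blinfun: "linear (blinfun_apply g)"
  by (simp add: blinfun.bounded_linear_right bounded_linear.linear)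

section \<open>Inner automorphisms and adjoint orbits\<close>

lemma blinfun_exp_derivation:
  fixes D :: "'g \<Rightarrow>\<^sub>L 'g"
  assumes "\<And>x y. D (br x y) = br (D x) y + br x (D y)"
  shows "blinfun_exp D (br x y) = br (blinfun_exp D x) (blinfun_exp D y)"
proof -
  have bb: "bounded_bilinear br" using bilinear_br by (simp add: bilinear_conv_bounded_bilinear)
  let ?u = "\<lambda>t. br (blinfun_exp (t *\<^sub>R D) x) (blinfun_exp (t *\<^sub>R D) y)"
  have "(?u has_vector_derivative D (?u t)) (at t)" for t
    using bounded_bilinear.has_vector_derivative[OF bb blinfun_exp_has_vector_derivative[of D x t]
        blinfun_exp_has_vector_derivative[of D y t]]
    by (simp add: assms blinfun_exp_scale_commute add.commute)
  from blinfun_exp_unique[OF this, of 1] show ?thesis by simp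
qed

lemma blinfun_exp_ad_hom: "blinfun_exp (ad br z) (br x y) = br (blinfun_exp (ad br z) x) (blinfun_exp (ad br z) y)"
  by (rule blinfun_exp_derivation, unfold ad_apply, rule br_jacobi)

lemma blinfun_exp_ad_in_Aut0: "blinfun_exp (ad br z) \<in> Aut0 br"
proof -
  have "bij (blinfun_apply (blinfun_exp A))" for A :: "'g \<Rightarrow>\<^sub>L 'g"
    by (rule bijI') (metis blinfun_exp_minus_left, metis blinfun_exp_minus_right)
  then have aut: "blinfun_exp (t *\<^sub>R ad br z) \<in> lie_automorphisms br" for t
    using blinfun_exp_ad_hom[of "t *\<^sub>R z"] by (simp add: lie_automorphisms_def linear_cmul[OF linear_ad])
  have "(\<lambda>t. blinfun_exp (t *\<^sub>R ad br z)) ` UNIV \<subseteq> Aut0 br"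
    unfolding Aut0_def
  proof (rule connected_component_maximal)
    show "id_blinfun \<in> range (\<lambda>t. blinfun_exp (t *\<^sub>R ad br z))"
      by (rule range_eqI[of _ _ 0]) simp
    show "connected (range (\<lambda>t. blinfun_exp (t *\<^sub>R ad br z)))"
      by (intro connected_continuous_image continuous_blinfun_exp_scale connected_UNIV)
  qed (use aut in auto)
  then have "blinfun_exp (1 *\<^sub>R ad br z) \<in> Aut0 br" by blast
  then show ?thesis by simp
qed

lemma connected_adjoint_orbit: "connected (adjoint_orbit br x)"
  unfolding adjoint_orbit_def Aut0_def
  by (intro connected_continuous_image connected_connected_component continuous_intros)

lemma adjoint_orbit_self: "x \<in> adjoint_orbit br x"
  unfolding adjoint_orbit_def by (rule image_eqI[OF _ id_in_Aut0]) simp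

lemma adjoint_orbit_Aut0: "g \<in> Aut0 br \<Longrightarrow> y \<in> adjoint_orbit br x \<Longrightarrow> g y \<in> adjoint_orbit br x"
  unfolding adjoint_orbit_def using Aut0_compose by force

text \<open>Conjugation by L is continuous, takes automorphisms to automorphisms of the transported
  bracket and fixes the identity, so it respects identity components.\<close>

lemma adjoint_orbit_conjugate_subset:
  fixes L M :: "'g \<Rightarrow> 'g"
  assumes L: "linear L" "linear M" "\<And>x. M (L x) = x" "\<And>x. L (M x) = x"
  shows "L ` adjoint_orbit br x \<subseteq> adjoint_orbit (\<lambda>x y. L (br (M x) (M y))) (L x)"
proof -
  let ?br' = "\<lambda>x y. L (br (M x) (M y))"
  have app: "blinfun_apply (Blinfun L) = L" "blinfun_apply (Blinfun M) = M"
    using L by (auto intro: bounded_linear_Blinfun_apply simp: linear_linear)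
  let ?c = "\<lambda>g. Blinfun L o\<^sub>L (g o\<^sub>L Blinfun M)"
  have bijs: "bij L" "bij M" using L by (metis bijI')+
  have "?c g \<in> lie_automorphisms ?br'" if "g \<in> lie_automorphisms br" for g
  proof -
    have "blinfun_apply (?c g) = L \<circ> (blinfun_apply g \<circ> M)" by (auto simp: app)
    moreover have "bij (L \<circ> (blinfun_apply g \<circ> M))"
      using bijs that by (auto simp: lie_automorphisms_def intro!: bij_comp)
    ultimately show ?thesis
      using that L by (simp add: lie_automorphisms_def)
  qed
  then have "?c ` Aut0 br \<subseteq> connected_component_set (lie_automorphisms ?br') (?c id_blinfun)"
    unfolding Aut0_def
    by (intro connected_component_image) (auto intro!: continuous_intros lie_automorphisms_id)
  moreover have "?c id_blinfun = id_blinfun"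
    by (rule blinfun_eqI) (simp add: app L)
  ultimately have "?c g \<in> Aut0 ?br'" if "g \<in> Aut0 br" for g
    using that by (auto simp: Aut0_def)
  moreover have "L (blinfun_apply g x) = ?c g (L x)" for g by (simp add: app L)
  ultimately have "L (blinfun_apply g x) \<in> (\<lambda>g. blinfun_apply g (L x)) ` Aut0 ?br'" if "g \<in> Aut0 br" for g
    using that by (intro image_eqI[of _ _ "?c g"]) auto
  then show ?thesis
    unfolding adjoint_orbit_def by (intro image_subsetI) (elim imageE, simp)
qed

end

lemma adjoint_orbit_conjugate:
  fixes br :: "'g::euclidean_space \<Rightarrow> 'g \<Rightarrow> 'g" and L M :: "'g \<Rightarrow> 'g"
  assumes br: "lie_algebra br" and L: "linear L" "linear M" "\<And>x. M (L x) = x" "\<And>x. L (M x) = x"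
  shows "adjoint_orbit (\<lambda>x y. L (br (M x) (M y))) (L x) = L ` adjoint_orbit br x"
proof
  let ?br' = "\<lambda>x y. L (br (M x) (M y))"
  interpret real_lie_algebra br by (unfold_locales) (rule br)
  have "lie_algebra ?br'"
    unfolding lie_algebra_def
  proof (intro conjI allI)
    show "bilinear ?br'"
      unfolding bilinear_def
      by (auto intro!: linearI simp: br_simps linear_add[OF L(1)] linear_add[OF L(2)]
          linear_cmul[OF L(1)] linear_cmul[OF L(2)])
    show "?br' x x = 0" for x by (simp add: br_simps linear_0[OF L(1)])
    fix x y z
    have "br (M x) (br (M y) (M z)) + br (M y) (br (M z) (M x)) + br (M z) (br (M x) (M y)) = 0"
      using br by (simp add: lie_algebra_def)
    then show "?br' x (?br' y z) + ?br' y (?br' z x) + ?br' z (?br' x y) = 0"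
      by (simp add: L linear_0[OF L(1)] flip: linear_add[OF L(1)])
  qed
  \<comment> \<open>As the transported bracket is again a Lie algebra, the inclusion applies to it
    with L and M exchanged, and this is the converse inclusion.\<close>
  then interpret b': real_lie_algebra ?br' by unfold_locales
  have "M ` adjoint_orbit ?br' (L x) \<subseteq> adjoint_orbit br x"
    using b'.adjoint_orbit_conjugate_subset[OF L(2,1,4,3), of "L x"] by (simp add: L)
  then have "L ` M ` adjoint_orbit ?br' (L x) \<subseteq> L ` adjoint_orbit br x" by (rule image_mono)
  then show "adjoint_orbit ?br' (L x) \<subseteq> L ` adjoint_orbit br x"
    by (simp add: image_image L)
  show "L ` adjoint_orbit br x \<subseteq> adjoint_orbit ?br' (L x)"
    by (rule adjoint_orbit_conjugate_subset[OF L])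
qed

section \<open>Cartan involutions\<close>

locale cartan_algebra = real_lie_algebra br for br :: "'g::euclidean_space \<Rightarrow> 'g \<Rightarrow> 'g" +
  fixes \<theta> :: "'g \<Rightarrow> 'g"
  assumes cartan: "cartan_involution br \<theta>"
begin

lemma linear_theta: "linear \<theta>" and theta_theta [simp]: "\<theta> (\<theta> x) = x"
  and theta_br: "\<theta> (br x y) = br (\<theta> x) (\<theta> y)"
  using cartan by (auto simp: cartan_involution_def)

lemmas theta_simps = linear_add[OF linear_theta] linear_diff[OF linear_theta]
  linear_cmul[OF linear_theta] linear_neg[OF linear_theta] linear_0[OF linear_theta]

definition ip :: "'g \<Rightarrow> 'g \<Rightarrow> real" where
  "ip x y = - killing_form br x (\<theta> y)"

lemma ip_sym: "ip x y = ip y x"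
proof -
  have "killing_form br x (\<theta> y) = killing_form br (\<theta> (\<theta> x)) (\<theta> y)" by simp
  also have "\<dots> = killing_form br (\<theta> x) y"
    by (rule killing_form_hom[of \<theta> \<theta>]) (simp_all add: linear_theta theta_br)
  finally show ?thesis by (simp add: ip_def killing_form_commute[of y])
qed

sublocale inner_form ip
proof
  have l: "linear (\<lambda>x. ip x y)" for y
    by (rule linearI) (simp_all add: ip_def killing_form_simps)
  then have "linear (ip x)" for x
    by (subst (asm) ip_sym) (simp add: eta_contract_eq)
  with l show "bilinear ip" by (simp add: bilinear_def)
  show "ip x y = ip y x" for x y by (rule ip_sym)
  show "ip x x > 0" if "x \<noteq> 0" for x
    using cartan that by (simp add: cartan_involution_def ip_def)
qed

text \<open>Invariance of the Killing form moves ad x across with a minus sign, and \<theta> turns x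
  into its image. In particular ad x is self-adjoint when \<theta> x = - x.\<close>

lemma ip_br: "ip (br x y) z = ip y (br (- \<theta> x) z)"
  by (simp add: ip_def killing_form_invariant br_simps theta_simps theta_br)
    (simp add: killing_form_commute[of y] killing_form_simps(2)[of "-1", simplified])

lemma ip_adprod: "ip (adprod cs z v) w = ip v (adprod cs (- \<theta> z) w)"
proof (induction cs arbitrary: v w)
  case (Cons c cs)
  have "ip (adprod (c # cs) z v) w = ip (br z v - c *\<^sub>R v) (adprod cs (- \<theta> z) w)"
    by (simp add: Cons)
  also have "\<dots> = ip v (br (- \<theta> z) (adprod cs (- \<theta> z) w) - c *\<^sub>R adprod cs (- \<theta> z) w)"
    by (simp add: ip_br)
  also have "\<dots> = ip v (adprod (c # cs) (- \<theta> z) w)"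
    by (simp add: adprod_commute)
  finally show ?case .
qed simp

lemma center_trivial:
  assumes "\<And>x. br z x = 0"
  shows "z = 0"
proof -
  have "ip z z = 0" by (simp add: ip_def killing_form_def assms trace_map_def)
  then show ?thesis by simp
qed

lemma ip_automorphism:
  assumes "g \<in> lie_automorphisms br" "\<And>x. \<theta> (g x) = g (\<theta> x)"
  shows "ip (g x) (g y) = ip x y"
proof -
  obtain h where h: "\<And>x. blinfun_apply h (blinfun_apply g x) = x" "\<And>x. blinfun_apply g (blinfun_apply h x) = x"
    using lie_automorphisms_inverse[OF assms(1)] by metis
  have "killing_form br (g x) (g (\<theta> y)) = killing_form br x (\<theta> y)"
    by (rule killing_form_hom[OF linear_blinfun linear_blinfun[of h] h])
      (use assms(1) in \<open>simp add: lie_automorphisms_def\<close>)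
  then show ?thesis by (simp add: ip_def assms(2))
qed

text \<open>Every element of \<open>K\<close> is a finite product of exponentials of operators ad x
  with \<theta> x = x, and each such ad x commutes with \<theta>.\<close>

lemma connected_lie_subgroup_k_commutes:
  assumes "connected_lie_subgroup K" "lie_algebra_of K = ad br ` cartan_k \<theta>" "g \<in> K"
  shows "\<theta> (g x) = g (\<theta> x)"
proof -
  obtain As where As: "set As \<subseteq> ad br ` cartan_k \<theta>" "g = foldr (\<lambda>A h. blinfun_exp A o\<^sub>L h) As id_blinfun"
    using assms unfolding connected_lie_subgroup_def by metis
  have step: "\<theta> (blinfun_exp A x) = blinfun_exp A (\<theta> x)" if A: "A \<in> ad br ` cartan_k \<theta>" for A x
    by (rule blinfun_exp_intertwine[OF linear_theta]) (use A in \<open>auto simp: cartan_k_def theta_br\<close>)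
  have "\<theta> (foldr (\<lambda>A h. blinfun_exp A o\<^sub>L h) As id_blinfun x) = foldr (\<lambda>A h. blinfun_exp A o\<^sub>L h) As id_blinfun (\<theta> x)"
    using As(1) by (induction As arbitrary: x) (auto simp: step)
  with As(2) show ?thesis by simp
qed

end

section \<open>Eigenspaces of a semisimple element\<close>

locale cartan_element = cartan_algebra br \<theta> for br :: "'g::euclidean_space \<Rightarrow> 'g \<Rightarrow> 'g" and \<theta> +
  fixes H :: 'g
  assumes theta_H: "\<theta> H = - H"
begin

text \<open>Arbitrary sets of reals serve as index sets, so that brackets follow sums of index sets
  and \<theta> negates them. The sets {0<..}, {0..} and {0} give \<open>n\<close>, the parabolic
  subalgebra of H and the centralizer of H.\<close>

definition esum :: "real set \<Rightarrow> 'g set" where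
  "esum I = span {x. \<exists>c\<in>I. br H x = c *\<^sub>R x}"

lemma subspace_esum [simp]: "subspace (esum I)"
  by (simp add: esum_def)

lemma esum_mono: "I \<subseteq> J \<Longrightarrow> esum I \<subseteq> esum J"
  unfolding esum_def by (intro span_mono) auto

lemma eigenvector_in_esum: "br H x = c *\<^sub>R x \<Longrightarrow> c \<in> I \<Longrightarrow> x \<in> esum I"
  unfolding esum_def by (rule span_base) auto

lemma esum_induct:
  assumes "x \<in> esum I" "subspace W" "\<And>c x. c \<in> I \<Longrightarrow> br H x = c *\<^sub>R x \<Longrightarrow> x \<in> W"
  shows "x \<in> W"
proof -
  have "esum I \<subseteq> W" unfolding esum_def by (rule span_minimal) (use assms in auto)
  with assms(1) show ?thesis by blast
qed

lemma selfadjoint_H: "ip (br H x) y = ip x (br H y)"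
  by (simp add: ip_br theta_H)

lemma esum_UNIV: "esum UNIV = UNIV"
proof -
  have "span {x. \<forall>f\<in>{br H}. \<exists>c. f x = c *\<^sub>R x} = UNIV"
    by (rule span_joint_eigenvectors) (auto simp: selfadjoint_H linear_br)
  then show ?thesis by (simp add: esum_def)
qed

lemma esum_orthogonal:
  assumes "x \<in> esum I" "y \<in> esum J" "I \<inter> J = {}"
  shows "ip x y = 0"
proof -
  have "x \<in> {x. \<forall>y\<in>esum J. ip x y = 0}"
  proof (rule esum_induct[OF assms(1)])
    show "subspace {x. \<forall>y\<in>esum J. ip x y = 0}" by (simp add: subspace_def)
    fix c x assume c: "c \<in> I" "br H x = c *\<^sub>R x"
    show "x \<in> {x. \<forall>y\<in>esum J. ip x y = 0}"
    proof (intro CollectI ballI)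
      fix y assume "y \<in> esum J"
      then have "y \<in> {y. ip x y = 0}"
      proof (rule esum_induct)
        show "subspace {y. ip x y = 0}" by (simp add: subspace_def)
        fix d y assume d: "d \<in> J" "br H y = d *\<^sub>R y"
        have "c * ip x y = d * ip x y" using selfadjoint_H[of x y] c(2) d(2) by simp
        moreover have "c \<noteq> d" using c(1) d(1) assms(3) by auto
        ultimately show "y \<in> {y. ip x y = 0}" by simp
      qed
      then show "ip x y = 0" by simp
    qed
  qed
  with assms(2) show ?thesis by blast
qed

lemma esum_disjoint: "x \<in> esum I \<Longrightarrow> x \<in> esum J \<Longrightarrow> I \<inter> J = {} \<Longrightarrow> x = 0"
  using esum_orthogonal[of x I x J] by simp

lemma esum_decompose:
  obtains u w where "u \<in> esum I" "w \<in> esum (- I)" "x = u + w"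
proof -
  have "x \<in> {u + w | u w. u \<in> esum I \<and> w \<in> esum (- I)}"
  proof (rule esum_induct[of x UNIV])
    show "x \<in> esum UNIV" by (simp add: esum_UNIV)
    show "subspace {u + w | u w. u \<in> esum I \<and> w \<in> esum (- I)}"
      by (rule subspace_sums) simp_all
    fix c x assume c: "br H x = c *\<^sub>R x"
    show "x \<in> {u + w | u w. u \<in> esum I \<and> w \<in> esum (- I)}"
    proof (cases "c \<in> I")
      case True
      have "x = x + 0 \<and> x \<in> esum I \<and> 0 \<in> esum (- I)"
        using eigenvector_in_esum[OF c True] by (simp add: subspace_0)
      then show ?thesis by blast
    next
      case False
      then have "x = 0 + x \<and> 0 \<in> esum I \<and> x \<in> esum (- I)"
        using eigenvector_in_esum[OF c, of "- I"] by (simp add: subspace_0)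
      then show ?thesis by blast
    qed
  qed
  then show ?thesis using that by blast
qed

lemma br_esum:
  assumes "x \<in> esum I" "y \<in> esum J" "\<And>i j. i \<in> I \<Longrightarrow> j \<in> J \<Longrightarrow> i + j \<in> L"
  shows "br x y \<in> esum L"
proof -
  have "x \<in> {x. \<forall>y\<in>esum J. br x y \<in> esum L}"
  proof (rule esum_induct[OF assms(1)])
    show "subspace {x. \<forall>y\<in>esum J. br x y \<in> esum L}"
      by (simp add: subspace_def br_simps subspace_0[OF subspace_esum]
          subspace_add[OF subspace_esum] subspace_scale[OF subspace_esum])
    fix c x assume c: "c \<in> I" "br H x = c *\<^sub>R x"
    show "x \<in> {x. \<forall>y\<in>esum J. br x y \<in> esum L}"
    proof (intro CollectI ballI)
      fix y assume "y \<in> esum J"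
      then have "y \<in> {y. br x y \<in> esum L}"
      proof (rule esum_induct)
        show "subspace {y. br x y \<in> esum L}"
          by (simp add: subspace_def br_simps subspace_0[OF subspace_esum]
              subspace_add[OF subspace_esum] subspace_scale[OF subspace_esum])
        fix d y assume d: "d \<in> J" "br H y = d *\<^sub>R y"
        have "br H (br x y) = (c + d) *\<^sub>R br x y"
          by (subst br_jacobi) (simp add: c d br_simps scaleR_add_left)
        then show "y \<in> {y. br x y \<in> esum L}"
          using eigenvector_in_esum assms(3)[OF c(1) d(1)] by blast
      qed
      then show "br x y \<in> esum L" by simp
    qed
  qed
  with assms(2) show ?thesis by blast
qed

lemma H_in_esum: "0 \<in> I \<Longrightarrow> H \<in> esum I"
  by (rule eigenvector_in_esum[of H 0]) (simp_all add: br_simps)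

lemma br_H_esum: "x \<in> esum I \<Longrightarrow> br H x \<in> esum I"
  using br_esum[of H "{0}" x I I] H_in_esum by simp

lemma br_H_eq_0_iff: "br H x = 0 \<longleftrightarrow> x \<in> esum {0}"
proof
  show "br H x = 0 \<Longrightarrow> x \<in> esum {0}" by (rule eigenvector_in_esum[of _ 0]) auto
  assume "x \<in> esum {0}"
  then have "x \<in> {x. br H x = 0}"
    by (rule esum_induct) (auto simp: subspace_def br_simps)
  then show "br H x = 0" by simp
qed

text \<open>ad H respects the splitting into eigenvalues inside and outside I, and has no kernel on
  the outer part because 0 lies in I.\<close>

lemma br_H_in_esumD:
  assumes "br H x \<in> esum I" "0 \<in> I"
  shows "x \<in> esum I"
proof -
  obtain u w where uw: "u \<in> esum I" "w \<in> esum (- I)" "x = u + w" by (rule esum_decompose)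
  have "br H w = br H x - br H u" by (simp add: uw br_simps)
  also have "\<dots> \<in> esum I" using assms br_H_esum uw by (intro subspace_diff) auto
  finally have "br H w = 0" using br_H_esum[OF uw(2)] by (rule esum_disjoint) auto
  then have "w \<in> esum {0}" by (simp add: br_H_eq_0_iff)
  then have "w = 0" using uw(2) assms(2) by (intro esum_disjoint[of w "{0}" "- I"]) auto
  with uw show ?thesis by simp
qed

lemma esum_subset_br_H_image:
  assumes "0 \<notin> I"
  shows "esum I \<subseteq> br H ` esum I"
proof
  fix x assume "x \<in> esum I"
  then show "x \<in> br H ` esum I"
  proof (rule esum_induct)
    show "subspace (br H ` esum I)" by (intro linear_subspace_image linear_br subspace_esum)
    fix c x assume c: "c \<in> I" "br H x = c *\<^sub>R x"
    then have "x = br H ((1 / c) *\<^sub>R x)" using assms by (auto simp: br_simps)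
    moreover have "(1 / c) *\<^sub>R x \<in> esum I" using eigenvector_in_esum[OF c(2,1)] by (simp add: subspace_scale)
    ultimately show "x \<in> br H ` esum I" by (rule image_eqI)
  qed
qed

lemma theta_esum:
  assumes "x \<in> esum I"
  shows "\<theta> x \<in> esum (uminus ` I)"
proof -
  have "x \<in> {x. \<theta> x \<in> esum (uminus ` I)}"
  proof (rule esum_induct[OF assms])
    show "subspace {x. \<theta> x \<in> esum (uminus ` I)}"
      by (simp add: subspace_def theta_simps subspace_0[OF subspace_esum] subspace_add[OF subspace_esum] subspace_scale[OF subspace_esum])
    fix c x assume c: "c \<in> I" "br H x = c *\<^sub>R x"
    have "br H (\<theta> x) = - \<theta> (br H x)" by (simp add: theta_br theta_H br_simps)
    also have "\<dots> = (- c) *\<^sub>R \<theta> x" by (simp add: c theta_simps)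
    finally show "x \<in> {x. \<theta> x \<in> esum (uminus ` I)}"
      using c(1) by (intro CollectI eigenvector_in_esum[of _ "- c"]) auto
  qed
  then show ?thesis by simp
qed

lemma eigenbasis:
  obtains B c where "finite B" "independent B" "span B = UNIV" "\<forall>b\<in>B. br H b = c b *\<^sub>R b"
proof -
  let ?J = "{x. \<exists>c\<in>UNIV. br H x = c *\<^sub>R x}"
  obtain B where B: "B \<subseteq> ?J" "independent B" "?J \<subseteq> span B"
    using maximal_independent_subset[of ?J] by blast
  have "span ?J \<subseteq> span B" using B(3) by (simp add: span_minimal)
  then have "span B = UNIV" using esum_UNIV by (auto simp: esum_def)
  have "\<forall>b\<in>B. \<exists>c. br H b = c *\<^sub>R b" using B(1) by auto
  then obtain c where c: "\<forall>b\<in>B. br H b = c b *\<^sub>R b" by metis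
  show ?thesis
    by (rule that[of B c]) (use c B(2) independent_imp_finite \<open>span B = UNIV\<close> in auto)
qed

text \<open>Linear versions of the eigenspace decomposition, to be used as coordinates of
  charts.\<close>

lemma esum_projections:
  obtains P M S where "linear P" "linear M" "linear S" "\<forall>x. P x \<in> esum {0<..}" "\<forall>x. M x \<in> esum {..<0}"
    "\<forall>x. S x \<in> esum {0}" "\<forall>x. x = P x + M x + S x"
proof -
  obtain B c where B: "finite B" "independent B" "span B = UNIV" "\<forall>b\<in>B. br H b = c b *\<^sub>R b"
    by (rule eigenbasis)
  have ex: "\<exists>g. linear g \<and> (\<forall>b\<in>B. g b = (if c b \<in> I then b else 0)) \<and> (\<forall>x. g x \<in> esum I)" for I
  proof -
    obtain g where g: "linear g" "\<forall>b\<in>B. g b = (if c b \<in> I then b else 0)"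
      using linear_independent_extend[OF B(2), of "\<lambda>b. if c b \<in> I then b else 0"] by (elim exE conjE)
    have "span B \<subseteq> {x. g x \<in> esum I}"
    proof (rule span_minimal)
      show "subspace {x. g x \<in> esum I}"
        by (simp add: subspace_def linear_0[OF g(1)] linear_add[OF g(1)] linear_cmul[OF g(1)]
            subspace_0[OF subspace_esum] subspace_add[OF subspace_esum] subspace_scale[OF subspace_esum])
      have "g b \<in> esum I" if "b \<in> B" for b
        using g(2) B(4) that subspace_0[OF subspace_esum] eigenvector_in_esum[of b "c b" I] by auto
      then show "B \<subseteq> {x. g x \<in> esum I}" by blast
    qed
    then have "\<forall>x. g x \<in> esum I" unfolding B(3) by auto
    with g show ?thesis by (intro exI[of _ g]) auto
  qed
  obtain P where P: "linear P" "\<forall>b\<in>B. P b = (if c b \<in> {0<..} then b else 0)" "\<forall>x. P x \<in> esum {0<..}"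
    using ex[of "{0<..}"] by (elim exE conjE)
  obtain M where M: "linear M" "\<forall>b\<in>B. M b = (if c b \<in> {..<0} then b else 0)" "\<forall>x. M x \<in> esum {..<0}"
    using ex[of "{..<0}"] by (elim exE conjE)
  obtain S where S: "linear S" "\<forall>b\<in>B. S b = (if c b \<in> {0} then b else 0)" "\<forall>x. S x \<in> esum {0}"
    using ex[of "{0}"] by (elim exE conjE)
  have "x = P x + M x + S x" for x
  proof (rule linear_eq_on[of "\<lambda>x. x" "\<lambda>x. P x + M x + S x" x B])
    show "linear (\<lambda>x. P x + M x + S x)" by (intro linear_compose_add P M S)
    show "b = P b + M b + S b" if "b \<in> B" for b using that P(2) M(2) S(2) by auto
  qed (use B in \<open>auto simp: linear_id[unfolded id_def]\<close>)
  with P M S show ?thesis by (intro that[of P M S]) auto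
qed

text \<open>A list without repetitions exists because ad H is diagonalizable; rigidity rests on the
  roots being simple.\<close>

lemma spectrum:
  obtains cs where "distinct cs" "\<forall>v. adprod cs H v = 0"
proof -
  obtain B c where B: "finite B" "independent B" "span B = UNIV" "\<forall>b\<in>B. br H b = c b *\<^sub>R b"
    by (rule eigenbasis)
  obtain cs where cs: "set cs = c ` B" "distinct cs"
    using finite_distinct_list[OF finite_imageI[OF B(1)], of c] by (elim exE conjE)
  have zero: "adprod cs H b = 0" if "b \<in> B" for b
    using that B(4) cs(1) by (intro adprod_eigenvector_zero[of H b "c b"]) auto
  have "v \<in> span B" for v using B(3) by simp
  then have "adprod cs H v = 0" for v
    by (rule linear_eq_0_on_span[OF linear_adprod, rotated]) (rule zero)
  with cs show ?thesis by (intro that[of cs]) auto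
qed

text \<open>It finds the infinitesimal motion A x that displaces H in a prescribed direction P x.
  Away from eigenvalue 0 this only requires inverting ad H; the minus sign comes from the order of
  the bracket.\<close>

lemma inverse_br_H:
  assumes "0 \<notin> I" "linear P" "\<And>x. P x \<in> esum I"
  obtains A where "linear A" "\<forall>x. A x \<in> esum I" "\<forall>x. br (A x) H = P x"
proof -
  obtain R where R: "range R \<subseteq> esum I" "linear R" "\<forall>v\<in>br H ` esum I. br H (R v) = v"
    using linear_exists_right_inverse_on[OF linear_br[of H] subspace_esum[of I]] by (elim exE conjE)
  show ?thesis
  proof (rule that[of "\<lambda>x. - R (P x)"])
    show "linear (\<lambda>x. - R (P x))"
      by (intro linear_compose_neg linear_compose[OF assms(2) R(2), unfolded o_def])
    show "\<forall>x. - R (P x) \<in> esum I" using R(1) subspace_neg[OF subspace_esum, of _ I] by (auto simp: image_subset_iff)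
    have "P x \<in> br H ` esum I" for x using assms esum_subset_br_H_image by blast
    from bspec[OF R(3) this] have "br (- R (P x)) H = P x" for x
      by (subst br_anti) (simp only: br_simps minus_minus)
    then show "\<forall>x. br (- R (P x)) H = P x" ..
  qed
qed

end

section \<open>Orbit charts\<close>

context real_lie_algebra
begin

text \<open>Canonical coordinates of the second kind on the group generated by the exponentials of \<open>ad (A b)\<close>.\<close>

definition expprod :: "('g \<Rightarrow> 'g) \<Rightarrow> 'g list \<Rightarrow> 'g \<Rightarrow> 'g \<Rightarrow>\<^sub>L 'g" where
  "expprod A bs x = foldr (\<lambda>b g. blinfun_exp (ad br ((x \<bullet> b) *\<^sub>R A b)) o\<^sub>L g) bs id_blinfun"

text \<open>A product of one-parameter exponentials is used in place of a single exponential of ad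
  (A x), so that smoothness follows from the one-variable case. The order of the basis has no effect
  on the derivative at 0.\<close>

definition expmap :: "('g \<Rightarrow> 'g) \<Rightarrow> 'g \<Rightarrow> 'g \<Rightarrow>\<^sub>L 'g" where
  "expmap A = expprod A (SOME bs. set bs = Basis \<and> distinct bs)"

lemma expprod_Nil: "expprod A [] x v = v"
  by (simp add: expprod_def)

lemma expprod_Cons:
  "expprod A (b # bs) x v = blinfun_exp ((x \<bullet> b) *\<^sub>R ad br (A b)) (expprod A bs x v)"
  by (simp add: expprod_def linear_cmul[OF linear_ad])

lemma expprod_zero: "expprod A bs 0 v = v"
  by (induction bs) (simp_all add: expprod_Nil expprod_Cons)

lemma Ck_on_expprod:
  assumes "Ck_on n f UNIV"
  shows "Ck_on n (\<lambda>x. expprod A bs x (f x)) UNIV"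
proof (induction bs)
  case Nil
  then show ?case using assms by (simp add: expprod_Nil)
next
  case (Cons b bs)
  have "linear (\<lambda>x. x \<bullet> b)" by (rule linearI) (simp_all add: inner_add_left)
  from Ck_on_blinfun_exp_compose[OF this Cons] show ?case by (simp add: expprod_Cons)
qed

lemma expprod_has_derivative:
  assumes "(f has_derivative f') (at 0)"
  shows "((\<lambda>x. expprod A bs x (f x)) has_derivative
    (\<lambda>v. (\<Sum>b\<leftarrow>bs. (v \<bullet> b) *\<^sub>R br (A b) (f 0)) + f' v)) (at 0)"
proof (induction bs)
  case Nil
  then show ?case using assms by (simp add: expprod_Nil)
next
  case (Cons b bs)
  have "linear (\<lambda>x. x \<bullet> b)" by (rule linearI) (simp_all add: inner_add_left)
  from blinfun_exp_compose_has_derivative[OF this Cons, of "ad br (A b)"] show ?case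
    by (simp add: expprod_Cons expprod_zero add.assoc)
qed

lemma basis_list: "set (SOME bs. set bs = (Basis :: 'g set) \<and> distinct bs) = Basis"
  "distinct (SOME bs. set bs = (Basis :: 'g set) \<and> distinct bs)"
proof -
  have "\<exists>bs. set bs = (Basis :: 'g set) \<and> distinct bs"
    by (rule finite_distinct_list) simp
  from someI_ex[OF this] show "set (SOME bs. set bs = (Basis :: 'g set) \<and> distinct bs) = Basis"
    "distinct (SOME bs. set bs = (Basis :: 'g set) \<and> distinct bs)" by auto
qed

lemma expmap_zero: "expmap A 0 v = v"
  by (simp add: expmap_def expprod_zero)

lemma Ck_on_expmap: "Ck_on n f UNIV \<Longrightarrow> Ck_on n (\<lambda>x. expmap A x (f x)) UNIV"
  unfolding expmap_def by (rule Ck_on_expprod)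

lemma expmap_has_derivative:
  assumes "linear A" "(f has_derivative f') (at 0)"
  shows "((\<lambda>x. expmap A x (f x)) has_derivative (\<lambda>v. br (A v) (f 0) + f' v)) (at 0)"
proof -
  let ?bs = "SOME bs. set bs = (Basis :: 'g set) \<and> distinct bs"
  have "(\<Sum>b\<leftarrow>?bs. (v \<bullet> b) *\<^sub>R br (A b) (f 0)) = br (A v) (f 0)" for v
  proof -
    have "(\<Sum>b\<leftarrow>?bs. (v \<bullet> b) *\<^sub>R br (A b) (f 0)) = (\<Sum>b\<in>Basis. (v \<bullet> b) *\<^sub>R br (A b) (f 0))"
      by (simp only: sum_list_distinct_conv_sum_set[OF basis_list(2)] basis_list(1))
    also have "\<dots> = br (A (\<Sum>b\<in>Basis. (v \<bullet> b) *\<^sub>R b)) (f 0)"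
      by (simp only: linear_sum[OF assms(1)] linear_cmul[OF assms(1)] linear_sum[OF linear_br_left] br_simps(3))
    finally show ?thesis by (simp only: euclidean_representation)
  qed
  then show ?thesis
    using expprod_has_derivative[OF assms(2), of A ?bs] by (simp only: expmap_def)
qed

lemma expmap_induct:
  assumes "subspace W" "\<And>x. A x \<in> W" "P id_blinfun" "\<And>z g. z \<in> W \<Longrightarrow> P g \<Longrightarrow> P (blinfun_exp (ad br z) o\<^sub>L g)"
  shows "P (expmap A x)"
proof -
  have "P (expprod A bs x)" for bs
    unfolding expprod_def
  proof (induction bs)
    case (Cons b bs)
    have "(x \<bullet> b) *\<^sub>R A b \<in> W" by (rule subspace_scale[OF assms(1,2)])
    from assms(4)[OF this Cons] show ?case by simp
  qed (simp add: assms(3))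
  then show ?thesis unfolding expmap_def .
qed

lemma expmap_in_Aut0: "expmap A x \<in> Aut0 br"
  by (rule expmap_induct[of UNIV]) (auto intro: id_in_Aut0 Aut0_compose blinfun_exp_ad_in_Aut0)

lemma adprod_zero_orbit:
  assumes "\<And>v. adprod cs x v = 0" "y \<in> adjoint_orbit br x"
  shows "adprod cs y v = 0"
proof -
  obtain g where g: "g \<in> Aut0 br" "y = g x" using assms(2) by (auto simp: adjoint_orbit_def)
  obtain h where h: "\<And>x. blinfun_apply g (blinfun_apply h x) = x" using Aut0_inverse[OF g(1)] by metis
  have "adprod cs (g x) (g (h v)) = g (adprod cs x (h v))"
    by (rule adprod_hom[OF linear_blinfun Aut0_hom[OF g(1)]])
  then show ?thesis by (simp add: h g assms(1))
qed

lemma adjoint_orbit_sym: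
  assumes "g \<in> Aut0 br" "g y \<in> adjoint_orbit br x"
  shows "y \<in> adjoint_orbit br x"
proof -
  obtain h where h: "h \<in> Aut0 br" "\<And>x. blinfun_apply h (blinfun_apply g x) = x"
    using Aut0_inverse[OF assms(1)] by metis
  from adjoint_orbit_Aut0[OF h(1) assms(2)] show ?thesis by (simp add: h(2))
qed

end

text \<open>Local surjectivity arguments ask only for an interior point of the image, and for this
  differentiability at a single point is enough.\<close>

lemma interior_image_surjective_derivative:
  fixes F :: "'a::euclidean_space \<Rightarrow> 'b::euclidean_space"
  assumes "continuous_on UNIV F" "(F has_derivative F') (at 0)" "surj F'" "e > 0"
  shows "F 0 \<in> interior (F ` ball 0 e)"
proof -
  obtain G where G: "linear G" "F' \<circ> G = id"
    using linear_surjective_right_inverse[OF has_derivative_linear[OF assms(2)] assms(3)] by blast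
  show ?thesis
    by (rule sussmann_open_mapping[OF open_UNIV assms(1) UNIV_I assms(2) _ G(2)])
      (use G(1) assms(4) in \<open>auto simp: linear_linear\<close>)
qed

context cartan_element
begin

text \<open>A polynomial that annihilates \<open>ad H\<close> annihilates \<open>ad z\<close> for every \<open>z\<close> in the orbit, so that this
  rigidity bounds the orbit from above without any knowledge of the topology of \<open>Aut0\<close>.\<close>

lemma squarefree_polynomial_rigid:
  assumes cs: "distinct cs" "\<And>v. adprod cs H v = 0"
  obtains e where "e > 0"
    "\<forall>s\<in>esum {0}. norm s < e \<longrightarrow> (\<forall>v. adprod cs (H + s) v = 0) \<longrightarrow> s = 0"
proof -
  obtain K where K: "K > 0" "\<forall>x y. norm (br x y) \<le> norm x * norm y * K"
    using bounded_bilinear.pos_bounded[OF bilinear_br[unfolded bilinear_conv_bounded_bilinear]]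
    by (elim exE conjE)
  \<comment> \<open>The entry 1 keeps \<open>D\<close> nonempty when there is no pair of distinct
    roots; \<open>m\<close> is then a positive lower bound for all gaps.\<close>
  define D where "D = insert 1 ((\<lambda>(c, d). \<bar>c - d\<bar>) ` {(c, d) \<in> set cs \<times> set cs. c \<noteq> d})"
  have "finite {(c, d) \<in> set cs \<times> set cs. c \<noteq> d}"
    by (rule finite_subset[of _ "set cs \<times> set cs"]) auto
  then have finD: "finite D" by (simp add: D_def)
  define m where "m = Min D"
  have "m \<in> D" unfolding m_def using finD by (intro Min_in) (auto simp: D_def)
  then have m: "m > 0" by (auto simp: D_def)
  have gap: "m \<le> \<bar>c - d\<bar>" if "c \<in> set cs" "d \<in> set cs" "c \<noteq> d" for c d
    unfolding m_def using that by (intro Min_le finD) (force simp: D_def)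
  have "s = 0" if s: "s \<in> esum {0}" "norm s < m / K" "\<And>v. adprod cs (H + s) v = 0" for s
  proof -
    have Hs: "br H s = 0" using s(1) by (simp add: br_H_eq_0_iff)
    \<comment> \<open>The bound m / K makes ad s smaller in norm than every gap c - d, so that (c -
      d) + ad s is injective.\<close>
    have small: "u = 0" if "c \<in> set cs" "d \<in> set cs" "c \<noteq> d" "(c - d) *\<^sub>R u + br s u = 0" for c d u
    proof (rule ccontr)
      assume "u \<noteq> 0"
      have "br s u = - ((c - d) *\<^sub>R u)" using that(4) by (metis add_eq_0_iff)
      then have "m * norm u \<le> norm (br s u)"
        using gap[OF that(1-3)] by (simp add: mult_right_mono)
      also have "\<dots> \<le> norm s * norm u * K" using K(2) by simp
      also have "\<dots> = norm u * (norm s * K)" by simp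
      also have "\<dots> < norm u * m" using s(2) K(1) \<open>u \<noteq> 0\<close> by (intro mult_strict_left_mono) (auto simp: field_simps)
      finally show False by (simp add: mult.commute)
    qed
    \<comment> \<open>On an eigenvector with eigenvalue c the factor with root d acts as (c - d) +
      ad s. All factors with d different from c are injective, and the one with d = c, which occurs
      at most once, is ad s; so the product can vanish on v only if ad s does. The first conjunct
      carries the case in which c has already been used up.\<close>
    have key: "(c \<notin> set ds \<longrightarrow> v = 0) \<and> br s v = 0"
      if "c \<in> set cs" "distinct ds" "set ds \<subseteq> set cs" "br H v = c *\<^sub>R v" "adprod ds (H + s) v = 0" for c v ds
      using that(2-)
    proof (induction ds arbitrary: v)
      case Nil
      then show ?case by (simp add: br_simps)
    next
      case (Cons d ds)
      define w where "w = (c - d) *\<^sub>R v + br s v"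
      have w: "br (H + s) v - d *\<^sub>R v = w"
        using Cons.prems by (simp add: w_def br_simps algebra_simps)
      \<comment> \<open>As s commutes with H, ad s keeps the eigenspace and the induction continues
        with an eigenvector for the same c.\<close>
      have "br H (br s v) = c *\<^sub>R br s v"
        by (subst br_jacobi) (simp add: Hs br_simps Cons.prems)
      then have Hw: "br H w = c *\<^sub>R w"
        using Cons.prems by (simp add: w_def br_simps algebra_simps)
      have IH: "(c \<notin> set ds \<longrightarrow> w = 0) \<and> br s w = 0"
        using Cons.prems Hw by (intro Cons.IH) (simp_all add: w)
      show ?case
      proof (cases "d = c")
        case True
        then have "w = 0" using IH Cons.prems(1) by auto
        then show ?thesis using True by (simp add: w_def)
      next
        case False
        have d: "d \<in> set cs" using Cons.prems(2) by simp
        have "br s w = 0" using IH by blast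
        then have "(c - d) *\<^sub>R br s v + br s (br s v) = 0" by (simp only: w_def br_simps)
        then have "br s v = 0" by (rule small[OF that(1) d False[symmetric]])
        moreover have "v = 0" if "c \<notin> set (d # ds)"
          using IH that small[OF \<open>c \<in> set cs\<close> d, of v] False by (auto simp: w_def)
        ultimately show ?thesis by blast
      qed
    qed
    have eig: "br s v = 0" if "br H v = c *\<^sub>R v" for c v
    proof (cases "v = 0")
      case False
      have "(\<Prod>d\<leftarrow>cs. c - d) = 0" using adprod_eigenvector[OF that, of cs] cs(2) False by simp
      then have "c \<in> set cs" by (auto simp: prod_list_zero_iff)
      then show ?thesis using key[of c cs v] cs(1) that s(3) by auto
    qed (simp add: br_simps)
    show "s = 0"
    proof (rule center_trivial)
      fix x
      have "x \<in> {x. br s x = 0}"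
      proof (rule esum_induct[of x UNIV])
        show "subspace {x. br s x = 0}" by (simp add: subspace_def br_simps)
      qed (use eig in \<open>auto simp: esum_UNIV\<close>)
      then show "br s x = 0" by simp
    qed
  qed
  then show ?thesis using m K by (intro that[of "m / K"]) auto
qed

text \<open>The chart at H moves the slice H + S x, inside the centralizer, by inner automorphisms.
  The choice of \<open>A\<close> makes its derivative at 0 the identity. Since automorphisms
  preserve the orbit, \<open>F x\<close> lies in it exactly if H + S x does, which by rigidity means
  S x = 0.\<close>

lemma embedded_adjoint_orbit: "embedded_submanifold (adjoint_orbit br H)"
proof -
  obtain P M S where PMS: "linear P" "linear M" "linear S" "\<forall>x. P x \<in> esum {0<..}"
    "\<forall>x. M x \<in> esum {..<0}" "\<forall>x. S x \<in> esum {0}" "\<forall>x. x = P x + M x + S x"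
    by (rule esum_projections)
  have lPM: "linear (\<lambda>x. P x + M x)" by (intro linear_compose_add PMS)
  have PMmem: "P x + M x \<in> esum (- {0})" for x
    using PMS(4,5) esum_mono[of "{0<..}" "- {0}"] esum_mono[of "{..<0}" "- {0}"]
    by (intro subspace_add[OF subspace_esum]) auto
  obtain A where A: "linear A" "\<forall>x. A x \<in> esum (- {0})" "\<forall>x. br (A x) H = P x + M x"
    by (rule inverse_br_H[OF _ lPM PMmem]) simp_all
  obtain cs where cs: "distinct cs" "\<forall>v. adprod cs H v = 0" by (rule spectrum)
  obtain e where e: "e > 0"
    "\<forall>s\<in>esum {0}. norm s < e \<longrightarrow> (\<forall>v. adprod cs (H + s) v = 0) \<longrightarrow> s = 0"
    by (rule squarefree_polynomial_rigid[OF cs(1) spec[OF cs(2)]])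
  define F where "F x = expmap A x (H + S x)" for x
  define U where "U = {x. norm (S x) < e}"
  define L where "L = {x. S x = 0}"
  have L: "subspace L"
    by (simp add: L_def subspace_def linear_0[OF PMS(3)] linear_add[OF PMS(3)] linear_cmul[OF PMS(3)])
  have "continuous_on UNIV (\<lambda>x. norm (S x))"
    using PMS(3) by (intro continuous_on_norm linear_continuous_on) (simp add: linear_linear)
  then have U: "open U" unfolding U_def by (intro open_Collect_less continuous_on_const)
  have CkHS: "Ck_on n (\<lambda>x. H + S x) UNIV" for n
    by (intro Ck_on_add Ck_on_const Ck_on_linear PMS open_UNIV)
  have CkF: "Ck_on n F UNIV" for n
    unfolding F_def by (rule Ck_on_expmap[OF CkHS])
  have dS: "((\<lambda>x. H + S x) has_derivative S) (at 0)"
    using PMS(3) by (auto intro!: derivative_eq_intros bounded_linear_imp_has_derivative simp: linear_linear)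
  have "(F has_derivative (\<lambda>v. br (A v) (H + S 0) + S v)) (at 0)"
    unfolding F_def by (rule expmap_has_derivative[OF A(1) dS])
  also have "(\<lambda>v. br (A v) (H + S 0) + S v) = (\<lambda>v. v)"
    using A(3) PMS(7) by (auto simp: linear_0[OF PMS(3)])
  finally have "frechet_derivative F (at 0) = (\<lambda>v. v)" by (metis frechet_derivative_at)
  then have inj: "inj (frechet_derivative F (at 0))" by simp
  have "0 \<in> U" using e(1) by (simp add: U_def linear_0[OF PMS(3)])
  from smooth_inverse_function[OF U Ck_on_subset[OF CkF subset_UNIV] this inj]
  obtain U' V G where UV: "open U' \<and> U' \<subseteq> U \<and> 0 \<in> U' \<and> open V \<and> F 0 \<in> V \<and> homeomorphism U' V F G \<and>
      (\<forall>n. Ck_on n G V)" by metis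
  have F0: "F 0 = H" by (simp add: F_def expmap_zero linear_0[OF PMS(3)])
  have orb: "F x \<in> adjoint_orbit br H \<longleftrightarrow> x \<in> L" if "x \<in> U" for x
  proof
    assume "x \<in> L"
    then show "F x \<in> adjoint_orbit br H"
      using expmap_in_Aut0 by (auto simp: F_def L_def adjoint_orbit_def)
  next
    assume "F x \<in> adjoint_orbit br H"
    then have "H + S x \<in> adjoint_orbit br H"
      unfolding F_def by (rule adjoint_orbit_sym[OF expmap_in_Aut0])
    then have "adprod cs (H + S x) v = 0" for v
      by (rule adprod_zero_orbit[OF spec[OF cs(2)]])
    then show "x \<in> L" using e(2) PMS(6) that by (auto simp: U_def L_def)
  qed
  show ?thesis
  proof (rule embedded_submanifoldI[OF L])
    fix z assume "z \<in> adjoint_orbit br H"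
    \<comment> \<open>The chart at H suffices: an automorphism is linear, preserves the orbit and
      carries H to z.\<close>
    then obtain g where g: "g \<in> Aut0 br" "z = g H" by (auto simp: adjoint_orbit_def)
    obtain h where h: "h \<in> Aut0 br" "\<And>x. blinfun_apply h (blinfun_apply g x) = x"
      "\<And>x. blinfun_apply g (blinfun_apply h x) = x"
      using Aut0_inverse[OF g(1)] by metis
    let ?W = "blinfun_apply h -` V"
    have sF: "smooth_map_on F U'"
      by (rule smooth_map_onI[OF open_UNIV CkF]) auto
    have sG: "smooth_map_on G V"
      by (rule smooth_map_onI[of V G]) (use UV in auto)
    have sf: "smooth_map_on (\<lambda>x. G (h x)) ?W"
      by (rule smooth_map_on_compose[OF smooth_map_on_linear[OF linear_blinfun] sG]) auto
    have sg: "smooth_map_on (\<lambda>x. g (F x)) U'"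
      by (rule smooth_map_on_compose[OF sF smooth_map_on_linear[OF linear_blinfun]]) (rule subset_UNIV)
    have oW: "open ?W"
      using UV by (intro open_vimage continuous_intros) auto
    have hom: "G (F x) = x" "F x \<in> V" if "x \<in> U'" for x
      using UV that by (auto simp: homeomorphism_def)
    have hom': "F (G y) = y" "G y \<in> U'" if "y \<in> V" for y
      using UV that by (auto simp: homeomorphism_def)
    have mem: "x \<in> adjoint_orbit br H \<longleftrightarrow> G (h x) \<in> L" if "x \<in> ?W" for x
    proof -
      have V: "h x \<in> V" using that by simp
      have "x \<in> adjoint_orbit br H \<longleftrightarrow> h x \<in> adjoint_orbit br H"
        using adjoint_orbit_Aut0[OF h(1)] adjoint_orbit_sym[OF h(1)] by blast
      also have "\<dots> \<longleftrightarrow> F (G (h x)) \<in> adjoint_orbit br H" by (simp only: hom'(1)[OF V])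
      also have "\<dots> \<longleftrightarrow> G (h x) \<in> L" using hom'(2)[OF V] UV by (intro orb) auto
      finally show ?thesis .
    qed
    show "\<exists>U V f g. open U \<and> z \<in> U \<and> open V \<and> smooth_map_on f U \<and> smooth_map_on g V \<and>
      f ` U \<subseteq> V \<and> g ` V \<subseteq> U \<and> (\<forall>x\<in>U. g (f x) = x) \<and> (\<forall>y\<in>V. f (g y) = y) \<and>
      (\<forall>x\<in>U. x \<in> adjoint_orbit br H \<longleftrightarrow> f x \<in> L)"
    proof (rule exI[of _ ?W], rule exI[of _ U'], rule exI[of _ "\<lambda>x. G (h x)"],
        rule exI[of _ "\<lambda>x. g (F x)"], intro conjI ballI)
      show "z \<in> ?W" using UV F0 by (simp add: g h)
    qed (use oW UV sf sg hom hom' mem h in auto)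
  qed
qed

end

lemma embedded_submanifold_linear_image:
  fixes L M :: "'a::euclidean_space \<Rightarrow> 'a"
  assumes L: "linear L" "linear M" "\<And>x. M (L x) = x" "\<And>x. L (M x) = x"
    and S: "embedded_submanifold S"
  shows "embedded_submanifold (L ` S)"
proof -
  obtain d where d: "\<forall>x\<in>S. \<exists>U V W \<phi>. open U \<and> x \<in> U \<and> open (V :: 'a set) \<and>
      subspace W \<and> dim W = d \<and> diffeomorphism \<phi> U V \<and> \<phi> ` (S \<inter> U) = W \<inter> V"
    using S unfolding embedded_submanifold_def by (elim exE)
  show ?thesis
    unfolding embedded_submanifold_def
  proof (intro exI[of _ d] ballI)
    fix z assume "z \<in> L ` S"
    then obtain x where x: "x \<in> S" "z = L x" by auto
    from bspec[OF d x(1)] obtain U V W \<phi> where c: "open U \<and> x \<in> U \<and> open (V :: 'a set) \<and>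
      subspace W \<and> dim W = d \<and> diffeomorphism \<phi> U V \<and> \<phi> ` (S \<inter> U) = W \<inter> V" by (elim exE)
    have bij: "bij_betw \<phi> U V" and s1: "smooth_map_on \<phi> U" and s2: "smooth_map_on (inv_into U \<phi>) V"
      using c by (auto simp: diffeomorphism_def)
    have M: "M ` L ` T = T" for T by (simp add: image_image L)
    have "diffeomorphism (\<lambda>x. \<phi> (M x)) (L ` U) V"
    proof (rule diffeomorphismI[of _ _ "\<lambda>y. L (inv_into U \<phi> y)"])
      show "smooth_map_on (\<lambda>x. \<phi> (M x)) (L ` U)"
        by (rule smooth_map_on_compose[OF smooth_map_on_linear[OF L(2)] s1]) (simp add: M)
      show "smooth_map_on (\<lambda>y. L (inv_into U \<phi> y)) V"
        by (rule smooth_map_on_compose[OF s2 smooth_map_on_linear[OF L(1)]]) (rule subset_UNIV)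
      have im: "\<phi> ` U = V" "inj_on \<phi> U" using bij by (auto simp: bij_betw_def)
      show "(\<lambda>x. \<phi> (M x)) ` L ` U \<subseteq> V" using im(1) by (auto simp: L)
      show "(\<lambda>y. L (inv_into U \<phi> y)) ` V \<subseteq> L ` U" using im(1) by (auto intro: inv_into_into)
      show "L (inv_into U \<phi> (\<phi> (M x))) = x" if "x \<in> L ` U" for x
        using that im(2) by (auto simp: L inv_into_f_f)
      show "\<phi> (M (L (inv_into U \<phi> y))) = y" if "y \<in> V" for y
        using that im(1) by (simp add: L f_inv_into_f)
    qed
    moreover have "open (L ` U)"
    proof -
      have "x \<in> L ` U" if "M x \<in> U" for x
        using imageI[OF that, of L] by (simp add: L)
      then have "L ` U = M -` U" by (auto simp: L)
      then show ?thesis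
        using c L(2) by (simp add: open_vimage linear_continuous_on linear_linear)
    qed
    moreover have "(\<lambda>x. \<phi> (M x)) ` (L ` S \<inter> L ` U) = W \<inter> V"
    proof -
      have "inj L" using L(3) by (metis injI)
      then have "L ` S \<inter> L ` U = L ` (S \<inter> U)" by (simp add: image_Int)
      then have "(\<lambda>x. \<phi> (M x)) ` (L ` S \<inter> L ` U) = \<phi> ` (S \<inter> U)" by (simp add: image_image L)
      then show ?thesis using c by simp
    qed
    ultimately have "open (L ` U) \<and> z \<in> L ` U \<and> open V \<and> subspace W \<and> dim W = d \<and>
      diffeomorphism (\<lambda>x. \<phi> (M x)) (L ` U) V \<and> (\<lambda>x. \<phi> (M x)) ` (L ` S \<inter> L ` U) = W \<inter> V"
      using c x by auto
    then show "\<exists>U V W \<phi>. open U \<and> z \<in> U \<and> open (V :: 'a set) \<and> subspace W \<and> dim W = d \<and>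
      diffeomorphism \<phi> U V \<and> \<phi> ` (L ` S \<inter> U) = W \<inter> V" by (intro exI)
  qed
qed

section \<open>The orbit as a bundle over the orbit of \<open>K\<close>\<close>

context cartan_element
begin

lemma esum_weaken:
  "x \<in> esum {0<..} \<Longrightarrow> x \<in> esum {0..}" "x \<in> esum {..<0} \<Longrightarrow> x \<in> esum {..0}"
  "x \<in> esum {0} \<Longrightarrow> x \<in> esum {0..}" "x \<in> esum {0} \<Longrightarrow> x \<in> esum {..0}"
  by (erule subsetD[OF esum_mono, rotated], force)+

lemma blinfun_exp_ad_esum:
  assumes "z \<in> esum I" "v \<in> esum J" "\<And>i j. i \<in> I \<Longrightarrow> j \<in> J \<Longrightarrow> i + j \<in> J"
  shows "blinfun_exp (ad br z) v \<in> esum J"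
  by (rule blinfun_exp_preserves[OF subspace_esum _ assms(2)])
    (use br_esum[OF assms(1) _ assms(3)] in simp)

text \<open>A substitute for membership in the group generated by exp (ad \<open>n\<close>),
  recording its action on \<open>n\<close> and on the parabolic subalgebra modulo
  \<open>n\<close>.\<close>

definition unipotent :: "('g \<Rightarrow>\<^sub>L 'g) \<Rightarrow> bool" where
  "unipotent g \<longleftrightarrow> g \<in> Aut0 br \<and> (\<forall>v\<in>esum {0<..}. g v \<in> esum {0<..}) \<and>
     (\<forall>v\<in>esum {0..}. g v - v \<in> esum {0<..})"

lemma unipotent_expmap:
  assumes "\<And>x. A x \<in> esum {0<..}"
  shows "unipotent (expmap A x)"
proof (rule expmap_induct[OF subspace_esum assms])
  show "unipotent id_blinfun"
    by (simp add: unipotent_def id_in_Aut0 subspace_0[OF subspace_esum])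
  fix z g assume z: "z \<in> esum {0<..}" and g: "unipotent g"
  let ?h = "blinfun_exp (ad br z)"
  have 1: "?h v \<in> esum {0<..}" if "v \<in> esum {0<..}" for v
    by (rule blinfun_exp_ad_esum[OF z that]) auto
  have 2: "?h v - v \<in> esum {0<..}" if "v \<in> esum {0..}" for v
  proof (rule blinfun_exp_diff_mem[OF subspace_esum])
    show "ad br z w \<in> esum {0<..}" if "w \<in> esum {0<..}" for w
      using br_esum[OF z that, of "{0<..}"] by auto
    show "ad br z v \<in> esum {0<..}"
      using br_esum[OF z that, of "{0<..}"] by auto
  qed
  have 3: "(?h o\<^sub>L g) v - v \<in> esum {0<..}" if v: "v \<in> esum {0..}" for v
  proof -
    have "g v - v \<in> esum {0<..}" using g v by (simp add: unipotent_def)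
    then have "?h (g v - v) \<in> esum {0<..}" by (rule 1)
    then have "?h (g v - v) + (?h v - v) \<in> esum {0<..}" by (rule subspace_add[OF subspace_esum _ 2[OF v]])
    then show ?thesis by (simp add: blinfun.diff_right)
  qed
  show "unipotent (?h o\<^sub>L g)"
    unfolding unipotent_def
  proof (intro conjI ballI)
    show "?h o\<^sub>L g \<in> Aut0 br"
      using g by (intro Aut0_compose blinfun_exp_ad_in_Aut0) (simp add: unipotent_def)
    show "(?h o\<^sub>L g) v \<in> esum {0<..}" if "v \<in> esum {0<..}" for v
      using 1 g that by (simp add: unipotent_def)
  qed (rule 3)
qed

text \<open>A unipotent element moves H only within H + \<open>n\<close>. The open mapping argument
  shows that near H every such point is reached.\<close>

lemma unipotent_translate_small:
  obtains e where "e > 0" "\<forall>Y\<in>esum {0<..}. norm Y < e \<longrightarrow> (\<exists>g. unipotent g \<and> g H = H + Y)"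
proof -
  obtain P M S where PMS: "linear P" "linear M" "linear S" "\<forall>x. P x \<in> esum {0<..}"
    "\<forall>x. M x \<in> esum {..<0}" "\<forall>x. S x \<in> esum {0}" "\<forall>x. x = P x + M x + S x"
    by (rule esum_projections)
  obtain A where A: "linear A" "\<forall>x. A x \<in> esum {0<..}" "\<forall>x. br (A x) H = P x"
    by (rule inverse_br_H[OF _ PMS(1) spec[OF PMS(4)]]) simp
  \<comment> \<open>The summand x - P x fills the directions outside \<open>n\<close>, so that the
    derivative at 0 is the identity of the whole space.\<close>
  define F where "F x = expmap A x H + (x - P x)" for x
  have lin: "linear (\<lambda>x. x - P x)"
    by (intro linear_compose_sub PMS(1)) (simp add: linear_id[unfolded id_def])
  have "Ck_on 0 F UNIV"
    unfolding F_def by (intro Ck_on_add Ck_on_expmap Ck_on_const Ck_on_linear lin open_UNIV)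
  then have cont: "continuous_on UNIV F" by simp
  have "((\<lambda>x. expmap A x H) has_derivative (\<lambda>v. br (A v) H + 0)) (at 0)"
    by (rule expmap_has_derivative[OF A(1), of "\<lambda>x. H"]) simp
  moreover have "((\<lambda>x. x - P x) has_derivative (\<lambda>x. x - P x)) (at 0)"
    using lin by (intro bounded_linear_imp_has_derivative) (simp add: linear_linear)
  ultimately have "(F has_derivative (\<lambda>v. (br (A v) H + 0) + (v - P v))) (at 0)"
    unfolding F_def by (rule has_derivative_add)
  then have der: "(F has_derivative (\<lambda>v. v)) (at 0)" using A(3) by simp
  have "F 0 \<in> interior (F ` ball 0 1)"
    by (rule interior_image_surjective_derivative[OF cont der]) (simp_all add: surj_def)
  moreover have "F 0 = H" by (simp add: F_def expmap_zero linear_0[OF PMS(1)])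
  ultimately obtain e where e: "e > 0" "ball H e \<subseteq> F ` ball 0 1"
    by (auto simp: mem_interior)
  have "\<exists>g. unipotent g \<and> g H = H + Y" if Y: "Y \<in> esum {0<..}" "norm Y < e" for Y
  proof -
    have "H + Y \<in> ball H e" using Y(2) by (simp add: dist_norm)
    then obtain x where x: "H + Y = F x" using e(2) by auto
    have u: "unipotent (expmap A x)" by (rule unipotent_expmap) (use A(2) in blast)
    have "H \<in> esum {0..}" by (rule H_in_esum) simp
    then have "expmap A x H - H \<in> esum {0<..}" using u by (simp add: unipotent_def)
    then have "Y - (expmap A x H - H) \<in> esum {0<..}" by (rule subspace_diff[OF subspace_esum Y(1)])
    \<comment> \<open>The filler is positive because both Y and the displacement of H are, and
      nonpositive by construction; hence it vanishes and the unipotent element alone reaches H +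
      Y.\<close>
    moreover have "Y - (expmap A x H - H) = x - P x" using x by (simp add: F_def algebra_simps)
    moreover have "x - P x = M x + S x" using PMS(7)[rule_format, of x] by (simp add: algebra_simps)
    ultimately have "x - P x \<in> esum {0<..}" "x - P x = M x + S x" by simp_all
    moreover have "M x + S x \<in> esum {..0}"
      by (rule subspace_add[OF subspace_esum esum_weaken(2,4)]) (use PMS(5,6) in blast)+
    ultimately have "x - P x = 0" by (intro esum_disjoint[of _ "{0<..}" "{..0}"]) auto
    then have "expmap A x H = H + Y" using x by (simp add: F_def)
    with u show ?thesis by blast
  qed
  with e(1) show ?thesis by (intro that[of e]) auto
qed

lemma contraction_tendsto_0:
  assumes "X \<in> esum {0<..}"
  shows "((\<lambda>t. blinfun_exp (t *\<^sub>R ad br (- H)) X) \<longlongrightarrow> 0) at_top"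
proof -
  let ?W = "{X. ((\<lambda>t. blinfun_exp (t *\<^sub>R ad br (- H)) X) \<longlongrightarrow> 0) at_top}"
  have "X \<in> ?W"
  proof (rule esum_induct[OF assms])
    show "subspace ?W"
      unfolding subspace_def
    proof (intro conjI ballI allI CollectI)
      show "((\<lambda>t. blinfun_exp (t *\<^sub>R ad br (- H)) 0) \<longlongrightarrow> 0) at_top" by (simp add: blinfun.zero_right)
      show "((\<lambda>t. blinfun_exp (t *\<^sub>R ad br (- H)) (x + y)) \<longlongrightarrow> 0) at_top" if "x \<in> ?W" "y \<in> ?W" for x y
        using tendsto_add[OF that[unfolded mem_Collect_eq]] by (simp add: blinfun.add_right)
      show "((\<lambda>t. blinfun_exp (t *\<^sub>R ad br (- H)) (c *\<^sub>R x)) \<longlongrightarrow> 0) at_top" if "x \<in> ?W" for c x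
        using tendsto_scaleR[OF tendsto_const that[unfolded mem_Collect_eq], of c] by (simp add: blinfun.scaleR_right)
    qed
    fix c x assume c: "c \<in> {0<..}" "br H x = c *\<^sub>R x"
    have ev: "ad br (- H) x = (- c) *\<^sub>R x" by (simp add: br_simps c)
    have "((\<lambda>t. exp (t * - c)) \<longlongrightarrow> 0) at_top"
    proof (rule filterlim_compose[OF exp_at_bot])
      show "LIM t at_top. t * - c :> at_bot"
        using c(1) by (intro filterlim_tendsto_neg_mult_at_bot[OF tendsto_const _ filterlim_ident, of "- c", simplified mult.commute]) auto
    qed
    from tendsto_scaleR[OF this tendsto_const[of x]]
    show "x \<in> ?W" by (simp add: blinfun_exp_eigenvector[OF ev])
  qed
  then show ?thesis by simp
qed

text \<open>exp (- t ad H) fixes H and for large t contracts X into the ball in which unipotent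
  elements suffice; exp (t ad H) then expands the result back to H + X.\<close>

lemma translate_H:
  assumes "X \<in> esum {0<..}"
  obtains g where "g \<in> Aut0 br" "g H = H + X" "\<forall>v\<in>esum {0<..}. g v \<in> esum {0<..}"
    "\<forall>v\<in>esum {0..}. g v \<in> esum {0..}"
proof -
  obtain e where e: "e > 0" "\<forall>Y\<in>esum {0<..}. norm Y < e \<longrightarrow> (\<exists>g. unipotent g \<and> g H = H + Y)"
    by (rule unipotent_translate_small)
  have "eventually (\<lambda>t. dist (blinfun_exp (t *\<^sub>R ad br (- H)) X) 0 < e) at_top"
    by (rule tendstoD[OF contraction_tendsto_0[OF assms] e(1)])
  then obtain t where t: "norm (blinfun_exp (t *\<^sub>R ad br (- H)) X) < e"
    by (auto simp: eventually_at_top_linorder)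
  let ?z = "(- t) *\<^sub>R H"
  have h: "t *\<^sub>R ad br (- H) = ad br ?z"
    by (simp add: linear_cmul[OF linear_ad] linear_neg[OF linear_ad])
  have z: "?z \<in> esum {0}" "- ?z \<in> esum {0}"
    using H_in_esum[of "{0}"] by (auto intro!: subspace_scale[OF subspace_esum] subspace_neg[OF subspace_esum])
  have hX: "blinfun_exp (ad br ?z) X \<in> esum {0<..}"
    by (rule blinfun_exp_ad_esum[OF z(1) assms]) auto
  have "norm (blinfun_exp (ad br ?z) X) < e" using t by (simp only: h)
  with e(2) hX obtain u where u: "unipotent u" "u H = H + blinfun_exp (ad br ?z) X" by blast
  let ?h = "blinfun_exp (ad br (- ?z))"
  have inv: "?h (blinfun_exp (ad br ?z) X) = X"
    unfolding linear_neg[OF linear_ad] by (rule blinfun_exp_minus_left)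
  have "ad br (- ?z) H = 0 *\<^sub>R H" by (simp add: br_simps)
  from blinfun_exp_eigenvector[OF this, of 1] have hH: "?h H = H" by simp
  have up: "u v \<in> esum {0..}" if v: "v \<in> esum {0..}" for v
  proof -
    have "u v - v \<in> esum {0..}"
      using u(1) v esum_weaken(1) by (simp add: unipotent_def)
    then have "(u v - v) + v \<in> esum {0..}" by (rule subspace_add[OF subspace_esum _ v])
    then show ?thesis by simp
  qed
  have hp: "?h v \<in> esum J" if "v \<in> esum J" for v J
    by (rule blinfun_exp_ad_esum[OF z(2) that]) auto
  show ?thesis
  proof (rule that[of "?h o\<^sub>L u"])
    show "?h o\<^sub>L u \<in> Aut0 br"
      using u by (intro Aut0_compose blinfun_exp_ad_in_Aut0) (simp add: unipotent_def)
    show "(?h o\<^sub>L u) H = H + X"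
      by (simp only: blinfun_apply_blinfun_compose u(2) blinfun.add_right hH inv)
    show "\<forall>v\<in>esum {0<..}. (?h o\<^sub>L u) v \<in> esum {0<..}"
      using u(1) hp by (simp add: unipotent_def)
    show "\<forall>v\<in>esum {0..}. (?h o\<^sub>L u) v \<in> esum {0..}"
      using up hp by simp
  qed
qed

lemma translate_in_orbit: "X \<in> esum {0<..} \<Longrightarrow> H + X \<in> adjoint_orbit br H"
proof -
  assume "X \<in> esum {0<..}"
  then obtain g where "g \<in> Aut0 br" "g H = H + X" by (rule translate_H)
  then show ?thesis by (metis adjoint_orbit_Aut0 adjoint_orbit_self)
qed

text \<open>\<open>F\<close> combines motions along \<open>K\<close>, along \<open>n\<close> and
  along the slice in the centralizer of H, based at H + X. The infinitesimal Iwasawa decomposition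
  makes its derivative bijective, and on the orbit rigidity kills the slice coordinate.\<close>

lemma orbit_locally_K:
  assumes K: "linear_group K" "lie_algebra_of K = ad br ` cartan_k \<theta>" and X: "X \<in> esum {0<..}"
  obtains e where "e > 0"
    "\<forall>z\<in>adjoint_orbit br H. dist z (H + X) < e \<longrightarrow> (\<exists>k\<in>K. \<exists>Y\<in>esum {0<..}. z = k (H + Y))"
proof -
  obtain P M S where PMS: "linear P" "linear M" "linear S" "\<forall>x. P x \<in> esum {0<..}"
    "\<forall>x. M x \<in> esum {..<0}" "\<forall>x. S x \<in> esum {0}" "\<forall>x. x = P x + M x + S x"
    by (rule esum_projections)
  obtain N where N: "linear N" "\<forall>x. N x \<in> esum {0<..}" "\<forall>x. br (N x) H = P x"
    by (rule inverse_br_H[OF _ PMS(1) spec[OF PMS(4)]]) simp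
  obtain n where n: "n \<in> Aut0 br" "n H = H + X" "\<forall>v\<in>esum {0<..}. n v \<in> esum {0<..}"
    "\<forall>v\<in>esum {0..}. n v \<in> esum {0..}"
    by (rule translate_H[OF X])
  obtain m where m: "m \<in> Aut0 br" "\<And>x. blinfun_apply m (blinfun_apply n x) = x"
    "\<And>x. blinfun_apply n (blinfun_apply m x) = x"
    using Aut0_inverse[OF n(1)] by metis
  obtain cs where cs: "distinct cs" "\<forall>v. adprod cs H v = 0" by (rule spectrum)
  obtain e where e: "e > 0"
    "\<forall>s\<in>esum {0}. norm s < e \<longrightarrow> (\<forall>v. adprod cs (H + s) v = 0) \<longrightarrow> s = 0"
    by (rule squarefree_polynomial_rigid[OF cs(1) spec[OF cs(2)]])
  \<comment> \<open>M x has the wanted negative component; adding \<theta> (M x) makes it fixed by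
    \<theta> at the price of a positive component only.\<close>
  define A where "A x = M x + \<theta> (M x)" for x
  have A: "linear A" unfolding A_def
    using linear_compose[OF PMS(2) linear_theta] by (intro linear_compose_add PMS(2)) (simp add: o_def)
  have Ak: "A x \<in> cartan_k \<theta>" for x by (simp add: A_def cartan_k_def theta_simps add.commute)
  have EK: "expmap A x \<in> K" for x
  proof (rule expmap_induct[OF _ Ak])
    show "subspace (cartan_k \<theta>)" by (auto simp: subspace_def cartan_k_def theta_simps)
    show "id_blinfun \<in> K" using K(1) by (simp add: linear_group_def)
    fix z g assume "z \<in> cartan_k \<theta>" "g \<in> K"
    moreover from this have "ad br z \<in> lie_algebra_of K" using K(2) by simp
    then have "blinfun_exp (1 *\<^sub>R ad br z) \<in> K" unfolding lie_algebra_of_def by blast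
    ultimately show "blinfun_exp (ad br z) o\<^sub>L g \<in> K"
      using K(1) by (simp add: linear_group_def)
  qed
  have S0: "S 0 = 0" by (rule linear_0[OF PMS(3)])
  define F where "F x = expmap A x (n (expmap N x (H + S x)))" for x
  have "Ck_on 0 F UNIV"
    unfolding F_def
    by (intro Ck_on_expmap Ck_on_linear_compose[OF blinfun.bounded_linear_right] Ck_on_add Ck_on_const
        Ck_on_linear PMS(3) open_UNIV)
  then have cont: "continuous_on UNIV F" by simp
  have dS: "((\<lambda>x. H + S x) has_derivative S) (at 0)"
    using PMS(3) by (auto intro!: derivative_eq_intros bounded_linear_imp_has_derivative simp: linear_linear)
  have "((\<lambda>x. expmap N x (H + S x)) has_derivative (\<lambda>v. br (N v) (H + S 0) + S v)) (at 0)"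
    by (rule expmap_has_derivative[OF N(1) dS])
  then have "((\<lambda>x. expmap N x (H + S x)) has_derivative (\<lambda>v. P v + S v)) (at 0)"
    using N(3) by (simp add: S0)
  then have "((\<lambda>x. n (expmap N x (H + S x))) has_derivative (\<lambda>v. n (P v + S v))) (at 0)"
    by (rule bounded_linear.has_derivative[OF blinfun.bounded_linear_right])
  from expmap_has_derivative[OF A this]
  have der: "(F has_derivative (\<lambda>v. br (A v) (H + X) + n (P v + S v))) (at 0)"
    unfolding F_def by (simp add: S0 expmap_zero n(2))
  let ?F' = "\<lambda>v. br (A v) (H + X) + n (P v + S v)"
  have inj: "v = 0" if v: "?F' v = 0" for v
  proof -
    \<comment> \<open>Pulling back by \<open>m\<close> moves the base point from H + X to H. There
      br H y has no negative component, so neither has y, nor A v = n y; but the negative component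
      of A v is M v.\<close>
    define y where "y = m (A v)"
    have "m (H + X) = H" by (simp add: m(2) flip: n(2))
    then have "m (?F' v) = br y H + (P v + S v)"
      by (simp add: blinfun.add_right[of m "br _ _"] Aut0_hom[OF m(1)] y_def m(2))
    then have eq: "br y H + (P v + S v) = 0" using v by (simp add: blinfun.zero_right)
    then have "br H y = P v + S v" by (subst br_anti) (metis add_eq_0_iff2 minus_minus)
    moreover have "P v + S v \<in> esum {0..}"
      using PMS(4,6) by (intro subspace_add[OF subspace_esum] esum_weaken(1)[of "P v"] esum_weaken(3)[of "S v"]) simp_all
    ultimately have "br H y \<in> esum {0..}" by simp
    then have "y \<in> esum {0..}" by (rule br_H_in_esumD) simp
    then have "n y \<in> esum {0..}" using n(4) by blast
    then have Av: "A v \<in> esum {0..}" by (simp add: y_def m(3))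
    have "\<theta> (M v) \<in> esum (uminus ` {..<0})" using PMS(5) by (intro theta_esum) blast
    moreover have "uminus ` {..<0} \<subseteq> {0::real..}" by auto
    ultimately have "\<theta> (M v) \<in> esum {0..}" using esum_mono by blast
    with Av have "A v - \<theta> (M v) \<in> esum {0..}" by (rule subspace_diff[OF subspace_esum])
    then have "M v \<in> esum {0..}" by (simp add: A_def)
    then have Mv: "M v = 0" using PMS(5) by (intro esum_disjoint[of _ "{0..}" "{..<0}"]) auto
    then have "y = 0" by (simp add: y_def A_def theta_simps blinfun.zero_right)
    then have PS: "P v + S v = 0" using eq by (simp add: br_simps)
    then have "P v = - S v" by (simp add: eq_neg_iff_add_eq_0)
    then have "P v \<in> esum {0}" using PMS(6) by (simp add: subspace_neg[OF subspace_esum])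
    then have "P v = 0" using PMS(4) by (intro esum_disjoint[of _ "{0}" "{0<..}"]) auto
    with PS Mv PMS(7)[rule_format, of v] show "v = 0" by simp
  qed
  have lin: "linear ?F'" by (rule has_derivative_linear[OF der])
  have "inj ?F'" unfolding linear_injective_0[OF lin] using inj by blast
  then have surj: "surj ?F'" by (rule linear_injective_imp_surjective[OF lin _ refl])
  obtain B where B: "B > 0" "\<And>x. norm (S x) \<le> B * norm x"
    using linear_bounded_pos[OF PMS(3)] by metis
  \<comment> \<open>The radius e / B keeps the norm of S x below the threshold \<open>e\<close> of
    rigidity.\<close>
  have "F 0 \<in> interior (F ` ball 0 (e / B))"
    by (rule interior_image_surjective_derivative[OF cont der surj]) (use e(1) B(1) in simp)
  moreover have "F 0 = H + X" by (simp add: F_def expmap_zero S0 n(2))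
  ultimately obtain d where d: "d > 0" "ball (H + X) d \<subseteq> F ` ball 0 (e / B)"
    by (auto simp: mem_interior)
  have "\<exists>k\<in>K. \<exists>Y\<in>esum {0<..}. z = k (H + Y)"
    if z: "z \<in> adjoint_orbit br H" "dist z (H + X) < d" for z
  proof -
    have "z \<in> ball (H + X) d" using z(2) by (simp add: dist_commute)
    then obtain x where x: "z = F x" "norm x < e / B" using d(2) by auto
    have "n (expmap N x (H + S x)) \<in> adjoint_orbit br H"
      using z(1) unfolding x(1) F_def by (rule adjoint_orbit_sym[OF expmap_in_Aut0])
    then have "expmap N x (H + S x) \<in> adjoint_orbit br H"
      by (rule adjoint_orbit_sym[OF n(1)])
    then have "H + S x \<in> adjoint_orbit br H"
      by (rule adjoint_orbit_sym[OF expmap_in_Aut0])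
    then have "adprod cs (H + S x) v = 0" for v by (rule adprod_zero_orbit[OF spec[OF cs(2)]])
    moreover have "norm (S x) < e"
      using B(2)[of x] x(2) B(1) by (simp add: field_simps)
    ultimately have "S x = 0" using e(2) PMS(6) by blast
    then have zx: "z = expmap A x (n (expmap N x H))" by (simp add: x(1) F_def)
    have "unipotent (expmap N x)" by (rule unipotent_expmap) (use N(2) in blast)
    moreover have "H \<in> esum {0..}" by (rule H_in_esum) simp
    ultimately have "expmap N x H - H \<in> esum {0<..}" by (simp add: unipotent_def)
    then have "n (expmap N x H - H) \<in> esum {0<..}" using n(3) by blast
    then have "X + n (expmap N x H - H) \<in> esum {0<..}" by (rule subspace_add[OF subspace_esum X])
    moreover have "n (expmap N x H) = H + (X + n (expmap N x H - H))"
      using n(2) by (simp add: blinfun.diff_right)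
    ultimately show ?thesis using EK zx by metis
  qed
  with d(1) show ?thesis by (intro that[of d]) auto
qed

lemma adjoint_orbit_eq:
  assumes "K \<subseteq> Aut0 br" "connected_lie_subgroup K" "lie_algebra_of K = ad br ` cartan_k \<theta>"
  shows "adjoint_orbit br H = {blinfun_apply k (H + X) | k X. k \<in> K \<and> X \<in> esum {0<..}}" (is "?O = ?W")
proof -
  have grp: "linear_group K" using assms(2) by (simp add: connected_lie_subgroup_def)
  have WO: "?W \<subseteq> ?O"
    using assms(1) adjoint_orbit_Aut0 translate_in_orbit by blast
  have inv: "\<exists>h\<in>K. (\<forall>x. blinfun_apply h (blinfun_apply k x) = x) \<and> (\<forall>x. blinfun_apply k (blinfun_apply h x) = x)" if "k \<in> K" for k
  proof -
    obtain h where h: "h \<in> K" "k o\<^sub>L h = id_blinfun" "h o\<^sub>L k = id_blinfun"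
      using grp \<open>k \<in> K\<close> unfolding linear_group_def by blast
    then show ?thesis
      by (intro bexI[of _ h]) (simp_all flip: blinfun_apply_blinfun_compose)
  qed
  have W_K: "blinfun_apply k w \<in> ?W" if kw: "k \<in> K" "w \<in> ?W" for k w
  proof -
    obtain l X where l: "l \<in> K" "X \<in> esum {0<..}" "w = blinfun_apply l (H + X)" using kw(2) by blast
    then have "k o\<^sub>L l \<in> K" using grp \<open>k \<in> K\<close> by (simp add: linear_group_def)
    moreover have "blinfun_apply k w = (k o\<^sub>L l) (H + X)" by (simp add: l)
    ultimately show ?thesis using l(2) by blast
  qed
  have local: "\<exists>e>0. \<forall>z\<in>?O. dist z (H + X) < e \<longrightarrow> z \<in> ?W" if X: "X \<in> esum {0<..}" for X
  proof -
    obtain e where "e > 0"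
      "\<forall>z\<in>?O. dist z (H + X) < e \<longrightarrow> (\<exists>k\<in>K. \<exists>Y\<in>esum {0<..}. z = k (H + Y))"
      by (rule orbit_locally_K[OF grp assms(3) X])
    then show ?thesis by blast
  qed
  \<comment> \<open>Isometry with respect to \<open>ip\<close> will bound the elements of
    \<open>K\<close>, and so also their inverses, by one constant.\<close>
  have iso: "ip (blinfun_apply k x) (blinfun_apply k x) = ip x x" if "k \<in> K" for k x
    using that assms(1) Aut0_subset
    by (intro ip_automorphism connected_lie_subgroup_k_commutes[OF assms(2,3)]) auto
  obtain C where C: "C > 0" "\<And>f x. (\<And>x. ip (f x) (f x) = ip x x) \<Longrightarrow> norm (f x) \<le> C * norm x"
    using ip_isometry_bound by metis
  have bound: "norm (blinfun_apply k x) \<le> C * norm x" if "k \<in> K" for k x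
    using C(2)[of "blinfun_apply k" x] iso[OF that] by blast
  have op: "openin (top_of_set ?O) ?W"
    unfolding openin_euclidean_subtopology_iff
  proof (intro conjI WO ballI)
    fix w assume "w \<in> ?W"
    then obtain k X where k: "k \<in> K" "X \<in> esum {0<..}" "w = blinfun_apply k (H + X)" by blast
    obtain h where h: "h \<in> K" "\<forall>x. blinfun_apply h (blinfun_apply k x) = x" "\<forall>x. blinfun_apply k (blinfun_apply h x) = x"
      using inv[OF k(1)] by blast
    obtain e where e: "e > 0" "\<forall>z\<in>?O. dist z (H + X) < e \<longrightarrow> z \<in> ?W" using local[OF k(2)] by blast
    show "\<exists>e>0. \<forall>z\<in>?O. dist z w < e \<longrightarrow> z \<in> ?W"
    proof (intro exI[of _ "e / C"] conjI ballI impI)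
      show "e / C > 0" using e(1) C(1) by simp
      fix z assume z: "z \<in> ?O" "dist z w < e / C"
      have "dist (h z) (H + X) = norm (h (z - w))" using h(2) k(3) by (simp add: dist_norm blinfun.diff_right)
      also have "\<dots> \<le> C * norm (z - w)" by (rule bound[OF h(1)])
      also have "\<dots> < e" using z(2) C(1) by (simp add: dist_norm field_simps)
      finally have "h z \<in> ?W" using e(2) adjoint_orbit_Aut0 z(1) h(1) assms(1) by blast
      from W_K[OF k(1) this] show "z \<in> ?W" using h(3) by simp
    qed
  qed
  have cl: "closedin (top_of_set ?O) ?W"
    unfolding closedin_limpt
  proof (intro conjI WO allI impI, elim conjE)
    fix z assume z: "z islimpt ?W" "z \<in> ?O"
    obtain f where f: "\<forall>i::nat. f i \<in> ?W" "f \<longlonglongrightarrow> z"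
      using z(1) unfolding islimpt_sequential by blast
    have "\<forall>i. \<exists>k X. k \<in> K \<and> X \<in> esum {0<..} \<and> f i = blinfun_apply k (H + X)" using f(1) by blast
    then obtain k X where k: "\<forall>i. k i \<in> K \<and> X i \<in> esum {0<..} \<and> f i = blinfun_apply (k i) (H + X i)" by metis
    have "\<forall>i. \<exists>h. h \<in> K \<and> (\<forall>x. blinfun_apply h (blinfun_apply (k i) x) = x) \<and> (\<forall>x. blinfun_apply (k i) (blinfun_apply h x) = x)" using inv k by blast
    then obtain h where h: "\<forall>i. h i \<in> K \<and> (\<forall>x. blinfun_apply (h i) (blinfun_apply (k i) x) = x) \<and> (\<forall>x. blinfun_apply (k i) (blinfun_apply (h i) x) = x)" by metis
    have hf: "h i (f i) = H + X i" for i using h k by simp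
    have "bounded (range f)" using f(2) by (rule convergent_imp_bounded)
    then obtain b where b: "\<And>i. norm (f i) \<le> b" by (auto simp: bounded_iff)
    \<comment> \<open>The vectors X i stay bounded because H + X i is the image of f i under an
      element of \<open>K\<close>; the k i themselves need not converge.\<close>
    have "norm (X i) \<le> C * b + norm H" for i
    proof -
      have "norm (H + X i) \<le> C * norm (f i)" using bound[of "h i" "f i"] h hf by metis
      also have "\<dots> \<le> C * b" using b C(1) by simp
      finally show ?thesis using norm_triangle_ineq4[of "H + X i" H] by simp
    qed
    then have "bounded (range X)" by (auto simp: bounded_iff)
    then obtain Y r where Y: "strict_mono r" "(X \<circ> r) \<longlonglongrightarrow> Y"
      using bounded_imp_convergent_subsequence by blast
    have Yn: "Y \<in> esum {0<..}"
      by (rule closed_sequentially[OF closed_subspace[OF subspace_esum] _ Y(2)]) (use k in auto)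
    obtain e where e: "e > 0" "\<forall>z\<in>?O. dist z (H + Y) < e \<longrightarrow> z \<in> ?W" using local[OF Yn] by blast
    \<comment> \<open>This sum bounds the distance from \<open>h (r i) z\<close> to H + Y: replacing
      z by f (r i) costs at most the factor C, and the rest is X (r i) - Y.\<close>
    have "(\<lambda>i. C * norm (z - f (r i)) + norm (X (r i) - Y)) \<longlonglongrightarrow> C * norm (z - z) + norm (Y - Y)"
      using LIMSEQ_subseq_LIMSEQ[OF f(2) Y(1)] Y(2) by (intro tendsto_intros) (simp_all add: o_def)
    then have "eventually (\<lambda>i. C * norm (z - f (r i)) + norm (X (r i) - Y) < e) sequentially"
      using e(1) by (intro order_tendstoD(2)) auto
    then obtain i where i: "C * norm (z - f (r i)) + norm (X (r i) - Y) < e"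
      by (auto simp: eventually_sequentially)
    let ?h = "h (r i)"
    have "dist (?h z) (H + Y) = norm (?h (z - f (r i)) + (X (r i) - Y))"
      by (simp add: dist_norm blinfun.diff_right hf algebra_simps)
    also have "\<dots> \<le> norm (?h (z - f (r i))) + norm (X (r i) - Y)" by (rule norm_triangle_ineq)
    also have "\<dots> < e" using bound[of ?h "z - f (r i)"] h i by force
    finally have "?h z \<in> ?W" using e(2) adjoint_orbit_Aut0 z(2) h assms(1) by blast
    from W_K[OF _ this, of "k (r i)"] show "z \<in> ?W" using h k by simp
  qed
  have "id_blinfun (H + 0) \<in> ?W"
    using grp subspace_0[OF subspace_esum] unfolding linear_group_def by blast
  then have ne: "?W \<noteq> {}" by (metis empty_iff)
  have "?W = {} \<or> ?W = ?O"
    by (rule connected_adjoint_orbit[of H, unfolded connected_clopen, THEN spec, THEN mp, OF conjI[OF op cl]])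
  then show ?thesis
  proof
    assume "?W = {}"
    with ne show ?thesis by contradiction
  qed (rule sym)
qed

text \<open>This replaces roots by the single operator ad H. Joint eigenvectors of all ad A with A
  in \<aa> span the algebra; one with a positive eigenvalue under ad H lies in a root space with
  \<alpha> H > 0, and any other lies in the nonpositive part.\<close>

lemma n_plus_eq:
  assumes "maximal_abelian_in br (cartan_s \<theta>) \<aa>" "H \<in> \<aa>"
  shows "n_plus br \<aa> H = esum {0<..}"
proof
  have a: "\<theta> x = - x" "br x y = 0" if "x \<in> \<aa>" "y \<in> \<aa>" for x y
    using assms(1) that by (auto simp: maximal_abelian_in_def abelian_subspace_def cartan_s_def)
  have suba: "subspace \<aa>" using assms(1) by (simp add: maximal_abelian_in_def abelian_subspace_def)
  show sub: "n_plus br \<aa> H \<subseteq> esum {0<..}"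
    unfolding n_plus_def
  proof (rule span_minimal[OF _ subspace_esum], rule UN_least)
    fix \<alpha> assume "\<alpha> \<in> {\<alpha> \<in> roots br \<aa>. 0 < \<alpha> H}"
    then show "root_space br \<aa> \<alpha> \<subseteq> esum {0<..}"
      using assms(2) eigenvector_in_esum[of _ "\<alpha> H" "{0<..}"] by (auto simp: root_space_def)
  qed
  let ?J = "{x. \<forall>f\<in>br ` \<aa>. \<exists>c. f x = c *\<^sub>R x}"
  have "span ?J = UNIV"
  proof (rule span_joint_eigenvectors)
    show "linear f" if "f \<in> br ` \<aa>" for f using that linear_br by auto
    show "ip (f x) y = ip x (f y)" if "f \<in> br ` \<aa>" for f x y using that a by (auto simp: ip_br)
    fix f g x assume "f \<in> br ` \<aa>" "g \<in> br ` \<aa>"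
    then obtain A B where AB: "A \<in> \<aa>" "B \<in> \<aa>" "f = br A" "g = br B" by blast
    have "br A (br B x) = br (br A B) x + br B (br A x)" by (rule br_jacobi)
    then show "f (g x) = g (f x)" using a(2)[OF AB(1,2)] by (simp add: AB br_simps)
  qed
  let ?T = "{u + w | u w. u \<in> n_plus br \<aa> H \<and> w \<in> esum {..0}}"
  have subn: "subspace (n_plus br \<aa> H)" by (simp add: n_plus_def)
  have subT: "subspace ?T" by (rule subspace_sums[OF subn subspace_esum])
  have "?J \<subseteq> ?T"
  proof
    fix j assume j: "j \<in> ?J"
    show "j \<in> ?T"
    proof (cases "j \<in> esum {..0}")
      case True
      then have "j = 0 + j \<and> 0 \<in> n_plus br \<aa> H \<and> j \<in> esum {..0}" using subspace_0[OF subn] by simp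
      then show ?thesis by blast
    next
      case False
      then have j0: "j \<noteq> 0" using subspace_0[OF subspace_esum] by metis
      \<comment> \<open>The eigenvalues of j assemble to a root: \<open>restrict\<close> makes it
        extensional, and linearity follows because a nonzero j determines each eigenvalue.\<close>
      define \<alpha> where "\<alpha> = restrict (\<lambda>A. SOME c. br A j = c *\<^sub>R j) \<aa>"
      have al: "br A j = \<alpha> A *\<^sub>R j" if "A \<in> \<aa>" for A
      proof -
        have "\<exists>c. br A j = c *\<^sub>R j" using j that by blast
        from someI_ex[OF this] show ?thesis using that by (simp add: \<alpha>_def)
      qed
      have uniq: "c = d" if "c *\<^sub>R j = d *\<^sub>R j" for c d using that j0 by simp
      have "\<alpha> H > 0"
        using False eigenvector_in_esum[OF al[OF assms(2)], of "{..0}"] by force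
      moreover have "\<alpha> \<in> roots br \<aa>"
        unfolding roots_def
      proof (intro CollectI conjI ballI allI)
        show "\<alpha> \<in> extensional \<aa>" by (simp add: \<alpha>_def)
        show "\<alpha> (A + B) = \<alpha> A + \<alpha> B" if "A \<in> \<aa>" "B \<in> \<aa>" for A B
          using al[OF subspace_add[OF suba that]] al[OF that(1)] al[OF that(2)]
          by (intro uniq) (simp add: br_simps scaleR_add_left)
        show "\<alpha> (c *\<^sub>R A) = c * \<alpha> A" if "A \<in> \<aa>" for c A
          using al[OF subspace_scale[OF suba that, of c], symmetric] al[OF that]
          by (intro uniq) (simp add: br_simps)
        show "\<exists>A\<in>\<aa>. \<alpha> A \<noteq> 0" using \<open>\<alpha> H > 0\<close> assms(2) by force
        have "j \<in> root_space br \<aa> \<alpha>" using al by (simp add: root_space_def)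
        then show "root_space br \<aa> \<alpha> \<noteq> {0}" using j0 by blast
      qed
      moreover have "j \<in> root_space br \<aa> \<alpha>" using al by (simp add: root_space_def)
      ultimately have "j \<in> n_plus br \<aa> H" unfolding n_plus_def by (intro span_base) blast
      then have "j = j + 0 \<and> j \<in> n_plus br \<aa> H \<and> 0 \<in> esum {..0}"
        using subspace_0[OF subspace_esum] by simp
      then show ?thesis by blast
    qed
  qed
  then have "span ?J \<subseteq> ?T" by (rule span_minimal[OF _ subT])
  then have T: "x \<in> ?T" for x using \<open>span ?J = UNIV\<close> by blast
  show "esum {0<..} \<subseteq> n_plus br \<aa> H"
  proof
    fix x assume x: "x \<in> esum {0<..}"
    obtain u w where uw: "x = u + w" "u \<in> n_plus br \<aa> H" "w \<in> esum {..0}" using T[of x] by blast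
    have "u \<in> esum {0<..}" using sub uw(2) by blast
    with x have "x - u \<in> esum {0<..}" by (rule subspace_diff[OF subspace_esum])
    then have "w = 0" using uw by (intro esum_disjoint[of w "{0<..}" "{..0}"]) auto
    with uw show "x \<in> n_plus br \<aa> H" by simp
  qed
qed

end

section \<open>The projection onto the nilpotent part\<close>

context cartan_element
begin

definition eigenvalues :: "real list" where
  "eigenvalues = (SOME cs. \<forall>v. adprod cs H v = 0)"

text \<open>\<open>pos_image z\<close> and \<open>nonpos_image z\<close> are the maps \<open>B\<close> and \<open>C\<close> of the introduction. For \<open>z\<close> in the
  orbit of \<open>H\<close>, the sum of the positive eigenspaces of \<open>ad z\<close> is the image of \<open>B\<close> and the kernel
  of \<open>C\<close>. Off the orbit \<open>gram z\<close> may be singular, and then \<open>inv (gram z)\<close> is arbitrary.\<close>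

definition pos_image :: "'g \<Rightarrow> 'g \<Rightarrow> 'g" where
  "pos_image = adprod (filter (\<lambda>c. c \<le> 0) eigenvalues)"

definition nonpos_image :: "'g \<Rightarrow> 'g \<Rightarrow> 'g" where
  "nonpos_image = adprod (filter (\<lambda>c. c > 0) eigenvalues)"

definition gram :: "'g \<Rightarrow> 'g \<Rightarrow> 'g" where
  "gram z v = pos_image z (pos_image (- \<theta> z) v) + nonpos_image (- \<theta> z) (nonpos_image z v)"

definition nil_part :: "'g \<Rightarrow> 'g" where
  "nil_part z = pos_image z (pos_image (- \<theta> z) (inv (gram z) z))"

lemma adprod_eigenvalues: "adprod eigenvalues H v = 0"
proof -
  have "\<exists>cs. \<forall>v. adprod cs H v = 0" by (rule spectrum) blast
  from someI_ex[OF this] show ?thesis unfolding eigenvalues_def by blast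
qed

lemma eigenvalue_mem: "br H x = c *\<^sub>R x \<Longrightarrow> x \<noteq> 0 \<Longrightarrow> c \<in> set eigenvalues"
  using adprod_eigenvector[of H x c eigenvalues] adprod_eigenvalues[of x] by (auto simp: prod_list_zero_iff)

text \<open>The factors with root at most 0 cover all nonpositive eigenvalues, so the nonpositive
  part is annihilated.\<close>

lemma pos_image_H_mem: "pos_image H v \<in> esum {0<..}"
proof -
  obtain u w where uw: "u \<in> esum {0<..}" "w \<in> esum (- {0<..})" "v = u + w" by (rule esum_decompose)
  have lin: "linear (pos_image H)" by (simp add: pos_image_def linear_adprod)
  have "w \<in> {w. pos_image H w = 0}"
  proof (rule esum_induct[OF uw(2)])
    show "subspace {w. pos_image H w = 0}"
      by (simp add: subspace_def linear_0[OF lin] linear_add[OF lin] linear_cmul[OF lin])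
    fix c x assume c: "c \<in> - {0<..}" "br H x = c *\<^sub>R x"
    show "x \<in> {w. pos_image H w = 0}"
    proof (cases "x = 0")
      case False
      then have "c \<in> set (filter (\<lambda>c. c \<le> 0) eigenvalues)"
        using eigenvalue_mem[OF c(2)] c(1) by simp
      then show ?thesis by (simp add: pos_image_def adprod_eigenvector_zero[OF c(2)])
    qed (simp add: linear_0[OF lin])
  qed
  then have "pos_image H v = pos_image H u" by (simp add: uw linear_add[OF lin])
  then show ?thesis
    using adprod_mem[OF subspace_esum br_H_esum uw(1)] by (simp add: pos_image_def)
qed

text \<open>On an eigenvector with eigenvalue c > 0 the map is multiplication by a product of
  numbers c - d with d at most 0, which is nonzero.\<close>

lemma pos_image_H_surj:
  assumes "u \<in> esum {0<..}"
  obtains v where "pos_image H v = u"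
proof -
  have lin: "linear (pos_image H)" by (simp add: pos_image_def linear_adprod)
  have "u \<in> range (pos_image H)"
  proof (rule esum_induct[OF assms])
    show "subspace (range (pos_image H))"
      by (rule linear_subspace_image[OF lin subspace_UNIV])
    fix c x assume c: "c \<in> {0<..}" "br H x = c *\<^sub>R x"
    let ?p = "\<Prod>d\<leftarrow>filter (\<lambda>c. c \<le> 0) eigenvalues. c - d"
    have "?p \<noteq> 0" using c(1) by (auto simp: prod_list_zero_iff)
    then have "pos_image H ((1 / ?p) *\<^sub>R x) = x"
      by (simp add: linear_cmul[OF lin]) (simp add: pos_image_def adprod_eigenvector[OF c(2)])
    then show "x \<in> range (pos_image H)" by (metis rangeI)
  qed
  then show ?thesis using that by blast
qed

text \<open>Each factor preserves the nonpositive part, and its kernel consists of eigenvectors with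
  a positive eigenvalue.\<close>

lemma adprod_positive_inj:
  assumes "\<And>d. d \<in> set ds \<Longrightarrow> d > 0"
  shows "w \<in> esum (- {0<..}) \<Longrightarrow> adprod ds H w = 0 \<Longrightarrow> w = 0"
  using assms
proof (induction ds arbitrary: w)
  case (Cons d ds)
  have "br H w - d *\<^sub>R w \<in> esum (- {0<..})"
    by (intro subspace_diff[OF subspace_esum] br_H_esum subspace_scale[OF subspace_esum] Cons.prems)
  then have "br H w - d *\<^sub>R w = 0"
    by (rule Cons.IH) (use Cons.prems in simp_all)
  then have "w \<in> esum {0<..}"
    using Cons.prems(3)[of d] by (intro eigenvector_in_esum[of w d]) auto
  then show ?case by (rule esum_disjoint[OF _ Cons.prems(1)]) auto
qed simp

lemma nonpos_image_H_eq_0_iff: "nonpos_image H v = 0 \<longleftrightarrow> v \<in> esum {0<..}"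
proof -
  have lin: "linear (nonpos_image H)" by (simp add: nonpos_image_def linear_adprod)
  have zero: "nonpos_image H u = 0" if "u \<in> esum {0<..}" for u
  proof -
    have "u \<in> {w. nonpos_image H w = 0}"
    proof (rule esum_induct[OF that])
      show "subspace {w. nonpos_image H w = 0}"
        by (simp add: subspace_def linear_0[OF lin] linear_add[OF lin] linear_cmul[OF lin])
      fix c x assume c: "c \<in> {0<..}" "br H x = c *\<^sub>R x"
      show "x \<in> {w. nonpos_image H w = 0}"
      proof (cases "x = 0")
        case False
        then have "c \<in> set (filter (\<lambda>c. c > 0) eigenvalues)"
          using eigenvalue_mem[OF c(2)] c(1) by simp
        then show ?thesis by (simp add: nonpos_image_def adprod_eigenvector_zero[OF c(2)])
      qed (simp add: linear_0[OF lin])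
    qed
    then show ?thesis by simp
  qed
  show ?thesis
  proof
    assume v: "nonpos_image H v = 0"
    obtain u w where uw: "u \<in> esum {0<..}" "w \<in> esum (- {0<..})" "v = u + w" by (rule esum_decompose)
    have "nonpos_image H w = 0" using v zero[OF uw(1)] by (simp add: uw(3) linear_add[OF lin])
    then have "w = 0"
      unfolding nonpos_image_def by (intro adprod_positive_inj[OF _ uw(2)]) auto
    with uw show "v \<in> esum {0<..}" by simp
  qed (rule zero)
qed

lemma ip_pos_image: "ip (pos_image z v) w = ip v (pos_image (- \<theta> z) w)"
  and ip_nonpos_image: "ip (nonpos_image z v) w = ip v (nonpos_image (- \<theta> z) w)"
  by (simp_all only: pos_image_def nonpos_image_def ip_adprod)

lemma ip_nonpos_image_adjoint: "ip (nonpos_image (- \<theta> z) v) w = ip v (nonpos_image z w)"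
  using ip_nonpos_image[of "- \<theta> z" v w] by (simp add: theta_simps)

lemma linear_gram: "linear (gram z)"
  unfolding gram_def pos_image_def nonpos_image_def
  by (intro linear_compose_add linear_compose[OF linear_adprod linear_adprod, unfolded o_def])

lemma translate_n:
  assumes "linear (blinfun_apply g)" "inj (blinfun_apply g)" "\<forall>v\<in>esum {0<..}. g v \<in> esum {0<..}"
  shows "blinfun_apply g ` esum {0<..} = esum {0<..}"
proof (rule subspace_dim_equal)
  show "subspace (blinfun_apply g ` esum {0<..})"
    by (rule linear_subspace_image[OF assms(1) subspace_esum])
  have "dim (blinfun_apply g ` esum {0<..}) = dim (esum {0<..})"
    by (rule dim_image_eq[OF assms(1)]) (rule inj_on_subset[OF assms(2) subset_UNIV])
  then show "dim (esum {0<..}) \<le> dim (blinfun_apply g ` esum {0<..})" by simp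
qed (use assms(3) in auto)

text \<open>The image of B and the kernel of C are transported from H to z by an automorphism and
  agree there with \<open>?D\<close>. On \<open>?D\<close> the Gram map is then B times its adjoint,
  and on the orthogonal complement the adjoint of C times C.\<close>

lemma gram_nil_part:
  assumes k: "k \<in> Aut0 br" "\<And>x. \<theta> (blinfun_apply k x) = k (\<theta> x)" and X: "X \<in> esum {0<..}"
  shows "inj (gram (k (H + X)))" and "nil_part (k (H + X)) = k X"
proof -
  let ?z = "k (H + X)"
  obtain n where n: "n \<in> Aut0 br" "n H = H + X" "\<forall>v\<in>esum {0<..}. n v \<in> esum {0<..}"
    "\<forall>v\<in>esum {0..}. n v \<in> esum {0..}"
    by (rule translate_H[OF X])
  obtain m where m: "\<And>x. blinfun_apply m (blinfun_apply n x) = x" using Aut0_inverse[OF n(1)] by metis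
  have "inj (blinfun_apply n)" using m by (metis injI)
  from translate_n[OF linear_blinfun this n(3)] have nn: "blinfun_apply n ` esum {0<..} = esum {0<..}" .
  define g where "g = k o\<^sub>L n"
  have g: "g \<in> Aut0 br" unfolding g_def by (rule Aut0_compose[OF k(1) n(1)])
  have gH: "g H = ?z" by (simp add: g_def n(2))
  \<comment> \<open>The automorphism \<open>g\<close> need not be an isometry. That \<open>k\<close>
    has the same effect on this subspace brings orthogonality back.\<close>
  have gn: "blinfun_apply g ` esum {0<..} = blinfun_apply k ` esum {0<..}"
    unfolding g_def using nn by (simp add: image_image[symmetric] o_def)
  obtain h where h: "\<And>x. blinfun_apply h (blinfun_apply g x) = x" "\<And>x. blinfun_apply g (blinfun_apply h x) = x"
    using Aut0_inverse[OF g] by metis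
  let ?D = "blinfun_apply k ` esum {0<..}"
  have D: "subspace ?D" by (rule linear_subspace_image[OF linear_blinfun subspace_esum])
  have pos: "pos_image ?z (g v) = g (pos_image H v)" and nonpos: "nonpos_image ?z (g v) = g (nonpos_image H v)" for v
    unfolding pos_image_def nonpos_image_def gH[symmetric]
    by (rule adprod_hom[OF linear_blinfun Aut0_hom[OF g]])+
  have pos_mem: "pos_image ?z v \<in> ?D" for v
    using pos[of "h v"] pos_image_H_mem[of "h v"] unfolding gn[symmetric] by (simp add: h(2))
  have pos_surj: "\<exists>v. pos_image ?z v = d" if d: "d \<in> ?D" for d
  proof -
    obtain u where u: "u \<in> esum {0<..}" "d = g u" using d unfolding gn[symmetric] by blast
    obtain v where "pos_image H v = u" by (rule pos_image_H_surj[OF u(1)])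
    then show ?thesis using pos[of v] u(2) by blast
  qed
  have nonpos_0: "nonpos_image ?z v = 0 \<longleftrightarrow> v \<in> ?D" for v
  proof -
    have "nonpos_image ?z v = g (nonpos_image H (h v))" using nonpos[of "h v"] by (simp add: h(2))
    then have "nonpos_image ?z v = 0 \<longleftrightarrow> nonpos_image H (h v) = 0"
      using h(1)[of "nonpos_image H (h v)"] by (metis blinfun.zero_right)
    also have "\<dots> \<longleftrightarrow> h v \<in> esum {0<..}" by (rule nonpos_image_H_eq_0_iff)
    also have "\<dots> \<longleftrightarrow> v \<in> ?D" unfolding gn[symmetric] by (metis h image_iff)
    finally show ?thesis .
  qed
  \<comment> \<open>A null vector is annihilated by C, hence lies in the image of B, and by the
    adjoint of B, hence is orthogonal to that image.\<close>
  have "v = 0" if "gram ?z v = 0" for v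
  proof -
    have "ip (gram ?z v) v = ip (pos_image (- \<theta> ?z) v) (pos_image (- \<theta> ?z) v)
        + ip (nonpos_image ?z v) (nonpos_image ?z v)"
      by (simp only: gram_def ip_simps(1) ip_pos_image[of ?z] ip_nonpos_image_adjoint)
    then have "ip (pos_image (- \<theta> ?z) v) (pos_image (- \<theta> ?z) v)
        + ip (nonpos_image ?z v) (nonpos_image ?z v) = 0" using that by simp
    then have 0: "pos_image (- \<theta> ?z) v = 0" "nonpos_image ?z v = 0"
      using add_nonneg_eq_0_iff[OF ip_ge_0 ip_ge_0] ip_eq_0_iff by metis+
    from 0(2) obtain y where y: "pos_image ?z y = v" using nonpos_0 pos_surj by blast
    have "ip (pos_image ?z y) v = ip y (pos_image (- \<theta> ?z) v)" by (rule ip_pos_image)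
    then show "v = 0" by (simp add: y 0)
  qed
  then show inj: "inj (gram ?z)" unfolding linear_injective_0[OF linear_gram] by blast
  then have surj: "surj (gram ?z)" by (rule linear_injective_imp_surjective[OF linear_gram _ refl])
  let ?y = "inv (gram ?z) ?z"
  have y: "gram ?z ?y = ?z" by (rule surj_f_inv_f[OF surj])
  have iso: "ip (k a) (k b) = ip a b" for a b
    using k(1) Aut0_subset by (intro ip_automorphism k(2)) auto
  \<comment> \<open>\<open>w\<close> lies in \<open>?D\<close> and is orthogonal to it. Indeed the
    equation for \<open>?y\<close> leaves w equal to k H minus a vector in the image of the adjoint
    of C, and both are orthogonal to the kernel of C.\<close>
  define w where "w = nil_part ?z - k X"
  have "w \<in> ?D"
    unfolding w_def nil_part_def by (rule subspace_diff[OF D pos_mem imageI[OF X]])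
  moreover have "ip d w = 0" if d: "d \<in> ?D" for d
  proof -
    obtain u where u: "u \<in> esum {0<..}" "d = k u" using d by blast
    have "w = k H - nonpos_image (- \<theta> ?z) (nonpos_image ?z ?y)"
      using y unfolding w_def nil_part_def gram_def by (simp add: blinfun.add_right algebra_simps)
    moreover have "ip d (k H) = 0"
      using esum_orthogonal[OF u(1) H_in_esum[of "{0}"]] by (simp add: u(2) iso)
    moreover have "ip d (nonpos_image (- \<theta> ?z) (nonpos_image ?z ?y)) = 0"
      using nonpos_0[of d] d by (simp flip: ip_nonpos_image)
    ultimately show ?thesis by simp
  qed
  ultimately have "ip w w = 0" by blast
  then have "w = 0" by (simp only: ip_eq_0_iff)
  then show "nil_part ?z = k X" by (simp add: w_def)
qed

text \<open>The Gram map stays invertible near each point of S, so \<open>nil_part\<close> serves as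
  its own smooth extension to an open set.\<close>

lemma smooth_nil_part:
  assumes "\<And>z. z \<in> S \<Longrightarrow> inj (gram z)"
  shows "smooth_map_on nil_part S"
  unfolding smooth_map_on_def
proof
  fix z0 assume z0: "z0 \<in> S"
  have lmt: "linear (\<lambda>z. - \<theta> z)" by (intro linear_compose_neg linear_theta)
  have lid: "linear (\<lambda>z::'g. z)" by (simp add: linear_id[unfolded id_def])
  have Ckp: "Ck_on n (\<lambda>z. pos_image z (pos_image (- \<theta> z) v)) UNIV" for n v
    unfolding pos_image_def
    by (rule Ck_on_adprod[OF lid Ck_on_adprod[OF lmt Ck_on_const[OF open_UNIV]]])
  have Ckn: "Ck_on n (\<lambda>z. nonpos_image (- \<theta> z) (nonpos_image z v)) UNIV" for n v
    unfolding nonpos_image_def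
    by (rule Ck_on_adprod[OF lmt Ck_on_adprod[OF lid Ck_on_const[OF open_UNIV]]])
  have Ckg: "Ck_on n (\<lambda>z. gram z v) UNIV" for n v
    unfolding gram_def by (rule Ck_on_add[OF Ckp Ckn open_UNIV])
  obtain U c where U: "open U" "z0 \<in> U" "c > 0" "\<forall>z v. z \<in> U \<longrightarrow> c * norm v \<le> norm (gram z v)"
    using linear_family_bounded_below[OF open_UNIV linear_gram Ck_on_imp_continuous_on[OF Ckg] UNIV_I assms[OF z0]]
    by metis
  have inj: "inj (gram z)" if "z \<in> U" for z
    unfolding linear_injective_0[OF linear_gram]
  proof (intro allI impI)
    fix v assume "gram z v = 0"
    then have "c * norm v \<le> 0" using U(4) that by (metis norm_zero)
    then show "v = 0" using U(3) by (simp add: mult_le_0_iff)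
  qed
  have bij: "inv (gram z) (gram z v) = v" "gram z (inv (gram z) v) = v" if "z \<in> U" for z v
    using inj[OF that] linear_injective_imp_surjective[OF linear_gram inj[OF that] refl]
    by (simp_all add: surj_f_inv_f)
  have linv: "linear (inv (gram z))" if "z \<in> U" for z
  proof (rule linearI)
    show "inv (gram z) (x + y) = inv (gram z) x + inv (gram z) y" for x y
      by (rule inv_f_eq[OF inj[OF that]]) (simp add: linear_add[OF linear_gram] bij(2)[OF that])
    show "inv (gram z) (a *\<^sub>R x) = a *\<^sub>R inv (gram z) x" for a x
      by (rule inv_f_eq[OF inj[OF that]]) (simp add: linear_cmul[OF linear_gram] bij(2)[OF that])
  qed
  have Ckinv: "Ck_on n (\<lambda>z. inv (gram z) v) U" for n v
    by (rule Ck_on_inverse_family[OF U(1) linear_gram Ck_on_subset[OF Ckg subset_UNIV] linv bij])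
  have Ckiz: "Ck_on n (\<lambda>z. inv (gram z) z) U" for n
    by (rule Ck_on_family_apply[where M = "\<lambda>z. inv (gram z)", OF U(1) linv Ckinv Ck_on_linear[OF lid U(1)]])
  have "linear (\<lambda>v. pos_image z (pos_image (- \<theta> z) v))" for z
    unfolding pos_image_def by (rule linear_compose[OF linear_adprod linear_adprod, unfolded o_def])
  then have "Ck_on n nil_part U" for n
    unfolding nil_part_def[abs_def]
    using Ck_on_family_apply[where M = "\<lambda>z v. pos_image z (pos_image (- \<theta> z) v)",
        OF U(1) _ Ck_on_subset[OF Ckp subset_UNIV] Ckiz] by blast
  then show "\<exists>U F. open U \<and> z0 \<in> U \<and> (\<forall>n. Ck_on n F U) \<and> (\<forall>y\<in>S \<inter> U. F y = nil_part y)"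
    using U by (intro exI[of _ U] exI[of _ nil_part]) auto
qed

lemma smooth_scale_nil_part:
  assumes "\<And>z. z \<in> S \<Longrightarrow> inj (gram z)"
  shows "smooth_map_on (\<lambda>z. z + a *\<^sub>R nil_part z) S"
  unfolding smooth_map_on_def
proof
  fix z assume "z \<in> S"
  obtain U F where UF: "open U \<and> z \<in> U \<and> (\<forall>n. Ck_on n F U) \<and> (\<forall>y\<in>S \<inter> U. F y = nil_part y)"
    by (rule smooth_map_onE[OF smooth_nil_part[OF assms] \<open>z \<in> S\<close>])
  have lid: "linear (\<lambda>z::'g. z)" by (simp add: linear_id[unfolded id_def])
  have "Ck_on n (\<lambda>z. z + a *\<^sub>R F z) U" for n
    by (rule Ck_on_add[OF Ck_on_linear[OF lid] Ck_on_linear_compose[OF bounded_linear_scaleR_right]])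
      (use UF in simp_all)
  then show "\<exists>U G. open U \<and> z \<in> U \<and> (\<forall>n. Ck_on n G U) \<and> (\<forall>y\<in>S \<inter> U. G y = y + a *\<^sub>R nil_part y)"
    using UF by (intro exI[of _ U] exI[of _ "\<lambda>z. z + a *\<^sub>R F z"]) auto
qed

end

section \<open>The deformed orbit\<close>

lemma deform_eq: "deform \<theta> r z = ((r + 1) / 2) *\<^sub>R z + ((r - 1) / 2) *\<^sub>R \<theta> z"
  by (simp add: deform_def scaleR_add_right scaleR_diff_right add_divide_distrib diff_divide_distrib
      scaleR_add_left scaleR_diff_left)

lemma deform_deform:
  assumes "linear \<theta>" "\<And>x. \<theta> (\<theta> x) = x" "r * q = 1"
  shows "deform \<theta> r (deform \<theta> q z) = z"
proof -
  let ?a = "\<lambda>r. (r + 1) / 2" and ?b = "\<lambda>r. (r - 1) / 2 :: real"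
  have "\<theta> (deform \<theta> q z) = ?a q *\<^sub>R \<theta> z + ?b q *\<^sub>R z"
    by (simp only: deform_eq linear_add[OF assms(1)] linear_cmul[OF assms(1)] assms(2))
  then have "deform \<theta> r (deform \<theta> q z)
      = ?a r *\<^sub>R (?a q *\<^sub>R z + ?b q *\<^sub>R \<theta> z) + ?b r *\<^sub>R (?a q *\<^sub>R \<theta> z + ?b q *\<^sub>R z)"
    by (subst deform_eq) (simp only: deform_eq[of \<theta> q])
  also have "\<dots> = (?a r * ?a q + ?b r * ?b q) *\<^sub>R z + (?a r * ?b q + ?b r * ?a q) *\<^sub>R \<theta> z"
    by (simp only: scaleR_add_right scaleR_add_left scaleR_scaleR ac_simps)
  also have "?a r * ?a q + ?b r * ?b q = 1"
    using assms(3) by (simp add: field_simps)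
  also have "?a r * ?b q + ?b r * ?a q = 0"
    using assms(3) by (simp add: field_simps)
  finally show ?thesis by simp
qed

text \<open>By \<open>deform_eq\<close> the coefficient of z in the deformation is (r + 1) / 2;
  scaling by its reciprocal normalizes it to 1, as in \<open>psi\<close>.\<close>

lemma deform_scaled_eq_psi:
  assumes "r > 0" "linear \<theta>"
  shows "deform \<theta> r ((2 / (r + 1)) *\<^sub>R z) = psi \<theta> r z"
proof -
  have "(r + 1) / 2 * (2 / (r + 1)) = 1" "(r - 1) / 2 * (2 / (r + 1)) = (r - 1) / (r + 1)"
    using assms(1) by (simp_all add: field_simps)
  then show ?thesis by (simp only: deform_eq psi_def linear_cmul[OF assms(2)] scaleR_scaleR scaleR_one)
qed

lemma weyl_chamber_closure:
  assumes "weyl_chamber br \<aa> C" "subspace \<aa>" "x \<in> closure C"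
  shows "x \<in> \<aa>"
proof -
  have "C \<subseteq> \<aa>"
    using assms(1) in_components_subset unfolding weyl_chamber_def by fast
  then have "closure C \<subseteq> \<aa>" by (rule closure_minimal[OF _ closed_subspace[OF assms(2)]])
  with assms(3) show ?thesis by blast
qed

theorem theorem9:
  fixes br :: "'g::euclidean_space \<Rightarrow> 'g \<Rightarrow> 'g"
    and \<theta> :: "'g \<Rightarrow> 'g"
    and \<aa> \<aa>\<^sub>p :: "'g set"
    and K :: "('g \<Rightarrow>\<^sub>L 'g) set"
    and H :: 'g and r :: real
  assumes "semisimple br" and "\<not> compact_type br"
    and "cartan_involution br \<theta>"
    and "maximal_abelian_in br (cartan_s \<theta>) \<aa>"
    and "weyl_chamber br \<aa> \<aa>\<^sub>p"
    and "K \<subseteq> Aut0 br" and "connected_lie_subgroup K" and "lie_algebra_of K = ad br ` cartan_k \<theta>"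
    and "H \<in> closure \<aa>\<^sub>p" and "r > 0"
  shows "embedded_submanifold (adjoint_orbit br H)
    \<and> embedded_submanifold (adjoint_orbit (deformed_bracket br \<theta> r) H)
    \<and> adjoint_orbit br H = {blinfun_apply k (H + X) | k X. k \<in> K \<and> X \<in> n_plus br \<aa> H}
    \<and> (\<exists>\<psi>t. (\<forall>k\<in>K. \<forall>X\<in>n_plus br \<aa> H. 
             \<psi>t (blinfun_apply k (H + X)) = blinfun_apply k (H + psi \<theta> r X))
         \<and> diffeomorphism \<psi>t (adjoint_orbit br H) (adjoint_orbit (deformed_bracket br \<theta> r) H))"
proof -
  have Ha: "H \<in> \<aa>"
    by (rule weyl_chamber_closure[OF assms(5) _ assms(9)])
      (use assms(4) in \<open>simp add: maximal_abelian_in_def abelian_subspace_def\<close>)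
  then have "\<theta> H = - H" using assms(4) by (auto simp: maximal_abelian_in_def cartan_s_def)
  moreover have lie: "lie_algebra br" using assms(1) by (simp add: semisimple_def)
  ultimately interpret cartan_element br \<theta> H by unfold_locales (use assms(3) in simp_all)
  let ?O = "adjoint_orbit br H" and ?n = "esum {0<..}"
  have n: "n_plus br \<aa> H = ?n" by (rule n_plus_eq[OF assms(4) Ha])
  have orbit: "?O = {blinfun_apply k (H + X) | k X. k \<in> K \<and> X \<in> ?n}"
    by (rule adjoint_orbit_eq[OF assms(6-8)])
  have commute: "\<theta> (blinfun_apply k x) = k (\<theta> x)" if "k \<in> K" for k x
    by (rule connected_lie_subgroup_k_commutes[OF assms(7,8) that])
  note nil = gram_nil_part[OF subsetD[OF assms(6)] commute]
  have inj: "inj (gram z)" if "z \<in> ?O" for z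
    using that nil(1) unfolding orbit by blast

  let ?T = "deform \<theta> r" and ?T' = "deform \<theta> (1 / r)"
  have TT': "?T (?T' z) = z" "?T' (?T z) = z" for z
    using assms(10) by (simp_all add: deform_deform linear_theta)
  have lT: "linear ?T" "linear ?T'" by (simp_all add: linear_deform linear_theta)
  have TH: "?T H = H" by (rule deform_s) (simp add: cartan_s_def theta_H)
  have T_k: "?T (blinfun_apply k x) = k (?T x)" if "k \<in> K" for k x
    by (simp add: deform_def commute[OF that] blinfun.add_right blinfun.diff_right blinfun.scaleR_right)
  have "inv ?T = ?T'" by (rule inv_equality) (simp_all add: TT')
  then have "deformed_bracket br \<theta> r = (\<lambda>x y. ?T (br (?T' x) (?T' y)))"
    by (simp add: deformed_bracket_def fun_eq_iff)
  then have orbit_r: "adjoint_orbit (deformed_bracket br \<theta> r) H = ?T ` ?O"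
    using adjoint_orbit_conjugate[OF lie lT TT'(2,1), of H] by (simp add: TH)

  \<comment> \<open>On z = k (H + X) this adds (c - 1) k X, which scales X by c without choosing k
    and X. It is multiplicative in c, so reciprocal factors give inverse maps of the orbit.\<close>
  define sc where "sc c z = z + (c - 1) *\<^sub>R nil_part z" for c z
  have sc: "sc c (blinfun_apply k (H + X)) = k (H + c *\<^sub>R X)" if "k \<in> K" "X \<in> ?n" for c k X
    using nil(2)[OF that(1) that(1) that(2)]
    by (simp add: sc_def blinfun.add_right blinfun.scaleR_right algebra_simps)
  have sc_mem: "sc c z \<in> ?O" if z: "z \<in> ?O" for c z
  proof -
    obtain k X where kX: "k \<in> K" "X \<in> ?n" "z = blinfun_apply k (H + X)" using z unfolding orbit by blast
    have "c *\<^sub>R X \<in> ?n" by (rule subspace_scale[OF subspace_esum kX(2)])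
    then show ?thesis unfolding orbit kX(3) sc[OF kX(1,2)] using kX(1) by blast
  qed
  have sc_sc: "sc c (sc d z) = z" if z: "z \<in> ?O" and cd: "c * d = 1" for c d z
  proof -
    obtain k X where kX: "k \<in> K" "X \<in> ?n" "z = blinfun_apply k (H + X)" using z unfolding orbit by blast
    have "d *\<^sub>R X \<in> ?n" by (rule subspace_scale[OF subspace_esum kX(2)])
    then show ?thesis unfolding kX(3) sc[OF kX(1,2)] by (simp add: sc[OF kX(1)] cd)
  qed
  have smooth_sc: "smooth_map_on (sc c) ?O" for c
    unfolding sc_def[abs_def] by (rule smooth_scale_nil_part[OF inj])

  let ?c = "2 / (r + 1)" and ?d = "(r + 1) / 2"
  have cd: "?c * ?d = 1" "?d * ?c = 1" using assms(10) by simp_all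
  have "diffeomorphism (\<lambda>z. ?T (sc ?c z)) ?O (?T ` ?O)"
  proof (rule diffeomorphismI[of _ _ "\<lambda>y. sc ?d (?T' y)"])
    show "smooth_map_on (\<lambda>z. ?T (sc ?c z)) ?O"
      by (rule smooth_map_on_compose[OF smooth_sc smooth_map_on_linear[OF lT(1)]]) (rule subset_UNIV)
    have "?T' ` ?T ` ?O \<subseteq> ?O" by (simp add: image_image TT')
    then show "smooth_map_on (\<lambda>y. sc ?d (?T' y)) (?T ` ?O)"
      by (rule smooth_map_on_compose[OF smooth_map_on_linear[OF lT(2)] smooth_sc])
    show "(\<lambda>z. ?T (sc ?c z)) ` ?O \<subseteq> ?T ` ?O" using sc_mem by blast
    show "(\<lambda>y. sc ?d (?T' y)) ` ?T ` ?O \<subseteq> ?O" using sc_mem by (auto simp: TT')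
    show "sc ?d (?T' (?T (sc ?c z))) = z" if "z \<in> ?O" for z
      by (simp only: TT' sc_sc[OF that cd(2)])
    show "?T (sc ?c (sc ?d (?T' y))) = y" if "y \<in> ?T ` ?O" for y
      using that sc_sc[OF _ cd(1)] by (auto simp: TT')
  qed
  moreover have "?T (sc ?c (blinfun_apply k (H + X))) = k (H + psi \<theta> r X)" if "k \<in> K" "X \<in> ?n" for k X
    by (simp only: sc[OF that] T_k[OF that(1)] linear_add[OF lT(1)] TH
        deform_scaled_eq_psi[OF assms(10) linear_theta])
  ultimately have "\<exists>\<psi>t. (\<forall>k\<in>K. \<forall>X\<in>?n. \<psi>t (blinfun_apply k (H + X)) = blinfun_apply k (H + psi \<theta> r X))
      \<and> diffeomorphism \<psi>t ?O (?T ` ?O)"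
    by (intro exI[of _ "\<lambda>z. ?T (sc ?c z)"]) auto
  moreover have "embedded_submanifold (?T ` ?O)"
    by (rule embedded_submanifold_linear_image[OF lT TT'(2,1) embedded_adjoint_orbit])
  ultimately show ?thesis
    unfolding n orbit_r using embedded_adjoint_orbit orbit by blast
qed

end
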